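(* Let $\mathbb H=\mathbb H(V,\Phi,k)$ be the graded affine Hecke algebra attached to a real root system $\Phi$ and a $W$-invariant parameter function $k:\Phi\to\mathbb C$. In $\mathbb H\otimes\mathcal W(V\oplus V^*,\omega)$, $$[D^+,D^-]=-\Omega_{\mathbb H}\otimes1+\Omega_W\otimes1-\frac14\sum_{\{\alpha,\beta\}\in\Phi_2^+}k_\alpha k_\beta\frac1{B(\alpha^\vee,\beta^\vee)}[s_\alpha,s_\beta]\otimes\nu'([s_\alpha,s_\beta])$$ $$=\big(-\Omega_{\mathbb H}+\Omega_W+\Omega'_W\big)\otimes1-\Delta(\Omega'_W)+1\otimes\nu'(\Omega'_W),$$ where $\Omega_{\mathbb H}=\sum_iv_iv^i\in Z(\mathbb H)$ and $\Omega_W,\Omega'_W\in\mathbb C[W]^W$ are given by $$\Omega_W=\frac14\sum_{\alpha,\beta>0}k_\alpha k_\beta B(\alpha,\beta)s_\alpha s_\beta,\qquad \Omega'_W=\frac1{16}\sum_{\alpha,\beta>0}k_\alpha k_\beta\frac1{B(\alpha^\vee,\beta^\vee)}[s_\alpha,s_\beta]^2.$$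
   Context: $(V_0^*,\Phi,V_0,\Phi^\vee)$ is a real (reduced) root system with coroots $\alpha^\vee\in V_0$, reflections $s_\alpha(v)=v-\alpha(v)\alpha^\vee$, finite Weyl group $W$, and $B$ a positive-definite $W$-invariant symmetric bilinear form on $V_0$; $V=\mathbb C\otimes_{\mathbb R} V_0$, $B$ is extended complex-bilinearly to $V$, and $B$ also denotes the dual form on $V^*$. Fix positive roots $\Phi^+$ with simple roots $\Pi$; $\alpha>0$ means $\alpha\in\Phi^+$. $\Phi_2^+$ is the set of unordered pairs $\{\alpha,\beta\}$ with $\alpha\neq\beta$ in $\Phi^+$. $\mathbb C[W]^W$ denotes the conjugation-invariant elements. $\mathbb H$ is the associative unital algebra generated by $\mathbb C[W]$ and $V$, with the elements of $V$ commuting with each other and with $v\cdot s_\alpha-s_\alpha\cdot s_\alpha(v)=k_\alpha\alpha(v)$ for $v\in V,\alpha\in\Pi$. For $v\in V$ put $T_v=\frac12\sum_{\alpha>0}k_\alpha\alpha(v)s_\alpha$ and $\widetilde v=v-T_v$. $\mathcal W=\mathcal W(V\oplus V^*,\omega)$ is the Weyl algebra: the quotient of the tensor algebra of $V\oplus V^*$ by $vw-wv=\omega(v,w)$, where $V,V^*$ are isotropic and $\omega(\lambda,v)=\lambda(v)$ for $\lambda\in V^*,v\in V$. For a basis $\{v_i\}$ of $V$ with $B$-dual basis $\{v^i\}\subset V$ and dual basis $\{v_i^*\}\subset V^*$: $D^-=\sum_i\widetilde v_i\otimes v_i^*$, $D^+=\sum_i\widetilde v_i\otimes v^i$. $\nu':\mathfrak{so}(V,B)\to\mathcal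 W$ is $\nu'(f)=\sum_if(v_i)v_i^*$; the commutator $[s_\alpha,s_\beta]=s_\alpha s_\beta-s_\beta s_\alpha$ acts on $V$ as an element of $\mathfrak{so}(V,B)$. Set $\Delta([s_\alpha,s_\beta])=[s_\alpha,s_\beta]\otimes1+1\otimes\nu'([s_\alpha,s_\beta])\in\mathbb H\otimes\mathcal W$, and $$\nu'(\Omega'_W)=\tfrac1{16}\sum_{\alpha,\beta>0}\tfrac{k_\alpha k_\beta}{B(\alpha^\vee,\beta^\vee)}\nu'([s_\alpha,s_\beta])^2,\qquad \Delta(\Omega'_W)=\tfrac1{16}\sum_{\alpha,\beta>0}\tfrac{k_\alpha k_\beta}{B(\alpha^\vee,\beta^\vee)}\Delta([s_\alpha,s_\beta])^2.$$ In all these sums, pairs with $B(\alpha^\vee,\beta^\vee)=0$ (for which $[s_\alpha,s_\beta]=0$) contribute $0$. *)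

theory Defs
  imports
    Complex_Main
    "HOL-Library.Poly_Mapping"
    "HOL-Library.Product_Plus"
    "HOL-Algebra.Module"
    "HOL-Algebra.QuotRing"
    "HOL-Algebra.Bij"
    "HOL-Algebra.Elementary_Groups"
begin

section \<open>Complex algebras\<close>

text \<open>A complex algebra is a record of type \<^typ>\<open>(complex, 'a) module\<close>: a (not necessarily commutative)
  ring structure together with a scalar multiplication \<open>\<odot>\<close> by complex numbers.\<close>

definition monoid_algebra ::
    "('m, 'x) monoid_scheme \<Rightarrow> (complex, 'm \<Rightarrow>\<^sub>0 complex) module" where
  "monoid_algebra M = \<lparr>
     carrier = {f. Poly_Mapping.keys f \<subseteq> carrier M},
     mult = (\<lambda>f g. \<Sum>x\<in>Poly_Mapping.keys f. \<Sum>y\<in>Poly_Mapping.keys g.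
        Poly_Mapping.single (x \<otimes>\<^bsub>M\<^esub> y) (Poly_Mapping.lookup f x * Poly_Mapping.lookup g y)),
     one = Poly_Mapping.single \<one>\<^bsub>M\<^esub> 1,
     zero = 0,
     add = (+),
     smult = (\<lambda>c. Poly_Mapping.map ((*) c)) \<rparr>"

definition quot_algebra ::
    "(complex, 'a) module \<Rightarrow> 'a set \<Rightarrow> (complex, 'a set) module" where
  "quot_algebra A J = \<lparr>
     carrier = carrier (A Quot J),
     mult = mult (A Quot J),
     one = one (A Quot J),
     zero = zero (A Quot J),
     add = add (A Quot J),
     smult = (\<lambda>c X. \<Union>x\<in>X. J +>\<^bsub>A\<^esub> (c \<odot>\<^bsub>A\<^esub> x)) \<rparr>"

definition commutator :: "('a, 'x) ring_scheme \<Rightarrow> 'a \<Rightarrow> 'a \<Rightarrow> 'a" where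
  "commutator A x y = x \<otimes>\<^bsub>A\<^esub> y \<ominus>\<^bsub>A\<^esub> y \<otimes>\<^bsub>A\<^esub> x"

definition alg_center :: "('a, 'x) ring_scheme \<Rightarrow> 'a set" where
  "alg_center A = {z \<in> carrier A. \<forall>x\<in>carrier A. z \<otimes>\<^bsub>A\<^esub> x = x \<otimes>\<^bsub>A\<^esub> z}"


subsection \<open>Generators and relations\<close>

definition free_algebra :: "'g set \<Rightarrow> (complex, 'g list \<Rightarrow>\<^sub>0 complex) module" where
  "free_algebra G = monoid_algebra \<lparr>carrier = lists G, mult = (@), one = []\<rparr>"

definition gen :: "'g \<Rightarrow> 'g list \<Rightarrow>\<^sub>0 complex" where
  "gen x = Poly_Mapping.single [x] 1"

text \<open>A relation \<open>l = r\<close> is represented by the element \<open>l - r\<close> of the free algebra. Ideals of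
  \<^theory>\<open>HOL-Algebra.Ideal\<close> are two-sided.\<close>

definition presented_algebra ::
    "'g set \<Rightarrow> ('g list \<Rightarrow>\<^sub>0 complex) set \<Rightarrow> (complex, ('g list \<Rightarrow>\<^sub>0 complex) set) module" where
  "presented_algebra G R = quot_algebra (free_algebra G) (Idl\<^bsub>free_algebra G\<^esub> R)"

definition presented_gen ::
    "'g set \<Rightarrow> ('g list \<Rightarrow>\<^sub>0 complex) set \<Rightarrow> 'g \<Rightarrow> ('g list \<Rightarrow>\<^sub>0 complex) set" where
  "presented_gen G R x = (Idl\<^bsub>free_algebra G\<^esub> R) +>\<^bsub>free_algebra G\<^esub> gen x"

text \<open>The relations making \<open>u \<mapsto> gen (j u)\<close> linear on a complex vector space with carrier \<open>U\<close> and
  operations \<open>pl\<close>, \<open>sc\<close>. The free algebra on \<open>U\<close> modulo these relations is the tensor algebra of \<open>U\<close>.\<close>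

definition linear_relations ::
    "('u \<Rightarrow> 'g) \<Rightarrow> 'u set \<Rightarrow> ('u \<Rightarrow> 'u \<Rightarrow> 'u) \<Rightarrow> (complex \<Rightarrow> 'u \<Rightarrow> 'u) \<Rightarrow> ('g list \<Rightarrow>\<^sub>0 complex) set" where
  "linear_relations j U pl sc =
     {gen (j (pl u w)) - (gen (j u) + gen (j w)) | u w. u \<in> U \<and> w \<in> U} \<union>
     {gen (j (sc c u)) - Poly_Mapping.map ((*) c) (gen (j u)) | c u. u \<in> U}"


subsection \<open>Tensor product of algebras\<close>

text \<open>The free vector space on \<open>A \<times> A'\<close> modulo bilinearity. The free vector space is the monoid algebra of
  the product of the multiplicative monoids, so \<open>(a \<otimes> b)(a' \<otimes> b') = a a' \<otimes> b b'\<close>; the span of the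
  bilinearity relations is already a two-sided ideal of it.\<close>

definition bilinear_relations ::
    "(complex, 'a) module \<Rightarrow> (complex, 'b) module \<Rightarrow> ('a \<times> 'b \<Rightarrow>\<^sub>0 complex) set" where
  "bilinear_relations A A' =
    (let t = (\<lambda>a b. Poly_Mapping.single (a, b) (1::complex)); s = (\<lambda>c. Poly_Mapping.map ((*) c)) in
     {t (a \<oplus>\<^bsub>A\<^esub> a') b - (t a b + t a' b) | a a' b. a \<in> carrier A \<and> a' \<in> carrier A \<and> b \<in> carrier A'} \<union>
     {t a (b \<oplus>\<^bsub>A'\<^esub> b') - (t a b + t a b') | a b b'. a \<in> carrier A \<and> b \<in> carrier A' \<and> b' \<in> carrier A'} \<union>
     {t (c \<odot>\<^bsub>A\<^esub> a) b - s c (t a b) | c a b. a \<in> carrier A \<and> b \<in> carrier A'} \<union>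
     {t a (c \<odot>\<^bsub>A'\<^esub> b) - s c (t a b) | c a b. a \<in> carrier A \<and> b \<in> carrier A'})"

definition tensor_ideal ::
    "(complex, 'a) module \<Rightarrow> (complex, 'b) module \<Rightarrow> ('a \<times> 'b \<Rightarrow>\<^sub>0 complex) set" where
  "tensor_ideal A A' = Idl\<^bsub>monoid_algebra (A \<times>\<times> A')\<^esub> (bilinear_relations A A')"

definition tensor_algebra ::
    "(complex, 'a) module \<Rightarrow> (complex, 'b) module \<Rightarrow> (complex, ('a \<times> 'b \<Rightarrow>\<^sub>0 complex) set) module" where
  "tensor_algebra A A' = quot_algebra (monoid_algebra (A \<times>\<times> A')) (tensor_ideal A A')"

definition pure_tensor ::
    "(complex, 'a) module \<Rightarrow> (complex, 'b) module \<Rightarrow> 'a \<Rightarrow> 'b \<Rightarrow> ('a \<times> 'b \<Rightarrow>\<^sub>0 complex) set" where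
  "pure_tensor A A' a b =
     tensor_ideal A A' +>\<^bsub>monoid_algebra (A \<times>\<times> A')\<^esub> Poly_Mapping.single (a, b) 1"


section \<open>The complexification \<open>V\<close> of \<open>V\<^sub>0\<close> and its dual\<close>

text \<open>The pair \<open>(x, y)\<close> stands for \<open>1 \<otimes> x + \<i> \<otimes> y\<close> in \<open>\<complex> \<otimes> V\<^sub>0\<close>.\<close>

type_synonym 'v cx = "'v \<times> 'v"

definition cscale :: "complex \<Rightarrow> 'v::real_vector cx \<Rightarrow> 'v cx" where
  "cscale c u = (Re c *\<^sub>R fst u - Im c *\<^sub>R snd u, Re c *\<^sub>R snd u + Im c *\<^sub>R fst u)"

lemma vector_space_cscale: "vector_space (cscale :: complex \<Rightarrow> 'v::real_vector cx \<Rightarrow> 'v cx)"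
  by unfold_locales (auto simp: cscale_def algebra_simps)

definition cdual :: "('v::real_vector cx \<Rightarrow> complex) set" where
  "cdual = {l. Vector_Spaces.linear cscale (*) l}"

text \<open>Complex-linear extension of a real functional; this is the inclusion of \<open>V\<^sub>0\<^sup>*\<close> into \<open>V\<^sup>*\<close>.\<close>

definition cext :: "('v \<Rightarrow> real) \<Rightarrow> 'v cx \<Rightarrow> complex" where
  "cext l u = complex_of_real (l (fst u)) + \<i> * complex_of_real (l (snd u))"

definition cext_form :: "('v \<Rightarrow> 'v \<Rightarrow> real) \<Rightarrow> 'v cx \<Rightarrow> 'v cx \<Rightarrow> complex" where
  "cext_form B u w =
     complex_of_real (B (fst u) (fst w) - B (snd u) (snd w)) +
     \<i> * complex_of_real (B (fst u) (snd w) + B (snd u) (fst w))"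

text \<open>The form on \<open>V\<^sup>*\<close> obtained by transport along the isomorphism \<open>u \<mapsto> B(u, -)\<close> from \<open>V\<close> to \<open>V\<^sup>*\<close>.\<close>

definition sharp :: "('v \<Rightarrow> 'v \<Rightarrow> real) \<Rightarrow> ('v cx \<Rightarrow> complex) \<Rightarrow> 'v cx" where
  "sharp B l = (THE u. \<forall>w. cext_form B u w = l w)"

definition dual_form ::
    "('v \<Rightarrow> 'v \<Rightarrow> real) \<Rightarrow> ('v cx \<Rightarrow> complex) \<Rightarrow> ('v cx \<Rightarrow> complex) \<Rightarrow> complex" where
  "dual_form B l m = cext_form B (sharp B l) (sharp B m)"


section \<open>Root systems\<close>

text \<open>Roots are linear functionals on \<open>V\<^sub>0 = 'v\<close>, coroots are vectors. The field \<^term>\<open>simple_roots\<close> is \<open>\<Pi>\<close>,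
  \<open>form\<close> is \<open>B\<close> and \<open>param\<close> is \<open>k\<close>.\<close>

record 'v hecke_datum =
  roots :: "('v \<Rightarrow> real) set"
  coroot :: "('v \<Rightarrow> real) \<Rightarrow> 'v"
  simple_roots :: "('v \<Rightarrow> real) set"
  form :: "'v \<Rightarrow> 'v \<Rightarrow> real"
  param :: "('v \<Rightarrow> real) \<Rightarrow> complex"

definition refl :: "'v::real_vector hecke_datum \<Rightarrow> ('v \<Rightarrow> real) \<Rightarrow> 'v \<Rightarrow> 'v" where
  "refl D \<alpha> v = v - \<alpha> v *\<^sub>R coroot D \<alpha>"

text \<open>The reflection in \<open>V\<^sub>0\<^sup>*\<close> is \<open>\<beta> \<mapsto> \<beta> - \<beta>(\<alpha>\<^sup>\<or>) \<alpha>\<close>. Neither integrality of the \<open>\<beta>(\<alpha>\<^sup>\<or>)\<close> nor that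
  the roots span is required; the last clause is reducedness.\<close>

definition real_root_system :: "'v::real_vector hecke_datum \<Rightarrow> bool" where
  "real_root_system D \<longleftrightarrow>
     finite (roots D) \<and>
     (\<forall>\<alpha>\<in>roots D. linear \<alpha>) \<and>
     inj_on (coroot D) (roots D) \<and>
     (\<forall>\<alpha>\<in>roots D. \<alpha> (coroot D \<alpha>) = 2) \<and>
     (\<forall>\<alpha>\<in>roots D. (\<lambda>\<beta> v. \<beta> v - \<beta> (coroot D \<alpha>) * \<alpha> v) ` roots D = roots D) \<and>
     (\<forall>\<alpha>\<in>roots D. refl D \<alpha> ` coroot D ` roots D = coroot D ` roots D) \<and>
     (\<forall>\<alpha>\<in>roots D. \<forall>c. (\<lambda>v. c * \<alpha> v) \<in> roots D \<longrightarrow> c = 1 \<or> c = - 1)"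

definition weyl_group :: "'v::real_vector hecke_datum \<Rightarrow> ('v \<Rightarrow> 'v) monoid" where
  "weyl_group D = subgroup_generated (BijGroup UNIV) (refl D ` roots D)"

text \<open>\<open>\<Pi>\<close> is a base: linearly independent, and every root is a combination of \<open>\<Pi>\<close> with all coefficients
  nonnegative (the positive roots) or all nonpositive.\<close>

definition pos_roots :: "'v::real_vector hecke_datum \<Rightarrow> ('v \<Rightarrow> real) set" where
  "pos_roots D = {\<beta> \<in> roots D. \<exists>c. (\<forall>\<alpha>\<in>simple_roots D. 0 \<le> c \<alpha>) \<and>
      \<beta> = (\<lambda>v. \<Sum>\<alpha>\<in>simple_roots D. c \<alpha> * \<alpha> v)}"

definition simple_system :: "'v::real_vector hecke_datum \<Rightarrow> bool" where
  "simple_system D \<longleftrightarrow>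
     simple_roots D \<subseteq> roots D \<and>
     (\<forall>c. (\<forall>v. (\<Sum>\<alpha>\<in>simple_roots D. c \<alpha> * \<alpha> v) = 0) \<longrightarrow> (\<forall>\<alpha>\<in>simple_roots D. c \<alpha> = 0)) \<and>
     (\<forall>\<beta>\<in>roots D. \<beta> \<in> pos_roots D \<or> (\<lambda>v. - \<beta> v) \<in> pos_roots D)"

definition invariant_form :: "'v::real_vector hecke_datum \<Rightarrow> bool" where
  "invariant_form D \<longleftrightarrow>
     (\<forall>u. linear (form D u)) \<and>
     (\<forall>u w. form D u w = form D w u) \<and>
     (\<forall>u. u \<noteq> 0 \<longrightarrow> 0 < form D u u) \<and>
     (\<forall>g\<in>carrier (weyl_group D). \<forall>u w. form D (g u) (g w) = form D u w)"

definition invariant_param :: "'v::real_vector hecke_datum \<Rightarrow> bool" where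
  "invariant_param D \<longleftrightarrow>
     (\<forall>g\<in>carrier (weyl_group D). \<forall>\<alpha>\<in>roots D. param D (\<alpha> \<circ> g) = param D \<alpha>)"

text \<open>A complex basis \<open>v\<close> of \<open>V\<close>, its \<open>B\<close>-dual basis \<open>vu\<close> in \<open>V\<close>, and its dual basis \<open>vs\<close> in \<open>V\<^sup>*\<close>. A finite
  basis exists if and only if \<open>V\<^sub>0\<close> is finite-dimensional.\<close>

definition basis_with_duals ::
    "'v::real_vector hecke_datum \<Rightarrow> 'i set \<Rightarrow> ('i \<Rightarrow> 'v cx) \<Rightarrow> ('i \<Rightarrow> 'v cx) \<Rightarrow> ('i \<Rightarrow> 'v cx \<Rightarrow> complex) \<Rightarrow> bool" where
  "basis_with_duals D I v vu vs \<longleftrightarrow>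
     finite I \<and> inj_on v I \<and>
     \<not> module.dependent cscale (v ` I) \<and> module.span cscale (v ` I) = UNIV \<and>
     (\<forall>i\<in>I. \<forall>j\<in>I. cext_form (form D) (v i) (vu j) = (if i = j then 1 else 0)) \<and>
     (\<forall>i\<in>I. vs i \<in> cdual) \<and>
     (\<forall>i\<in>I. \<forall>j\<in>I. vs i (v j) = (if i = j then 1 else 0))"


section \<open>The group algebra of \<open>W\<close>\<close>

definition CW :: "'v::real_vector hecke_datum \<Rightarrow> (complex, ('v \<Rightarrow> 'v) \<Rightarrow>\<^sub>0 complex) module" where
  "CW D = monoid_algebra (weyl_group D)"

definition sW :: "'v::real_vector hecke_datum \<Rightarrow> ('v \<Rightarrow> real) \<Rightarrow> ('v \<Rightarrow> 'v) \<Rightarrow>\<^sub>0 complex" where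
  "sW D \<alpha> = Poly_Mapping.single (refl D \<alpha>) 1"

definition CW_inv :: "'v::real_vector hecke_datum \<Rightarrow> (('v \<Rightarrow> 'v) \<Rightarrow>\<^sub>0 complex) set" where
  "CW_inv D = {a \<in> carrier (CW D). \<forall>g\<in>carrier (weyl_group D).
     Poly_Mapping.single g 1 \<otimes>\<^bsub>CW D\<^esub> a \<otimes>\<^bsub>CW D\<^esub> Poly_Mapping.single (inv\<^bsub>weyl_group D\<^esub> g) 1 = a}"

definition CW_act :: "(('v::real_vector \<Rightarrow> 'v) \<Rightarrow>\<^sub>0 complex) \<Rightarrow> 'v cx \<Rightarrow> 'v cx" where
  "CW_act a u = (\<Sum>g\<in>Poly_Mapping.keys a. cscale (Poly_Mapping.lookup a g) (map_prod g g u))"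

definition Omega_W :: "'v::real_vector hecke_datum \<Rightarrow> ('v \<Rightarrow> 'v) \<Rightarrow>\<^sub>0 complex" where
  "Omega_W D = (1/4) \<odot>\<^bsub>CW D\<^esub> (\<Oplus>\<^bsub>CW D\<^esub>\<alpha>\<in>pos_roots D. \<Oplus>\<^bsub>CW D\<^esub>\<beta>\<in>pos_roots D.
     (param D \<alpha> * param D \<beta> * dual_form (form D) (cext \<alpha>) (cext \<beta>)) \<odot>\<^bsub>CW D\<^esub> (sW D \<alpha> \<otimes>\<^bsub>CW D\<^esub> sW D \<beta>))"

text \<open>Since \<open>x / 0 = 0\<close>, this coefficient is \<open>0\<close> when \<open>B(\<alpha>\<^sup>\<or>, \<beta>\<^sup>\<or>) = 0\<close>, which is the convention for
  such pairs.\<close>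

definition pair_coeff :: "'v::real_vector hecke_datum \<Rightarrow> ('v \<Rightarrow> real) \<Rightarrow> ('v \<Rightarrow> real) \<Rightarrow> complex" where
  "pair_coeff D \<alpha> \<beta> =
     param D \<alpha> * param D \<beta> * (1 / complex_of_real (form D (coroot D \<alpha>) (coroot D \<beta>)))"

definition Omega_W' :: "'v::real_vector hecke_datum \<Rightarrow> ('v \<Rightarrow> 'v) \<Rightarrow>\<^sub>0 complex" where
  "Omega_W' D = (1/16) \<odot>\<^bsub>CW D\<^esub> (\<Oplus>\<^bsub>CW D\<^esub>\<alpha>\<in>pos_roots D. \<Oplus>\<^bsub>CW D\<^esub>\<beta>\<in>pos_roots D.
     pair_coeff D \<alpha> \<beta> \<odot>\<^bsub>CW D\<^esub> (commutator (CW D) (sW D \<alpha>) (sW D \<beta>) [^]\<^bsub>CW D\<^esub> (2::nat)))"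


section \<open>The graded affine Hecke algebra\<close>

text \<open>Generators are the elements of \<open>\<complex>[W]\<close> and of \<open>V\<close>. The first three groups of relations make the
  map from \<open>\<complex>[W]\<close> a unital algebra homomorphism.\<close>

type_synonym 'v hecke_gen = "(('v \<Rightarrow> 'v) \<Rightarrow>\<^sub>0 complex) + 'v cx"

definition hecke_gens :: "'v::real_vector hecke_datum \<Rightarrow> 'v hecke_gen set" where
  "hecke_gens D = carrier (CW D) <+> UNIV"

definition hecke_relations ::
    "'v::real_vector hecke_datum \<Rightarrow> ('v hecke_gen list \<Rightarrow>\<^sub>0 complex) set" where
  "hecke_relations D = (let F = free_algebra (hecke_gens D) in
     linear_relations Inl (carrier (CW D)) (add (CW D)) (smult (CW D)) \<union>
     {gen (Inl (a \<otimes>\<^bsub>CW D\<^esub> b)) - gen (Inl a) \<otimes>\<^bsub>F\<^esub> gen (Inl b) | a b. a \<in> carrier (CW D) \<and> b \<in> carrier (CW D)} \<union>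
     {gen (Inl \<one>\<^bsub>CW D\<^esub>) - \<one>\<^bsub>F\<^esub>} \<union>
     linear_relations Inr UNIV (+) cscale \<union>
     {gen (Inr u) \<otimes>\<^bsub>F\<^esub> gen (Inr w) - gen (Inr w) \<otimes>\<^bsub>F\<^esub> gen (Inr u) | u w. True} \<union>
     {gen (Inr u) \<otimes>\<^bsub>F\<^esub> gen (Inl (sW D \<alpha>))
        - gen (Inl (sW D \<alpha>)) \<otimes>\<^bsub>F\<^esub> gen (Inr (map_prod (refl D \<alpha>) (refl D \<alpha>) u))
        - (param D \<alpha> * cext \<alpha> u) \<odot>\<^bsub>F\<^esub> \<one>\<^bsub>F\<^esub> | u \<alpha>. \<alpha> \<in> simple_roots D})"

type_synonym 'v hecke_elt = "('v hecke_gen list \<Rightarrow>\<^sub>0 complex) set"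

definition hecke_algebra :: "'v::real_vector hecke_datum \<Rightarrow> (complex, 'v hecke_elt) module" where
  "hecke_algebra D = presented_algebra (hecke_gens D) (hecke_relations D)"

definition W_to_H :: "'v::real_vector hecke_datum \<Rightarrow> (('v \<Rightarrow> 'v) \<Rightarrow>\<^sub>0 complex) \<Rightarrow> 'v hecke_elt" where
  "W_to_H D a = presented_gen (hecke_gens D) (hecke_relations D) (Inl a)"

definition V_to_H :: "'v::real_vector hecke_datum \<Rightarrow> 'v cx \<Rightarrow> 'v hecke_elt" where
  "V_to_H D u = presented_gen (hecke_gens D) (hecke_relations D) (Inr u)"

definition T_elt :: "'v::real_vector hecke_datum \<Rightarrow> 'v cx \<Rightarrow> ('v \<Rightarrow> 'v) \<Rightarrow>\<^sub>0 complex" where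
  "T_elt D u = (1/2) \<odot>\<^bsub>CW D\<^esub> (\<Oplus>\<^bsub>CW D\<^esub>\<alpha>\<in>pos_roots D. (param D \<alpha> * cext \<alpha> u) \<odot>\<^bsub>CW D\<^esub> sW D \<alpha>)"

definition tilde :: "'v::real_vector hecke_datum \<Rightarrow> 'v cx \<Rightarrow> 'v hecke_elt" where
  "tilde D u = V_to_H D u \<ominus>\<^bsub>hecke_algebra D\<^esub> W_to_H D (T_elt D u)"

definition Omega_H ::
    "'v::real_vector hecke_datum \<Rightarrow> 'i set \<Rightarrow> ('i \<Rightarrow> 'v cx) \<Rightarrow> ('i \<Rightarrow> 'v cx) \<Rightarrow> 'v hecke_elt" where
  "Omega_H D I v vu =
     (\<Oplus>\<^bsub>hecke_algebra D\<^esub>i\<in>I. V_to_H D (v i) \<otimes>\<^bsub>hecke_algebra D\<^esub> V_to_H D (vu i))"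


section \<open>The Weyl algebra\<close>

text \<open>An element of \<open>V \<oplus> V\<^sup>*\<close> is a pair. The form \<open>\<omega>\<close> is antisymmetric, so \<open>\<omega>(v, \<lambda>) = - \<lambda>(v)\<close>.\<close>

type_synonym 'v sympl = "'v cx \<times> ('v cx \<Rightarrow> complex)"

definition sympl_carrier :: "'v::real_vector sympl set" where
  "sympl_carrier = UNIV \<times> cdual"

definition sympl_add :: "'v::real_vector sympl \<Rightarrow> 'v sympl \<Rightarrow> 'v sympl" where
  "sympl_add p q = (fst p + fst q, \<lambda>u. snd p u + snd q u)"

definition sympl_scale :: "complex \<Rightarrow> 'v::real_vector sympl \<Rightarrow> 'v sympl" where
  "sympl_scale c p = (cscale c (fst p), \<lambda>u. c * snd p u)"

definition omega :: "'v::real_vector sympl \<Rightarrow> 'v sympl \<Rightarrow> complex" where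
  "omega p q = snd p (fst q) - snd q (fst p)"

definition weyl_relations :: "('v::real_vector sympl list \<Rightarrow>\<^sub>0 complex) set" where
  "weyl_relations = (let F = free_algebra sympl_carrier in
     linear_relations id sympl_carrier sympl_add sympl_scale \<union>
     {gen p \<otimes>\<^bsub>F\<^esub> gen q - gen q \<otimes>\<^bsub>F\<^esub> gen p - omega p q \<odot>\<^bsub>F\<^esub> \<one>\<^bsub>F\<^esub>
        | p q. p \<in> sympl_carrier \<and> q \<in> sympl_carrier})"

type_synonym 'v weyl_elt = "('v sympl list \<Rightarrow>\<^sub>0 complex) set"

definition weyl_algebra :: "(complex, 'v::real_vector weyl_elt) module" where
  "weyl_algebra = presented_algebra sympl_carrier weyl_relations"

definition V_to_Wl :: "'v::real_vector cx \<Rightarrow> 'v weyl_elt" where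
  "V_to_Wl u = presented_gen sympl_carrier weyl_relations (u, \<lambda>_. 0)"

definition Vst_to_Wl :: "('v::real_vector cx \<Rightarrow> complex) \<Rightarrow> 'v weyl_elt" where
  "Vst_to_Wl l = presented_gen sympl_carrier weyl_relations (0, l)"

text \<open>The formula makes sense for every endomorphism \<open>f\<close>; it is applied only to elements of \<open>so(V, B)\<close>.\<close>

definition nu' ::
    "'i set \<Rightarrow> ('i \<Rightarrow> 'v cx) \<Rightarrow> ('i \<Rightarrow> 'v cx \<Rightarrow> complex) \<Rightarrow> ('v::real_vector cx \<Rightarrow> 'v cx) \<Rightarrow> 'v weyl_elt" where
  "nu' I v vs f =
     (\<Oplus>\<^bsub>weyl_algebra\<^esub>i\<in>I. V_to_Wl (f (v i)) \<otimes>\<^bsub>weyl_algebra\<^esub> Vst_to_Wl (vs i))"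

text \<open>The element \<open>\<nu>'([s\<^sub>\<alpha>, s\<^sub>\<beta>])\<close>.\<close>

definition nu'_comm ::
    "'v::real_vector hecke_datum \<Rightarrow> 'i set \<Rightarrow> ('i \<Rightarrow> 'v cx) \<Rightarrow> ('i \<Rightarrow> 'v cx \<Rightarrow> complex) \<Rightarrow>
     ('v \<Rightarrow> real) \<Rightarrow> ('v \<Rightarrow> real) \<Rightarrow> 'v weyl_elt" where
  "nu'_comm D I v vs \<alpha> \<beta> = nu' I v vs (CW_act (commutator (CW D) (sW D \<alpha>) (sW D \<beta>)))"

definition nu'_Omega_W' ::
    "'v::real_vector hecke_datum \<Rightarrow> 'i set \<Rightarrow> ('i \<Rightarrow> 'v cx) \<Rightarrow> ('i \<Rightarrow> 'v cx \<Rightarrow> complex) \<Rightarrow> 'v weyl_elt" where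
  "nu'_Omega_W' D I v vs =
     (1/16) \<odot>\<^bsub>weyl_algebra\<^esub> (\<Oplus>\<^bsub>weyl_algebra\<^esub>\<alpha>\<in>pos_roots D. \<Oplus>\<^bsub>weyl_algebra\<^esub>\<beta>\<in>pos_roots D.
        pair_coeff D \<alpha> \<beta> \<odot>\<^bsub>weyl_algebra\<^esub> (nu'_comm D I v vs \<alpha> \<beta> [^]\<^bsub>weyl_algebra\<^esub> (2::nat)))"


section \<open>The tensor product of the Hecke algebra and the Weyl algebra\<close>

type_synonym 'v hw_elt = "('v hecke_elt \<times> 'v weyl_elt \<Rightarrow>\<^sub>0 complex) set"

definition HW :: "'v::real_vector hecke_datum \<Rightarrow> (complex, 'v hw_elt) module" where
  "HW D = tensor_algebra (hecke_algebra D) weyl_algebra"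

definition tens :: "'v::real_vector hecke_datum \<Rightarrow> 'v hecke_elt \<Rightarrow> 'v weyl_elt \<Rightarrow> 'v hw_elt" where
  "tens D h u = pure_tensor (hecke_algebra D) weyl_algebra h u"

definition D_minus ::
    "'v::real_vector hecke_datum \<Rightarrow> 'i set \<Rightarrow> ('i \<Rightarrow> 'v cx) \<Rightarrow> ('i \<Rightarrow> 'v cx \<Rightarrow> complex) \<Rightarrow> 'v hw_elt" where
  "D_minus D I v vs = (\<Oplus>\<^bsub>HW D\<^esub>i\<in>I. tens D (tilde D (v i)) (Vst_to_Wl (vs i)))"

definition D_plus ::
    "'v::real_vector hecke_datum \<Rightarrow> 'i set \<Rightarrow> ('i \<Rightarrow> 'v cx) \<Rightarrow> ('i \<Rightarrow> 'v cx) \<Rightarrow> 'v hw_elt" where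
  "D_plus D I v vu = (\<Oplus>\<^bsub>HW D\<^esub>i\<in>I. tens D (tilde D (v i)) (V_to_Wl (vu i)))"

definition Delta_comm ::
    "'v::real_vector hecke_datum \<Rightarrow> 'i set \<Rightarrow> ('i \<Rightarrow> 'v cx) \<Rightarrow> ('i \<Rightarrow> 'v cx \<Rightarrow> complex) \<Rightarrow>
     ('v \<Rightarrow> real) \<Rightarrow> ('v \<Rightarrow> real) \<Rightarrow> 'v hw_elt" where
  "Delta_comm D I v vs \<alpha> \<beta> =
     tens D (W_to_H D (commutator (CW D) (sW D \<alpha>) (sW D \<beta>))) \<one>\<^bsub>weyl_algebra\<^esub> \<oplus>\<^bsub>HW D\<^esub>
     tens D \<one>\<^bsub>hecke_algebra D\<^esub> (nu'_comm D I v vs \<alpha> \<beta>)"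

definition Delta_Omega_W' ::
    "'v::real_vector hecke_datum \<Rightarrow> 'i set \<Rightarrow> ('i \<Rightarrow> 'v cx) \<Rightarrow> ('i \<Rightarrow> 'v cx \<Rightarrow> complex) \<Rightarrow> 'v hw_elt" where
  "Delta_Omega_W' D I v vs =
     (1/16) \<odot>\<^bsub>HW D\<^esub> (\<Oplus>\<^bsub>HW D\<^esub>\<alpha>\<in>pos_roots D. \<Oplus>\<^bsub>HW D\<^esub>\<beta>\<in>pos_roots D.
        pair_coeff D \<alpha> \<beta> \<odot>\<^bsub>HW D\<^esub> (Delta_comm D I v vs \<alpha> \<beta> [^]\<^bsub>HW D\<^esub> (2::nat)))"

definition pos_root_pairs :: "'v::real_vector hecke_datum \<Rightarrow> ('v \<Rightarrow> real) set set" where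
  "pos_root_pairs D = {{\<alpha>, \<beta>} | \<alpha> \<beta>. \<alpha> \<in> pos_roots D \<and> \<beta> \<in> pos_roots D \<and> \<alpha> \<noteq> \<beta>}"

text \<open>The value at an unordered pair of an expression symmetric in its two arguments.\<close>

definition on_pair :: "('a \<Rightarrow> 'a \<Rightarrow> 'b) \<Rightarrow> 'a set \<Rightarrow> 'b" where
  "on_pair f p = (THE y. \<exists>\<alpha> \<beta>. p = {\<alpha>, \<beta>} \<and> y = f \<alpha> \<beta>)"

end

theory Submission
  imports Defs
begin

text \<open>
  The elements \<open>tilde v\<close> satisfy \<open>w \<cdot> tilde v \<cdot> w\<^sup>-\<^sup>1 = tilde (w v)\<close> for every \<open>w\<close> in the Weyl group: for simple
  reflections this is the defining relation of the Hecke algebra, and these generate the group. Hence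
  \<open>[tilde x, s\<^sub>\<alpha>]\<close> is \<open>\<alpha>(x)\<close> times an element depending only on \<open>\<alpha>\<close>, so that \<open>[tilde x, T\<^sub>y]\<close> is symmetric in
  \<open>x, y\<close>, and expanding \<open>[x, y] = 0\<close> gives \<open>[tilde x, tilde y] = -[T\<^sub>x, T\<^sub>y]\<close>. Likewise \<open>tilde \<alpha>\<^sup>#\<close> anticommutes with
  \<open>s\<^sub>\<alpha>\<close>, where \<open>\<alpha>\<^sup>#\<close> is the vector representing \<open>\<alpha>\<close>, and expanding \<open>\<Omega>\<^sub>H\<close> gives \<open>\<Sum> tilde v\<^sup>i tilde v\<^sub>i = \<Omega>\<^sub>H - \<Omega>\<^sub>W\<close>.
  In \<open>[D\<^sup>+, D\<^sup>-]\<close> the commutators in the Weyl algebra contribute minus this sum, and those in the Hecke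
  algebra contribute \<open>-1/4 \<Sum> k\<^sub>\<alpha> k\<^sub>\<beta> [s\<^sub>\<alpha>, s\<^sub>\<beta>] \<otimes> \<alpha>\<^sup># \<beta>\<close>, whose antisymmetrisation is expressed by
  \<open>\<nu>'([s\<^sub>\<alpha>, s\<^sub>\<beta>]) = B(\<alpha>\<^sup>\<or>, \<beta>\<^sup>\<or>) (\<alpha>\<^sup># \<beta> - \<beta>\<^sup># \<alpha>)\<close>.
\<close>

section \<open>Algebras over the complex numbers\<close>

text \<open>The Hecke relation is imposed for simple reflections only, and the sums run over the
  positive roots, a set that reflections do not preserve. The equivariance arguments therefore rest
  on two facts: simple reflections generate the group, and \<open>s \<gamma>\<close> permutes the
  positive roots other than \<gamma>. The one exceptional root explains the factor 1/2 in
  \<open>T_elt\<close>: conjugation by \<open>s \<gamma>\<close> flips the sign of its term, and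
  twice that term is the scalar term of the Hecke relation, which cancels in \<open>tilde\<close>.
  The basis disappears by contraction: for a linear f, summing \<alpha>(v i) f(vu i) over i gives f
  at the Riesz vector of \<alpha>. The same rule makes \<Omega>H central: moving
  \<open>s \<gamma>\<close> past it reflects both bases and leaves a multiple of the Riesz vector
  plus its reflection, which is zero. The second formula comes from squaring
  \<open>Delta_comm\<close>. Its two summands commute, so the mixed term occurs twice, and each
  unordered pair is counted twice among ordered pairs; 4 times 1/16 is the 1/4 of the first formula.
  Orthogonal coroots give commuting reflections, so the value 0 of \<open>pair_coeff\<close> there
  agrees with the form of the terms that has no denominator.\<close>

locale complex_algebra = ring A for A :: "(complex, 'a) module" (structure) +
  assumes smult_closed [simp, intro]: "x \<in> carrier A \<Longrightarrow> c \<odot> x \<in> carrier A"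
    and smult_l_distr: "x \<in> carrier A \<Longrightarrow> (c + d) \<odot> x = c \<odot> x \<oplus> d \<odot> x"
    and smult_r_distr: "\<lbrakk>x \<in> carrier A; y \<in> carrier A\<rbrakk> \<Longrightarrow> c \<odot> (x \<oplus> y) = c \<odot> x \<oplus> c \<odot> y"
    and smult_smult: "x \<in> carrier A \<Longrightarrow> c \<odot> (d \<odot> x) = (c * d) \<odot> x"
    and smult_1 [simp]: "x \<in> carrier A \<Longrightarrow> 1 \<odot> x = x"
    and smult_mult_l: "\<lbrakk>x \<in> carrier A; y \<in> carrier A\<rbrakk> \<Longrightarrow> (c \<odot> x) \<otimes> y = c \<odot> (x \<otimes> y)"
    and smult_mult_r: "\<lbrakk>x \<in> carrier A; y \<in> carrier A\<rbrakk> \<Longrightarrow> x \<otimes> (c \<odot> y) = c \<odot> (x \<otimes> y)"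
begin

lemma smult_0_left [simp]: "x \<in> carrier A \<Longrightarrow> 0 \<odot> x = \<zero>"
  using smult_l_distr[of x 0 0] by (metis add.r_cancel_one' add_0 smult_closed)

lemma smult_0_right [simp]: "c \<odot> \<zero> = \<zero>"
  using smult_smult[of \<zero> c 0] by simp

lemma smult_minus_left: "x \<in> carrier A \<Longrightarrow> (- c) \<odot> x = \<ominus> (c \<odot> x)"
  using smult_l_distr[of x "- c" c] by (simp add: minus_equality)

lemma smult_minus_right: "x \<in> carrier A \<Longrightarrow> c \<odot> (\<ominus> x) = \<ominus> (c \<odot> x)"
  using smult_r_distr[of "\<ominus> x" x c] by (simp add: minus_equality l_neg)

lemma smult_diff_right: "\<lbrakk>x \<in> carrier A; y \<in> carrier A\<rbrakk> \<Longrightarrow> c \<odot> (x \<ominus> y) = c \<odot> x \<ominus> c \<odot> y"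
  by (simp add: minus_eq smult_r_distr smult_minus_right)

lemma finsum_closedI [simp, intro]:
  "(\<And>i. i \<in> S \<Longrightarrow> f i \<in> carrier A) \<Longrightarrow> finsum A f S \<in> carrier A"
  by (rule finsum_closed) auto

lemma finsum_eqI:
  "\<lbrakk>\<And>i. i \<in> S \<Longrightarrow> f i = g i; \<And>i. i \<in> S \<Longrightarrow> g i \<in> carrier A\<rbrakk> \<Longrightarrow> finsum A f S = finsum A g S"
  by (rule finsum_cong') auto

lemma finsum_add:
  "\<lbrakk>\<And>i. i \<in> S \<Longrightarrow> f i \<in> carrier A; \<And>i. i \<in> S \<Longrightarrow> g i \<in> carrier A\<rbrakk>
    \<Longrightarrow> (\<Oplus>i\<in>S. f i \<oplus> g i) = finsum A f S \<oplus> finsum A g S"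
  by (rule finsum_addf) auto

lemma finsum_smult:
  assumes "\<And>i. i \<in> S \<Longrightarrow> f i \<in> carrier A"
  shows "(\<Oplus>i\<in>S. c \<odot> f i) = c \<odot> finsum A f S"
\<comment> \<open>On an infinite index set \<open>finsum\<close> takes its default value
  \<open>\<zero>\<close> on both sides.\<close>
proof (cases "finite S")
  case True
  then show ?thesis using assms
    by (induction S rule: finite_induct) (auto simp: Pi_iff finsum_insert smult_r_distr)
qed simp

lemma finsum_minus:
  "(\<And>i. i \<in> S \<Longrightarrow> f i \<in> carrier A) \<Longrightarrow> (\<Oplus>i\<in>S. \<ominus> f i) = \<ominus> finsum A f S"
  using finsum_smult[of S f "- 1"] by (simp add: smult_minus_left cong: finsum_cong)

lemma finsum_diff:
  "\<lbrakk>\<And>i. i \<in> S \<Longrightarrow> f i \<in> carrier A; \<And>i. i \<in> S \<Longrightarrow> g i \<in> carrier A\<rbrakk>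
    \<Longrightarrow> (\<Oplus>i\<in>S. f i \<ominus> g i) = finsum A f S \<ominus> finsum A g S"
  by (simp add: minus_eq finsum_add finsum_minus)

lemma finsum_mult_l:
  "\<lbrakk>a \<in> carrier A; \<And>i. i \<in> S \<Longrightarrow> f i \<in> carrier A\<rbrakk> \<Longrightarrow> a \<otimes> finsum A f S = (\<Oplus>i\<in>S. a \<otimes> f i)"
  by (cases "finite S") (auto simp: finsum_rdistr)

lemma finsum_mult_r:
  "\<lbrakk>a \<in> carrier A; \<And>i. i \<in> S \<Longrightarrow> f i \<in> carrier A\<rbrakk> \<Longrightarrow> finsum A f S \<otimes> a = (\<Oplus>i\<in>S. f i \<otimes> a)"
  by (cases "finite S") (auto simp: finsum_ldistr)

lemma finsum_finsum_swap:
  assumes "finite S" "finite T" "\<And>i j. \<lbrakk>i \<in> S; j \<in> T\<rbrakk> \<Longrightarrow> f i j \<in> carrier A"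
  shows "(\<Oplus>i\<in>S. \<Oplus>j\<in>T. f i j) = (\<Oplus>j\<in>T. \<Oplus>i\<in>S. f i j)"
  using assms(1,3)
proof (induction S rule: finite_induct)
  case (insert x F)
  have "(\<Oplus>i\<in>insert x F. \<Oplus>j\<in>T. f i j) = (\<Oplus>j\<in>T. f x j) \<oplus> (\<Oplus>j\<in>T. \<Oplus>i\<in>F. f i j)"
    using insert by (subst finsum_insert) auto
  also have "\<dots> = (\<Oplus>j\<in>T. f x j \<oplus> (\<Oplus>i\<in>F. f i j))"
    using insert by (subst finsum_add) auto
  also have "\<dots> = (\<Oplus>j\<in>T. \<Oplus>i\<in>insert x F. f i j)"
    using insert by (intro finsum_eqI) (auto simp: finsum_insert Pi_iff)
  finally show ?case .
qed simp

lemma commutator_closed [simp, intro]: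
  "\<lbrakk>x \<in> carrier A; y \<in> carrier A\<rbrakk> \<Longrightarrow> commutator A x y \<in> carrier A"
  by (simp add: commutator_def)

lemma commutator_minus_swap:
  "\<lbrakk>x \<in> carrier A; y \<in> carrier A\<rbrakk> \<Longrightarrow> commutator A y x = \<ominus> commutator A x y"
  unfolding commutator_def by algebra

lemma commutator_smult_l:
  "\<lbrakk>x \<in> carrier A; y \<in> carrier A\<rbrakk> \<Longrightarrow> commutator A (c \<odot> x) y = c \<odot> commutator A x y"
  by (simp add: commutator_def smult_mult_l smult_mult_r smult_diff_right)

lemma commutator_smult_r:
  "\<lbrakk>x \<in> carrier A; y \<in> carrier A\<rbrakk> \<Longrightarrow> commutator A x (c \<odot> y) = c \<odot> commutator A x y"
  by (simp add: commutator_def smult_mult_l smult_mult_r smult_diff_right)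

lemma commutator_finsum_l:
  "\<lbrakk>y \<in> carrier A; \<And>i. i \<in> S \<Longrightarrow> f i \<in> carrier A\<rbrakk>
    \<Longrightarrow> commutator A (finsum A f S) y = (\<Oplus>i\<in>S. commutator A (f i) y)"
  by (simp add: commutator_def finsum_mult_l finsum_mult_r finsum_diff)

lemma commutator_finsum_r:
  "\<lbrakk>y \<in> carrier A; \<And>i. i \<in> S \<Longrightarrow> f i \<in> carrier A\<rbrakk>
    \<Longrightarrow> commutator A y (finsum A f S) = (\<Oplus>i\<in>S. commutator A y (f i))"
  by (simp add: commutator_def finsum_mult_l finsum_mult_r finsum_diff)

end

section \<open>Homomorphisms of complex algebras\<close>

definition alg_hom :: "(complex, 'a) module \<Rightarrow> (complex, 'b) module \<Rightarrow> ('a \<Rightarrow> 'b) \<Rightarrow> bool" where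
  "alg_hom A A' h \<longleftrightarrow> h \<in> carrier A \<rightarrow> carrier A' \<and> h \<one>\<^bsub>A\<^esub> = \<one>\<^bsub>A'\<^esub> \<and>
     (\<forall>x\<in>carrier A. \<forall>y\<in>carrier A. h (x \<oplus>\<^bsub>A\<^esub> y) = h x \<oplus>\<^bsub>A'\<^esub> h y \<and> h (x \<otimes>\<^bsub>A\<^esub> y) = h x \<otimes>\<^bsub>A'\<^esub> h y) \<and>
     (\<forall>c. \<forall>x\<in>carrier A. h (c \<odot>\<^bsub>A\<^esub> x) = c \<odot>\<^bsub>A'\<^esub> h x)"

locale complex_algebra_hom = A: complex_algebra A + A': complex_algebra A'
  for A :: "(complex, 'a) module" and A' :: "(complex, 'b) module" and h +
  assumes alg_hom: "alg_hom A A' h"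
begin

lemma hom_closed [simp, intro]: "x \<in> carrier A \<Longrightarrow> h x \<in> carrier A'"
  and hom_one [simp]: "h \<one>\<^bsub>A\<^esub> = \<one>\<^bsub>A'\<^esub>"
  and hom_add: "\<lbrakk>x \<in> carrier A; y \<in> carrier A\<rbrakk> \<Longrightarrow> h (x \<oplus>\<^bsub>A\<^esub> y) = h x \<oplus>\<^bsub>A'\<^esub> h y"
  and hom_mult: "\<lbrakk>x \<in> carrier A; y \<in> carrier A\<rbrakk> \<Longrightarrow> h (x \<otimes>\<^bsub>A\<^esub> y) = h x \<otimes>\<^bsub>A'\<^esub> h y"
  and hom_smult: "x \<in> carrier A \<Longrightarrow> h (c \<odot>\<^bsub>A\<^esub> x) = c \<odot>\<^bsub>A'\<^esub> h x"
  using alg_hom unfolding alg_hom_def by auto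

lemma hom_zero [simp]: "h \<zero>\<^bsub>A\<^esub> = \<zero>\<^bsub>A'\<^esub>"
  using hom_smult[of "\<zero>\<^bsub>A\<^esub>" 0] by simp

lemma hom_minus: "x \<in> carrier A \<Longrightarrow> h (\<ominus>\<^bsub>A\<^esub> x) = \<ominus>\<^bsub>A'\<^esub> h x"
  using hom_smult[of x "- 1"] by (simp add: A.smult_minus_left A'.smult_minus_left)

lemma hom_diff: "\<lbrakk>x \<in> carrier A; y \<in> carrier A\<rbrakk> \<Longrightarrow> h (x \<ominus>\<^bsub>A\<^esub> y) = h x \<ominus>\<^bsub>A'\<^esub> h y"
  by (simp add: A.minus_eq A'.minus_eq hom_add hom_minus)

lemma hom_commutator:
  "\<lbrakk>x \<in> carrier A; y \<in> carrier A\<rbrakk> \<Longrightarrow> h (commutator A x y) = commutator A' (h x) (h y)"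
  by (simp add: commutator_def hom_diff hom_mult)

lemma hom_finsum:
  assumes "\<And>i. i \<in> S \<Longrightarrow> f i \<in> carrier A"
  shows "h (finsum A f S) = (\<Oplus>\<^bsub>A'\<^esub>i\<in>S. h (f i))"
proof (cases "finite S")
  case True
  then show ?thesis using assms
    by (induction S rule: finite_induct) (auto simp: Pi_iff A.finsum_insert A'.finsum_insert hom_add)
qed simp

lemma hom_nat_pow: "x \<in> carrier A \<Longrightarrow> h (x [^]\<^bsub>A\<^esub> (n::nat)) = h x [^]\<^bsub>A'\<^esub> n"
  by (induction n) (auto simp: hom_mult)

end

section \<open>Monoid algebras\<close>

lemma poly_mapping_sum_single:
  assumes "finite S" "Poly_Mapping.keys f \<subseteq> S"
  shows "f = (\<Sum>x\<in>S. Poly_Mapping.single x (Poly_Mapping.lookup f x))"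
proof (rule poly_mapping_eqI)
  fix k
  have "(\<Sum>x\<in>S. Poly_Mapping.lookup f x when x = k) = (if k \<in> S then Poly_Mapping.lookup f k else 0)"
    using assms(1) by (simp add: when_def sum.delta)
  then show "Poly_Mapping.lookup f k
      = Poly_Mapping.lookup (\<Sum>x\<in>S. Poly_Mapping.single x (Poly_Mapping.lookup f x)) k"
    using assms(2) by (auto simp: lookup_sum lookup_single in_keys_iff)
qed

lemma lookup_map_times [simp]:
  "Poly_Mapping.lookup (Poly_Mapping.map ((*) (c::complex)) f) k = c * Poly_Mapping.lookup f k"
  by (simp add: map.rep_eq when_def)

lemma map_times_single [simp]:
  "Poly_Mapping.map ((*) (c::complex)) (Poly_Mapping.single k a) = Poly_Mapping.single k (c * a)"
  by (rule poly_mapping_eqI) (simp add: lookup_single when_def)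

context
  fixes M :: "('m, 'x) monoid_scheme"
begin

lemma carrier_monoid_algebra [simp]:
  "carrier (monoid_algebra M) = {f. Poly_Mapping.keys f \<subseteq> carrier M}"
  and add_monoid_algebra [simp]: "(\<oplus>\<^bsub>monoid_algebra M\<^esub>) = (+)"
  and zero_monoid_algebra [simp]: "\<zero>\<^bsub>monoid_algebra M\<^esub> = 0"
  and one_monoid_algebra [simp]: "\<one>\<^bsub>monoid_algebra M\<^esub> = Poly_Mapping.single \<one>\<^bsub>M\<^esub> 1"
  and smult_monoid_algebra [simp]: "(\<odot>\<^bsub>monoid_algebra M\<^esub>) = (\<lambda>c. Poly_Mapping.map ((*) c))"
  by (simp_all add: monoid_algebra_def)

text \<open>The product is defined by sums over supports, and supports change under addition and
  scaling. Indices outside a support contribute zero, so several products can be written over one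
  common index set and compared termwise.\<close>

lemma mult_monoid_algebra_superset:
  assumes "finite S" "finite T" "Poly_Mapping.keys f \<subseteq> S" "Poly_Mapping.keys g \<subseteq> T"
  shows "f \<otimes>\<^bsub>monoid_algebra M\<^esub> g = (\<Sum>x\<in>S. \<Sum>y\<in>T.
    Poly_Mapping.single (x \<otimes>\<^bsub>M\<^esub> y) (Poly_Mapping.lookup f x * Poly_Mapping.lookup g y))"
proof -
  have "f \<otimes>\<^bsub>monoid_algebra M\<^esub> g = (\<Sum>x\<in>Poly_Mapping.keys f. \<Sum>y\<in>Poly_Mapping.keys g.
    Poly_Mapping.single (x \<otimes>\<^bsub>M\<^esub> y) (Poly_Mapping.lookup f x * Poly_Mapping.lookup g y))"
    by (simp add: monoid_algebra_def)
  also have "\<dots> = (\<Sum>x\<in>Poly_Mapping.keys f. \<Sum>y\<in>T.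
    Poly_Mapping.single (x \<otimes>\<^bsub>M\<^esub> y) (Poly_Mapping.lookup f x * Poly_Mapping.lookup g y))"
    using assms by (intro sum.cong sum.mono_neutral_left) (auto simp: in_keys_iff)
  also have "\<dots> = (\<Sum>x\<in>S. \<Sum>y\<in>T.
    Poly_Mapping.single (x \<otimes>\<^bsub>M\<^esub> y) (Poly_Mapping.lookup f x * Poly_Mapping.lookup g y))"
    using assms by (intro sum.mono_neutral_left) (auto simp: in_keys_iff)
  finally show ?thesis .
qed

lemma mult_monoid_algebra_single [simp]:
  "Poly_Mapping.single x a \<otimes>\<^bsub>monoid_algebra M\<^esub> Poly_Mapping.single y b
    = Poly_Mapping.single (x \<otimes>\<^bsub>M\<^esub> y) (a * b)"
  by (subst mult_monoid_algebra_superset[of "{x}" "{y}"]) auto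

lemma mult_monoid_algebra_add_l:
  "(f + g) \<otimes>\<^bsub>monoid_algebra M\<^esub> h = f \<otimes>\<^bsub>monoid_algebra M\<^esub> h + g \<otimes>\<^bsub>monoid_algebra M\<^esub> h"
proof -
  let ?S = "Poly_Mapping.keys f \<union> Poly_Mapping.keys g" and ?T = "Poly_Mapping.keys h"
  have S: "finite ?S" "finite ?T" "Poly_Mapping.keys (f + g) \<subseteq> ?S"
    using Poly_Mapping.keys_add[of f g] by auto
  show ?thesis using S
    by (simp add: mult_monoid_algebra_superset[of ?S ?T] lookup_add distrib_right single_add sum.distrib)
qed

lemma mult_monoid_algebra_add_r:
  "h \<otimes>\<^bsub>monoid_algebra M\<^esub> (f + g) = h \<otimes>\<^bsub>monoid_algebra M\<^esub> f + h \<otimes>\<^bsub>monoid_algebra M\<^esub> g"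
proof -
  let ?S = "Poly_Mapping.keys f \<union> Poly_Mapping.keys g" and ?T = "Poly_Mapping.keys h"
  have S: "finite ?S" "finite ?T" "Poly_Mapping.keys (f + g) \<subseteq> ?S"
    using Poly_Mapping.keys_add[of f g] by auto
  show ?thesis using S
    by (simp add: mult_monoid_algebra_superset[of ?T ?S] lookup_add distrib_left single_add sum.distrib)
qed

lemma mult_monoid_algebra_0 [simp]:
  "0 \<otimes>\<^bsub>monoid_algebra M\<^esub> h = 0" "h \<otimes>\<^bsub>monoid_algebra M\<^esub> 0 = 0"
  by (simp_all add: monoid_algebra_def)

lemma mult_monoid_algebra_sum_l:
  "(\<Sum>i\<in>S. f i) \<otimes>\<^bsub>monoid_algebra M\<^esub> h = (\<Sum>i\<in>S. f i \<otimes>\<^bsub>monoid_algebra M\<^esub> h)"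
  by (induction S rule: infinite_finite_induct) (auto simp: mult_monoid_algebra_add_l)

lemma mult_monoid_algebra_sum_r:
  "h \<otimes>\<^bsub>monoid_algebra M\<^esub> (\<Sum>i\<in>S. f i) = (\<Sum>i\<in>S. h \<otimes>\<^bsub>monoid_algebra M\<^esub> f i)"
  by (induction S rule: infinite_finite_induct) (auto simp: mult_monoid_algebra_add_r)

lemma keys_sum_single_subset:
  "(\<And>i. i \<in> S \<Longrightarrow> Poly_Mapping.keys (f i) \<subseteq> T) \<Longrightarrow> Poly_Mapping.keys (\<Sum>i\<in>S. f i) \<subseteq> T"
  by (induction S rule: infinite_finite_induct) (auto dest: subsetD[OF Poly_Mapping.keys_add])

lemma mult_monoid_algebra_closed:
  assumes "monoid M" "Poly_Mapping.keys f \<subseteq> carrier M" "Poly_Mapping.keys g \<subseteq> carrier M"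
  shows "Poly_Mapping.keys (f \<otimes>\<^bsub>monoid_algebra M\<^esub> g) \<subseteq> carrier M"
proof -
  interpret monoid M by fact
  show ?thesis
    unfolding mult_monoid_algebra_superset[OF finite_keys finite_keys order_refl order_refl]
    using assms by (intro keys_sum_single_subset) (auto split: if_splits)
qed

lemma keys_map_times_subset: "Poly_Mapping.keys (Poly_Mapping.map ((*) (c::complex)) f) \<subseteq> Poly_Mapping.keys f"
  by (auto simp: in_keys_iff)

lemma complex_algebra_monoid_algebra:
  assumes "monoid M"
  shows "complex_algebra (monoid_algebra M)"
proof -
  interpret M: monoid M by fact
  let ?A = "monoid_algebra M"
  let ?s = "\<lambda>f. \<Sum>x\<in>Poly_Mapping.keys f. Poly_Mapping.single x (Poly_Mapping.lookup f x)"
  have expand: "f = ?s f" for f :: "'m \<Rightarrow>\<^sub>0 complex"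
    by (rule poly_mapping_sum_single) auto
  \<comment> \<open>Both sides are additive in each factor, which reduces the claim to basis
    elements and there to associativity in \<open>M\<close>. The latter holds on the carrier, hence
    the conditions on the supports.\<close>
  have assoc: "f \<otimes>\<^bsub>?A\<^esub> g \<otimes>\<^bsub>?A\<^esub> h = f \<otimes>\<^bsub>?A\<^esub> (g \<otimes>\<^bsub>?A\<^esub> h)"
    if "Poly_Mapping.keys f \<subseteq> carrier M" "Poly_Mapping.keys g \<subseteq> carrier M" "Poly_Mapping.keys h \<subseteq> carrier M"
    for f g h
  proof -
    have "?s f \<otimes>\<^bsub>?A\<^esub> ?s g \<otimes>\<^bsub>?A\<^esub> ?s h = ?s f \<otimes>\<^bsub>?A\<^esub> (?s g \<otimes>\<^bsub>?A\<^esub> ?s h)"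
      unfolding mult_monoid_algebra_sum_l mult_monoid_algebra_sum_r mult_monoid_algebra_single
      using that by (intro sum.cong refl) (auto simp: M.m_assoc mult.assoc subset_iff)
    then show ?thesis by (simp flip: expand)
  qed
  have one_l: "Poly_Mapping.single \<one>\<^bsub>M\<^esub> 1 \<otimes>\<^bsub>?A\<^esub> f = f"
    and one_r: "f \<otimes>\<^bsub>?A\<^esub> Poly_Mapping.single \<one>\<^bsub>M\<^esub> 1 = f"
    if "Poly_Mapping.keys f \<subseteq> carrier M" for f
  proof -
    have "Poly_Mapping.single \<one>\<^bsub>M\<^esub> 1 \<otimes>\<^bsub>?A\<^esub> ?s f = ?s f" "?s f \<otimes>\<^bsub>?A\<^esub> Poly_Mapping.single \<one>\<^bsub>M\<^esub> 1 = ?s f"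
      unfolding mult_monoid_algebra_sum_l mult_monoid_algebra_sum_r mult_monoid_algebra_single
      using that by (auto intro!: sum.cong simp: subset_iff)
    then show "Poly_Mapping.single \<one>\<^bsub>M\<^esub> 1 \<otimes>\<^bsub>?A\<^esub> f = f" "f \<otimes>\<^bsub>?A\<^esub> Poly_Mapping.single \<one>\<^bsub>M\<^esub> 1 = f"
      by (simp_all flip: expand)
  qed
  have ab: "abelian_group ?A"
  proof (rule abelian_groupI)
    fix x assume "x \<in> carrier ?A"
    then show "\<exists>y\<in>carrier ?A. y \<oplus>\<^bsub>?A\<^esub> x = \<zero>\<^bsub>?A\<^esub>"
      by (intro bexI[of _ "- x"]) (auto simp: in_keys_iff)
  qed (auto dest: subsetD[OF Poly_Mapping.keys_add] simp: add.assoc add.commute)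
  have mon: "monoid ?A"
    using assms by (intro monoidI) (simp_all add: assoc one_l one_r mult_monoid_algebra_closed)
  have "ring ?A"
    using ab mon by (rule ringI) (auto simp: mult_monoid_algebra_add_l mult_monoid_algebra_add_r)
  moreover have "Poly_Mapping.map ((*) c) f \<otimes>\<^bsub>?A\<^esub> g = Poly_Mapping.map ((*) c) (f \<otimes>\<^bsub>?A\<^esub> g)"
    "f \<otimes>\<^bsub>?A\<^esub> Poly_Mapping.map ((*) c) g = Poly_Mapping.map ((*) c) (f \<otimes>\<^bsub>?A\<^esub> g)" for c f g
  proof -
    have *: "Poly_Mapping.map ((*) c) (\<Sum>i\<in>S. F i) = (\<Sum>i\<in>S. Poly_Mapping.map ((*) c) (F i))"
      for S and F :: "'m \<Rightarrow> 'm \<Rightarrow>\<^sub>0 complex"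
      by (rule poly_mapping_eqI) (simp add: lookup_sum sum_distrib_left)
    show "Poly_Mapping.map ((*) c) f \<otimes>\<^bsub>?A\<^esub> g = Poly_Mapping.map ((*) c) (f \<otimes>\<^bsub>?A\<^esub> g)"
      "f \<otimes>\<^bsub>?A\<^esub> Poly_Mapping.map ((*) c) g = Poly_Mapping.map ((*) c) (f \<otimes>\<^bsub>?A\<^esub> g)"
      by (simp_all add: mult_monoid_algebra_superset[of "Poly_Mapping.keys f" "Poly_Mapping.keys g"]
          keys_map_times_subset * mult_ac)
  qed
  ultimately show ?thesis
    by (intro complex_algebra.intro complex_algebra_axioms.intro)
      (auto dest: subsetD[OF keys_map_times_subset] intro!: poly_mapping_eqI simp: lookup_add algebra_simps)
qed

end

section \<open>Quotients, presentations and tensor products\<close>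

context
  fixes A :: "(complex, 'a) module" and J
  assumes A: "complex_algebra A" and J: "ideal J A"
begin

interpretation A: complex_algebra A by (rule A)
interpretation J: ideal J A by (rule J)

text \<open>Scaling by c is multiplication by c \<odot> 1, so a two-sided ideal of the ring is
  automatically a subspace.\<close>

lemma smult_ideal: "x \<in> J \<Longrightarrow> c \<odot>\<^bsub>A\<^esub> x \<in> J"
  using J.I_l_closed[of x "c \<odot>\<^bsub>A\<^esub> \<one>\<^bsub>A\<^esub>"] J.a_Hcarr[of x] by (simp add: A.smult_mult_l)

lemma carrier_quot_algebra: "carrier (quot_algebra A J) = (+>\<^bsub>A\<^esub>) J ` carrier A"
  by (auto simp: quot_algebra_def FactRing_simps)

text \<open>\<open>quot_algebra\<close> scales a coset without choosing a representative, by a union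
  over all of its elements. The members of this union coincide because scaling keeps differences
  inside J, and the union is over a nonempty set, so it equals its common member.\<close>

lemma smult_quot_algebra:
  assumes "x \<in> carrier A"
  shows "c \<odot>\<^bsub>quot_algebra A J\<^esub> (J +>\<^bsub>A\<^esub> x) = J +>\<^bsub>A\<^esub> (c \<odot>\<^bsub>A\<^esub> x)"
proof -
  have "J +>\<^bsub>A\<^esub> (c \<odot>\<^bsub>A\<^esub> y) = J +>\<^bsub>A\<^esub> (c \<odot>\<^bsub>A\<^esub> x)" if y: "y \<in> J +>\<^bsub>A\<^esub> x" for y
  proof -
    obtain z where z: "z \<in> J" "y = z \<oplus>\<^bsub>A\<^esub> x" using y by (auto simp: a_r_coset_def')
    then have "z \<in> carrier A" by (simp add: J.a_Hcarr)
    then have "c \<odot>\<^bsub>A\<^esub> y \<ominus>\<^bsub>A\<^esub> c \<odot>\<^bsub>A\<^esub> x = c \<odot>\<^bsub>A\<^esub> z"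
      using z assms by (simp add: A.smult_r_distr A.minus_eq A.a_assoc A.r_neg)
    then show ?thesis
      using z assms smult_ideal[of z c] \<open>z \<in> carrier A\<close> by (subst A.quotient_eq_iff_same_a_r_cos[OF J, symmetric]) auto
  qed
  moreover have "J +>\<^bsub>A\<^esub> x \<noteq> {}" using J.a_rcos_self[OF assms] by blast
  ultimately have "(\<Union>y\<in>J +>\<^bsub>A\<^esub> x. J +>\<^bsub>A\<^esub> (c \<odot>\<^bsub>A\<^esub> y)) = J +>\<^bsub>A\<^esub> (c \<odot>\<^bsub>A\<^esub> x)"
    by (intro SUP_eq_const)
  then show ?thesis by (simp add: quot_algebra_def)
qed

lemma alg_hom_quot_algebra: "alg_hom A (quot_algebra A J) ((+>\<^bsub>A\<^esub>) J)"
  unfolding alg_hom_def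
  by (auto simp: smult_quot_algebra carrier_quot_algebra)
    (auto simp: quot_algebra_def FactRing_def J.rcoset_mult_add J.a_rcos_sum)

lemma complex_algebra_quot_algebra: "complex_algebra (quot_algebra A J)"
proof -
  let ?Q = "quot_algebra A J"
  have "ring ?Q"
  proof -
    \<comment> \<open>\<open>A Quot J\<close> is a ring record and \<open>?Q\<close> a module
      record, so the ring axioms are carried over field by field.\<close>
    interpret Q0: ring "A Quot J" by (rule J.quotient_is_ring)
    have [simp]: "carrier ?Q = carrier (A Quot J)" "mult ?Q = mult (A Quot J)" "one ?Q = one (A Quot J)"
      "zero ?Q = zero (A Quot J)" "add ?Q = add (A Quot J)"
      by (simp_all add: quot_algebra_def)
    have "abelian_group ?Q"
      by (rule abelian_groupI) (auto simp: Q0.a_ac intro: Q0.l_neg)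
    moreover have "monoid ?Q"
      by (rule monoidI) (auto simp: Q0.m_assoc)
    ultimately show ?thesis
      by (rule ringI) (auto simp: Q0.l_distr Q0.r_distr)
  qed
  then interpret Q: ring ?Q .
  have closed: "J +>\<^bsub>A\<^esub> x \<in> carrier ?Q" if "x \<in> carrier A" for x
    using that unfolding carrier_quot_algebra by simp
  have hom: "(J +>\<^bsub>A\<^esub> x) \<oplus>\<^bsub>?Q\<^esub> (J +>\<^bsub>A\<^esub> y) = J +>\<^bsub>A\<^esub> (x \<oplus>\<^bsub>A\<^esub> y)"
    "(J +>\<^bsub>A\<^esub> x) \<otimes>\<^bsub>?Q\<^esub> (J +>\<^bsub>A\<^esub> y) = J +>\<^bsub>A\<^esub> (x \<otimes>\<^bsub>A\<^esub> y)"
    if "x \<in> carrier A" "y \<in> carrier A" for x y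
    using alg_hom_quot_algebra that by (auto simp: alg_hom_def)
  have rep: "\<exists>x\<in>carrier A. X = J +>\<^bsub>A\<^esub> x" if "X \<in> carrier ?Q" for X
    using that unfolding carrier_quot_algebra by auto
  show ?thesis
    by unfold_locales
      (auto dest!: rep simp: closed hom smult_quot_algebra A.smult_l_distr A.smult_r_distr
        A.smult_smult A.smult_mult_l A.smult_mult_r simp del: Q.m_closed Q.add.m_closed)
qed

lemma complex_algebra_hom_quot_algebra:
  "complex_algebra_hom A (quot_algebra A J) ((+>\<^bsub>A\<^esub>) J)"
  by (intro complex_algebra_hom.intro complex_algebra_hom_axioms.intro A
      complex_algebra_quot_algebra alg_hom_quot_algebra)

end

lemma monoid_free: "monoid \<lparr>carrier = lists G, mult = (@), one = []\<rparr>"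
  by (rule monoidI) auto

lemma complex_algebra_free_algebra: "complex_algebra (free_algebra G)"
  unfolding free_algebra_def by (intro complex_algebra_monoid_algebra monoid_free)

lemma carrier_free_algebra: "carrier (free_algebra G) = {f. Poly_Mapping.keys f \<subseteq> lists G}"
  and add_free_algebra: "(\<oplus>\<^bsub>free_algebra G\<^esub>) = (+)"
  and zero_free_algebra: "\<zero>\<^bsub>free_algebra G\<^esub> = 0"
  and one_free_algebra: "\<one>\<^bsub>free_algebra G\<^esub> = Poly_Mapping.single [] 1"
  and smult_free_algebra: "(\<odot>\<^bsub>free_algebra G\<^esub>) = (\<lambda>c. Poly_Mapping.map ((*) c))"
  and mult_free_algebra_single:
    "Poly_Mapping.single x a \<otimes>\<^bsub>free_algebra G\<^esub> Poly_Mapping.single y b = Poly_Mapping.single (x @ y) (a * b)"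
  by (simp_all add: free_algebra_def)

lemma gen_closed: "x \<in> G \<Longrightarrow> gen x \<in> carrier (free_algebra G)"
  by (simp add: gen_def carrier_free_algebra)

text \<open>Relations are written with the pointwise \<open>-\<close>, while equality of cosets is
  tested with \<open>\<ominus>\<close>, which is built from the inverse in the carrier. This
  identifies the two.\<close>

lemma minus_monoid_algebra:
  assumes "monoid M" "f \<in> carrier (monoid_algebra M)" "g \<in> carrier (monoid_algebra M)"
  shows "f \<ominus>\<^bsub>monoid_algebra M\<^esub> g = f - g"
proof -
  interpret complex_algebra "monoid_algebra M" by (rule complex_algebra_monoid_algebra) fact
  have "\<ominus>\<^bsub>monoid_algebra M\<^esub> g = - g"
    using assms(3) by (intro minus_equality) (auto simp: in_keys_iff)
  then show ?thesis by (simp add: minus_eq)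
qed

lemma finsum_monoid_algebra:
  assumes "monoid M" "\<And>i. i \<in> S \<Longrightarrow> f i \<in> carrier (monoid_algebra M)"
  shows "finsum (monoid_algebra M) f S = (\<Sum>i\<in>S. f i)"
proof -
  interpret complex_algebra "monoid_algebra M" by (rule complex_algebra_monoid_algebra) fact
  show ?thesis using assms(2)
    by (induction S rule: infinite_finite_induct) (auto simp: Pi_iff finsum_insert)
qed

section \<open>Algebras given by generators and relations\<close>

locale presentation =
  fixes G :: "'g set" and R :: "('g list \<Rightarrow>\<^sub>0 complex) set"
  assumes relations_closed: "R \<subseteq> carrier (free_algebra G)"
begin

abbreviation "F \<equiv> free_algebra G"
abbreviation "P \<equiv> presented_algebra G R"
abbreviation "\<pi> \<equiv> (+>\<^bsub>F\<^esub>) (Idl\<^bsub>F\<^esub> R)"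

lemma ideal_relations: "ideal (Idl\<^bsub>F\<^esub> R) F"
  by (intro ring.genideal_ideal complex_algebra.axioms(1)[OF complex_algebra_free_algebra] relations_closed)

sublocale proj: complex_algebra_hom F P \<pi>
  unfolding presented_algebra_def
  by (rule complex_algebra_hom_quot_algebra[OF complex_algebra_free_algebra ideal_relations])

lemma presented_gen_eq: "presented_gen G R x = \<pi> (gen x)"
  by (simp add: presented_gen_def)

lemma presented_gen_closed [simp, intro]: "x \<in> G \<Longrightarrow> presented_gen G R x \<in> carrier P"
  by (simp add: presented_gen_eq gen_closed)

lemma carrier_presented: "carrier P = \<pi> ` carrier F"
  unfolding presented_algebra_def
  by (rule carrier_quot_algebra[OF complex_algebra_free_algebra ideal_relations])

lemma minus_F: "\<lbrakk>x \<in> carrier F; y \<in> carrier F\<rbrakk> \<Longrightarrow> x \<ominus>\<^bsub>F\<^esub> y = x - y"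
  unfolding free_algebra_def by (rule minus_monoid_algebra[OF monoid_free])

lemma relation:
  assumes "x - y \<in> R" "x \<in> carrier F" "y \<in> carrier F"
  shows "\<pi> x = \<pi> y"
proof -
  have "x \<ominus>\<^bsub>F\<^esub> y \<in> Idl\<^bsub>F\<^esub> R"
    using assms minus_F proj.A.genideal_self[OF relations_closed] by auto
  then show ?thesis
    using proj.A.quotient_eq_iff_same_a_r_cos[OF ideal_relations assms(2,3)] by simp
qed

lemma presented_gen_add:
  assumes "linear_relations j U pl sc \<subseteq> R" "u \<in> U" "w \<in> U" "j u \<in> G" "j w \<in> G" "j (pl u w) \<in> G"
  shows "presented_gen G R (j (pl u w)) = presented_gen G R (j u) \<oplus>\<^bsub>P\<^esub> presented_gen G R (j w)"
proof -
  have "gen (j (pl u w)) - (gen (j u) + gen (j w)) \<in> R"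
    using assms(1-3) unfolding linear_relations_def by blast
  moreover have "gen (j u) + gen (j w) = gen (j u) \<oplus>\<^bsub>F\<^esub> gen (j w)"
    by (simp add: add_free_algebra)
  ultimately show ?thesis
    using assms(4-6) relation[of "gen (j (pl u w))" "gen (j u) \<oplus>\<^bsub>F\<^esub> gen (j w)"]
    by (simp add: presented_gen_eq gen_closed proj.hom_add)
qed

lemma presented_gen_smult:
  assumes "linear_relations j U pl sc \<subseteq> R" "u \<in> U" "j u \<in> G" "j (sc c u) \<in> G"
  shows "presented_gen G R (j (sc c u)) = c \<odot>\<^bsub>P\<^esub> presented_gen G R (j u)"
proof -
  have "gen (j (sc c u)) - Poly_Mapping.map ((*) c) (gen (j u)) \<in> R"
    using assms(1,2) unfolding linear_relations_def by blast
  then show ?thesis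
    using assms(3-4) relation[of "gen (j (sc c u))" "c \<odot>\<^bsub>F\<^esub> gen (j u)"]
    by (simp add: proj.hom_smult presented_gen_eq gen_closed) (simp add: smult_free_algebra)
qed

text \<open>The elements commuting with z form a subalgebra. Words are reached by induction on their
  length, and everything else because each coset is represented by a finite combination of
  words.\<close>

lemma commutes_with_generators_imp_central:
  assumes z: "z \<in> carrier P"
    and comm: "\<And>x. x \<in> G \<Longrightarrow> z \<otimes>\<^bsub>P\<^esub> presented_gen G R x = presented_gen G R x \<otimes>\<^bsub>P\<^esub> z"
  shows "z \<in> alg_center P"
proof -
  have word: "z \<otimes>\<^bsub>P\<^esub> \<pi> (Poly_Mapping.single w 1) = \<pi> (Poly_Mapping.single w 1) \<otimes>\<^bsub>P\<^esub> z
      \<and> Poly_Mapping.single w 1 \<in> carrier F" if "w \<in> lists G" for w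
    using that
  proof (induction w)
    case Nil
    then show ?case using z proj.hom_one
      by (auto simp: one_free_algebra carrier_free_algebra)
  next
    case (Cons x w)
    have *: "Poly_Mapping.single (x # w) 1 = gen x \<otimes>\<^bsub>F\<^esub> Poly_Mapping.single w 1"
      by (simp add: gen_def mult_free_algebra_single)
    have c: "gen x \<in> carrier F" "Poly_Mapping.single w 1 \<in> carrier F" "\<pi> (gen x) \<in> carrier P" "\<pi> (Poly_Mapping.single w 1) \<in> carrier P"
      using Cons by (auto intro: gen_closed proj.hom_closed)
    let ?g = "\<pi> (gen x)" and ?w = "\<pi> (Poly_Mapping.single w 1)"
    have zg: "z \<otimes>\<^bsub>P\<^esub> ?g = ?g \<otimes>\<^bsub>P\<^esub> z" and zw: "z \<otimes>\<^bsub>P\<^esub> ?w = ?w \<otimes>\<^bsub>P\<^esub> z"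
      using Cons comm[of x] by (simp_all add: presented_gen_eq)
    have "z \<otimes>\<^bsub>P\<^esub> (?g \<otimes>\<^bsub>P\<^esub> ?w) = z \<otimes>\<^bsub>P\<^esub> ?g \<otimes>\<^bsub>P\<^esub> ?w"
      using c z by (simp only: proj.A'.m_assoc)
    also have "\<dots> = ?g \<otimes>\<^bsub>P\<^esub> (z \<otimes>\<^bsub>P\<^esub> ?w)"
      using c z by (simp only: zg proj.A'.m_assoc)
    also have "\<dots> = ?g \<otimes>\<^bsub>P\<^esub> ?w \<otimes>\<^bsub>P\<^esub> z"
      using c z by (simp only: zw proj.A'.m_assoc)
    finally have "z \<otimes>\<^bsub>P\<^esub> (?g \<otimes>\<^bsub>P\<^esub> ?w) = ?g \<otimes>\<^bsub>P\<^esub> ?w \<otimes>\<^bsub>P\<^esub> z" .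
    then show ?case unfolding * using c by (simp add: proj.hom_mult)
  qed
  have "z \<otimes>\<^bsub>P\<^esub> \<pi> f = \<pi> f \<otimes>\<^bsub>P\<^esub> z" if f: "f \<in> carrier F" for f
  proof -
    have w: "w \<in> lists G" if "w \<in> Poly_Mapping.keys f" for w
      using f that by (auto simp: carrier_free_algebra)
    have "f = (\<Sum>w\<in>Poly_Mapping.keys f. Poly_Mapping.lookup f w \<odot>\<^bsub>F\<^esub> Poly_Mapping.single w 1)"
      using poly_mapping_sum_single[of "Poly_Mapping.keys f" f] by (simp add: smult_free_algebra)
    also have "\<dots> = (\<Oplus>\<^bsub>F\<^esub>w\<in>Poly_Mapping.keys f. Poly_Mapping.lookup f w \<odot>\<^bsub>F\<^esub> Poly_Mapping.single w 1)"
      unfolding free_algebra_def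
      by (rule finsum_monoid_algebra[OF monoid_free, symmetric])
        (use w in \<open>auto simp: subset_iff\<close>)
    finally have f_eq: "f = (\<Oplus>\<^bsub>F\<^esub>w\<in>Poly_Mapping.keys f. Poly_Mapping.lookup f w \<odot>\<^bsub>F\<^esub> Poly_Mapping.single w 1)" .
    have cl: "\<pi> (Poly_Mapping.single w 1) \<in> carrier P" if "w \<in> Poly_Mapping.keys f" for w
      using word[OF w[OF that]] proj.hom_closed by blast
    have "\<pi> f = (\<Oplus>\<^bsub>P\<^esub>w\<in>Poly_Mapping.keys f. \<pi> (Poly_Mapping.lookup f w \<odot>\<^bsub>F\<^esub> Poly_Mapping.single w 1))"
      by (subst f_eq, rule proj.hom_finsum) (use word w in blast)
    also have "\<dots> = (\<Oplus>\<^bsub>P\<^esub>w\<in>Poly_Mapping.keys f. Poly_Mapping.lookup f w \<odot>\<^bsub>P\<^esub> \<pi> (Poly_Mapping.single w 1))"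
      using cl word w by (intro proj.A'.finsum_eqI proj.hom_smult proj.A'.smult_closed) auto
    finally have pf: "\<pi> f = (\<Oplus>\<^bsub>P\<^esub>w\<in>Poly_Mapping.keys f. Poly_Mapping.lookup f w \<odot>\<^bsub>P\<^esub> \<pi> (Poly_Mapping.single w 1))" .
    have "z \<otimes>\<^bsub>P\<^esub> \<pi> f = (\<Oplus>\<^bsub>P\<^esub>w\<in>Poly_Mapping.keys f. z \<otimes>\<^bsub>P\<^esub> (Poly_Mapping.lookup f w \<odot>\<^bsub>P\<^esub> \<pi> (Poly_Mapping.single w 1)))"
      unfolding pf using cl z by (intro proj.A'.finsum_mult_l) auto
    also have "\<dots> = (\<Oplus>\<^bsub>P\<^esub>w\<in>Poly_Mapping.keys f. (Poly_Mapping.lookup f w \<odot>\<^bsub>P\<^esub> \<pi> (Poly_Mapping.single w 1)) \<otimes>\<^bsub>P\<^esub> z)"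
      using cl z word w by (intro proj.A'.finsum_eqI) (auto simp: proj.A'.smult_mult_l proj.A'.smult_mult_r)
    also have "\<dots> = \<pi> f \<otimes>\<^bsub>P\<^esub> z"
      unfolding pf using cl z by (intro proj.A'.finsum_mult_r[symmetric]) auto
    finally show ?thesis .
  qed
  then show ?thesis using z by (auto simp: alg_center_def carrier_presented)
qed

end

section \<open>Tensor products of algebras\<close>

locale tensor_product = A: complex_algebra A + A': complex_algebra A'
  for A :: "(complex, 'a) module" and A' :: "(complex, 'b) module"
begin

abbreviation "T \<equiv> tensor_algebra A A'"
abbreviation "M \<equiv> monoid_algebra (A \<times>\<times> A')"
abbreviation pt (infixl "\<otimes>\<otimes>" 72) where "a \<otimes>\<otimes> b \<equiv> pure_tensor A A' a b"

lemma monoid_DirProd: "monoid (A \<times>\<times> A')"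
  by (rule DirProd_monoid) (rule A.monoid_axioms A'.monoid_axioms)+

lemma single_closed: "\<lbrakk>a \<in> carrier A; b \<in> carrier A'\<rbrakk> \<Longrightarrow> Poly_Mapping.single (a, b) c \<in> carrier M"
  by (simp add: DirProd_def)

lemma bilinear_relations_closed: "bilinear_relations A A' \<subseteq> carrier M"
proof -
  interpret M: complex_algebra M by (rule complex_algebra_monoid_algebra[OF monoid_DirProd])
  have cl: "x - y \<in> carrier M" "x + y \<in> carrier M"
    if "x \<in> carrier M" "y \<in> carrier M" for x y
    using that M.minus_closed[of x y] M.add.m_closed[of x y]
      minus_monoid_algebra[OF monoid_DirProd, of x y] by simp_all
  have cl': "Poly_Mapping.map ((*) c) x \<in> carrier M" if "x \<in> carrier M" for x c
    using M.smult_closed[OF that] by simp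
  show ?thesis
    unfolding bilinear_relations_def Let_def
    by (intro Un_least subsetI; elim CollectE exE conjE; hypsubst)
      (intro cl cl' single_closed A.add.m_closed A'.add.m_closed A.smult_closed A'.smult_closed; assumption)+
qed

lemma ideal_tensor: "ideal (tensor_ideal A A') M"
  unfolding tensor_ideal_def
  by (intro ring.genideal_ideal complex_algebra.axioms(1)[OF complex_algebra_monoid_algebra[OF monoid_DirProd]]
      bilinear_relations_closed)

sublocale proj: complex_algebra_hom M T "(+>\<^bsub>M\<^esub>) (tensor_ideal A A')"
  unfolding tensor_algebra_def
  by (rule complex_algebra_hom_quot_algebra[OF complex_algebra_monoid_algebra[OF monoid_DirProd] ideal_tensor])

lemma relation:
  assumes "x - y \<in> bilinear_relations A A'" "x \<in> carrier M" "y \<in> carrier M"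
  shows "tensor_ideal A A' +>\<^bsub>M\<^esub> x = tensor_ideal A A' +>\<^bsub>M\<^esub> y"
proof -
  have "x \<ominus>\<^bsub>M\<^esub> y \<in> tensor_ideal A A'"
    unfolding tensor_ideal_def minus_monoid_algebra[OF monoid_DirProd assms(2,3)]
    using assms proj.A.genideal_self[OF bilinear_relations_closed] by auto
  then show ?thesis
    using proj.A.quotient_eq_iff_same_a_r_cos[OF ideal_tensor assms(2,3)] by simp
qed

lemma pure_tensor_closed [simp, intro]:
  "\<lbrakk>a \<in> carrier A; b \<in> carrier A'\<rbrakk> \<Longrightarrow> a \<otimes>\<otimes> b \<in> carrier T"
  unfolding pure_tensor_def by (intro proj.hom_closed single_closed)

lemma pure_tensor_mult:
  "\<lbrakk>a \<in> carrier A; b \<in> carrier A'; a' \<in> carrier A; b' \<in> carrier A'\<rbrakk>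
    \<Longrightarrow> (a \<otimes>\<otimes> b) \<otimes>\<^bsub>T\<^esub> (a' \<otimes>\<otimes> b') = (a \<otimes>\<^bsub>A\<^esub> a') \<otimes>\<otimes> (b \<otimes>\<^bsub>A'\<^esub> b')"
  using proj.hom_mult[OF single_closed single_closed, of a b a' b' 1 1]
  by (simp add: pure_tensor_def DirProd_def)

lemma pure_tensor_add_l:
  assumes "a \<in> carrier A" "a' \<in> carrier A" "b \<in> carrier A'"
  shows "(a \<oplus>\<^bsub>A\<^esub> a') \<otimes>\<otimes> b = a \<otimes>\<otimes> b \<oplus>\<^bsub>T\<^esub> a' \<otimes>\<otimes> b"
proof -
  have "Poly_Mapping.single (a \<oplus>\<^bsub>A\<^esub> a', b) 1 - (Poly_Mapping.single (a, b) 1 \<oplus>\<^bsub>M\<^esub> Poly_Mapping.single (a', b) 1)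
      \<in> bilinear_relations A A'"
    using assms unfolding bilinear_relations_def Let_def add_monoid_algebra by blast
  from relation[OF this] show ?thesis
    unfolding pure_tensor_def using assms proj.hom_add[OF single_closed single_closed, of a b a' b 1 1] single_closed
    by (metis A.add.m_closed proj.A.add.m_closed)
qed

lemma pure_tensor_add_r:
  assumes "a \<in> carrier A" "b \<in> carrier A'" "b' \<in> carrier A'"
  shows "a \<otimes>\<otimes> (b \<oplus>\<^bsub>A'\<^esub> b') = a \<otimes>\<otimes> b \<oplus>\<^bsub>T\<^esub> a \<otimes>\<otimes> b'"
proof -
  have "Poly_Mapping.single (a, b \<oplus>\<^bsub>A'\<^esub> b') 1 - (Poly_Mapping.single (a, b) 1 \<oplus>\<^bsub>M\<^esub> Poly_Mapping.single (a, b') 1)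
      \<in> bilinear_relations A A'"
    using assms unfolding bilinear_relations_def Let_def add_monoid_algebra by blast
  from relation[OF this] show ?thesis
    unfolding pure_tensor_def using assms proj.hom_add[OF single_closed single_closed, of a b a b' 1 1] single_closed
    by (metis A'.add.m_closed proj.A.add.m_closed)
qed

lemma pure_tensor_smult_l:
  assumes "a \<in> carrier A" "b \<in> carrier A'"
  shows "(c \<odot>\<^bsub>A\<^esub> a) \<otimes>\<otimes> b = c \<odot>\<^bsub>T\<^esub> (a \<otimes>\<otimes> b)"
proof -
  have "Poly_Mapping.single (c \<odot>\<^bsub>A\<^esub> a, b) 1 - c \<odot>\<^bsub>M\<^esub> Poly_Mapping.single (a, b) 1 \<in> bilinear_relations A A'"
    using assms unfolding bilinear_relations_def Let_def smult_monoid_algebra by blast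
  from relation[OF this] show ?thesis
    unfolding pure_tensor_def using assms proj.hom_smult[OF single_closed, of a b c 1] single_closed
    by (metis A.smult_closed proj.A.smult_closed)
qed

lemma pure_tensor_smult_r:
  assumes "a \<in> carrier A" "b \<in> carrier A'"
  shows "a \<otimes>\<otimes> (c \<odot>\<^bsub>A'\<^esub> b) = c \<odot>\<^bsub>T\<^esub> (a \<otimes>\<otimes> b)"
proof -
  have "Poly_Mapping.single (a, c \<odot>\<^bsub>A'\<^esub> b) 1 - c \<odot>\<^bsub>M\<^esub> Poly_Mapping.single (a, b) 1 \<in> bilinear_relations A A'"
    using assms unfolding bilinear_relations_def Let_def smult_monoid_algebra by blast
  from relation[OF this] show ?thesis
    unfolding pure_tensor_def using assms proj.hom_smult[OF single_closed, of a b c 1] single_closed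
    by (metis A'.smult_closed proj.A.smult_closed)
qed

end

section \<open>Root systems\<close>

locale root_datum =
  fixes D :: "'v::real_vector hecke_datum"
  assumes root_system: "real_root_system D"
    and simple: "simple_system D"
    and inv_form: "invariant_form D"
    and inv_param: "invariant_param D"
begin

abbreviation "B \<equiv> form D"
abbreviation "s \<equiv> refl D"
abbreviation "W \<equiv> weyl_group D"
abbreviation "\<Phi>pos \<equiv> pos_roots D"
abbreviation "\<Delta> \<equiv> simple_roots D"

section \<open>Roots, coroots and the invariant form\<close>

lemma finite_roots: "finite (roots D)"
  and root_linear: "\<alpha> \<in> roots D \<Longrightarrow> linear \<alpha>"
  and root_coroot: "\<alpha> \<in> roots D \<Longrightarrow> \<alpha> (coroot D \<alpha>) = 2"
  and root_reduced: "\<lbrakk>\<alpha> \<in> roots D; (\<lambda>v. c * \<alpha> v) \<in> roots D\<rbrakk> \<Longrightarrow> c = 1 \<or> c = - 1"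
  using root_system unfolding real_root_system_def by blast+

lemma reflect_root:
  assumes "\<alpha> \<in> roots D" "\<beta> \<in> roots D"
  shows "(\<lambda>v. \<beta> v - \<beta> (coroot D \<alpha>) * \<alpha> v) \<in> roots D"
proof -
  have "(\<lambda>\<beta> v. \<beta> v - \<beta> (coroot D \<alpha>) * \<alpha> v) ` roots D = roots D"
    using root_system assms(1) unfolding real_root_system_def by blast
  then show ?thesis using assms(2) by blast
qed

lemma form_linear: "linear (B u)"
  and form_sym: "B u w = B w u"
  and form_pos: "u \<noteq> 0 \<Longrightarrow> 0 < B u u"
  and form_weyl: "g \<in> carrier W \<Longrightarrow> B (g u) (g w) = B u w"
  using inv_form unfolding invariant_form_def by blast+

lemma form_simps:
  shows "B u (x + y) = B u x + B u y" "B u (x - y) = B u x - B u y" "B u (c *\<^sub>R x) = c * B u x" "B u (- x) = - B u x" "B u 0 = 0"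
    and "B (x + y) u = B x u + B y u" "B (x - y) u = B x u - B y u" "B (c *\<^sub>R x) u = c * B x u" "B (- x) u = - B x u" "B 0 u = 0"
proof -
  show r: "B u (x + y) = B u x + B u y" "B u (x - y) = B u x - B u y" "B u (c *\<^sub>R x) = c * B u x" "B u (- x) = - B u x" "B u 0 = 0"
    for u x y c
    using form_linear[of u] by (simp_all add: linear_add linear_diff linear_cmul linear_neg linear_0)
  show "B (x + y) u = B x u + B y u" "B (x - y) u = B x u - B y u" "B (c *\<^sub>R x) u = c * B x u" "B (- x) u = - B x u" "B 0 u = 0"
    by (simp_all only: form_sym[where w = u] r)
qed

lemma form_nondegenerate:
  assumes "\<And>w. B u w = B u' w"
  shows "u = u'"
  using assms[of "u - u'"] form_pos[of "u - u'"] by (auto simp: form_simps)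

lemma root_simps:
  assumes "\<alpha> \<in> roots D"
  shows "\<alpha> (x + y) = \<alpha> x + \<alpha> y" "\<alpha> (x - y) = \<alpha> x - \<alpha> y" "\<alpha> (c *\<^sub>R x) = c * \<alpha> x" "\<alpha> (- x) = - \<alpha> x" "\<alpha> 0 = 0"
  using root_linear[OF assms]
  by (simp_all add: linear_add linear_diff linear_cmul linear_neg linear_0)

lemma refl_refl: "\<alpha> \<in> roots D \<Longrightarrow> s \<alpha> (s \<alpha> u) = u"
  by (simp add: refl_def root_simps root_coroot)

lemma refl_comp_refl: "\<alpha> \<in> roots D \<Longrightarrow> s \<alpha> \<circ> s \<alpha> = id"
  by (auto simp: refl_refl)

lemma bij_refl: "\<alpha> \<in> roots D \<Longrightarrow> bij (s \<alpha>)"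
  using refl_comp_refl by (metis o_bij)

lemma refl_linear: "\<alpha> \<in> roots D \<Longrightarrow> linear (s \<alpha>)"
  by (rule linearI) (simp_all add: refl_def root_simps algebra_simps)

section \<open>The Weyl group as a group of bijections\<close>

lemma carrier_BijGroup_UNIV: "carrier (BijGroup (UNIV :: 'v set)) = {f. bij f}"
  by (auto simp: BijGroup_def Bij_def)

lemma weyl_one: "\<one>\<^bsub>W\<^esub> = id"
  by (auto simp: weyl_group_def subgroup_generated_def BijGroup_def fun_eq_iff)

lemma group_W: "group W"
  unfolding weyl_group_def by (rule group.group_subgroup_generated) (rule group_BijGroup)

lemma weyl_bij: "g \<in> carrier W \<Longrightarrow> bij g"
  using group.carrier_subgroup_generated_subset[OF group_BijGroup[of UNIV]] carrier_BijGroup_UNIV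
  unfolding weyl_group_def by blast

text \<open>\<open>BijGroup\<close> multiplies by composition restricted to the underlying set; on
  \<open>UNIV\<close> the restriction is vacuous.\<close>

lemma weyl_mult_comp: "\<lbrakk>g \<in> carrier W; h \<in> carrier W\<rbrakk> \<Longrightarrow> g \<otimes>\<^bsub>W\<^esub> h = g \<circ> h"
  using weyl_bij[of g] weyl_bij[of h]
  by (auto simp: weyl_group_def subgroup_generated_def BijGroup_def Bij_def compose_def)

lemma weyl_comp: "\<lbrakk>g \<in> carrier W; h \<in> carrier W\<rbrakk> \<Longrightarrow> g \<circ> h \<in> carrier W"
  using monoid.m_closed[OF group.is_monoid[OF group_W]] weyl_mult_comp by metis

lemma weyl_id: "id \<in> carrier W"
  using monoid.one_closed[OF group.is_monoid[OF group_W]] weyl_one by simp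

lemma carrier_W: "carrier W = generate (BijGroup UNIV) (s ` roots D)"
proof -
  have "carrier (BijGroup UNIV) \<inter> s ` roots D = s ` roots D"
    by (auto simp: carrier_BijGroup_UNIV bij_refl)
  then show ?thesis by (simp add: weyl_group_def carrier_subgroup_generated)
qed

lemma refl_in_W [simp, intro]: "\<alpha> \<in> roots D \<Longrightarrow> s \<alpha> \<in> carrier W"
  unfolding carrier_W by (auto intro: generate.incl)

text \<open>The inductive definition of \<open>generate\<close> also closes under inverses of
  generators. A reflection is its own inverse, so that case merges with the case of a
  reflection.\<close>

lemma weyl_induct_roots [consumes 1, case_names id refl comp]:
  assumes "g \<in> carrier W" and id: "Q id" and refl: "\<And>\<alpha>. \<alpha> \<in> roots D \<Longrightarrow> Q (s \<alpha>)"
    and comp: "\<And>g h. \<lbrakk>g \<in> carrier W; h \<in> carrier W; Q g; Q h\<rbrakk> \<Longrightarrow> Q (g \<circ> h)"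
  shows "Q g"
  using assms(1)[unfolded carrier_W]
proof (induction rule: generate.induct)
  case one
  then show ?case using id by (simp add: BijGroup_def id_def)
next
  case (incl h)
  then show ?case using refl by blast
next
  case (inv h)
  then obtain \<alpha> where \<alpha>: "\<alpha> \<in> roots D" "h = s \<alpha>" by blast
  have "inv\<^bsub>BijGroup UNIV\<^esub> h = h"
    using \<alpha> group.inv_equality[OF group_BijGroup[of UNIV], of h h]
    by (auto simp: carrier_BijGroup_UNIV bij_refl BijGroup_def Bij_def compose_def refl_refl)
  then show ?case using \<alpha> refl by simp
next
  case (eng g h)
  then have "g \<in> carrier W" "h \<in> carrier W" by (simp_all add: carrier_W)
  moreover from this have "g \<otimes>\<^bsub>BijGroup UNIV\<^esub> h = g \<circ> h"
    using weyl_bij by (auto simp: BijGroup_def Bij_def compose_def)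
  ultimately show ?case using comp[of g h] eng by metis
qed

text \<open>The Riesz representative of a root. Since \<open>s \<alpha>\<close> is orthogonal, the coroot is proportional to it.\<close>

definition ash :: "('v \<Rightarrow> real) \<Rightarrow> 'v" where
  "ash \<alpha> = (2 / B (coroot D \<alpha>) (coroot D \<alpha>)) *\<^sub>R coroot D \<alpha>"

lemma coroot_nonzero: "\<alpha> \<in> roots D \<Longrightarrow> coroot D \<alpha> \<noteq> 0"
  using root_coroot root_simps(5) by force

text \<open>The reflection \<open>s \<alpha>\<close> negates the coroot of \<alpha>. Invariance of B
  under \<open>s \<alpha>\<close>, applied to this coroot and w, is therefore a linear equation for
  the pairing of the two, and this is its solution.\<close>

lemma form_coroot: "\<alpha> \<in> roots D \<Longrightarrow> 2 * B (coroot D \<alpha>) w = \<alpha> w * B (coroot D \<alpha>) (coroot D \<alpha>)"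
  using form_weyl[OF refl_in_W, of \<alpha> "coroot D \<alpha>" w]
  by (simp add: refl_def form_simps root_coroot scaleR_2 algebra_simps)

lemma form_ash: "\<alpha> \<in> roots D \<Longrightarrow> B (ash \<alpha>) w = \<alpha> w"
  using form_coroot[of \<alpha> w] form_pos[OF coroot_nonzero, of \<alpha>]
  by (simp add: ash_def form_simps field_simps)

lemma ash_unique: "\<lbrakk>\<alpha> \<in> roots D; \<And>w. B u w = \<alpha> w\<rbrakk> \<Longrightarrow> u = ash \<alpha>"
  by (rule form_nondegenerate) (simp add: form_ash)

lemma form_ash_ash: "\<alpha> \<in> roots D \<Longrightarrow> B (ash \<alpha>) (ash \<alpha>) = 4 / B (coroot D \<alpha>) (coroot D \<alpha>)"
  using root_coroot[of \<alpha>] by (simp add: form_ash root_simps) (simp add: ash_def root_simps)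

text \<open>The coroot is recovered from the root and the form alone. The axioms only say that
  reflections permute the set of coroots; through this formula each individual coroot is seen to be
  compatible with negation and with reflections.\<close>

lemma coroot_conv_ash: "\<alpha> \<in> roots D \<Longrightarrow> coroot D \<alpha> = (2 / B (ash \<alpha>) (ash \<alpha>)) *\<^sub>R ash \<alpha>"
  using form_pos[OF coroot_nonzero, of \<alpha>] by (simp add: form_ash_ash) (simp add: ash_def)

lemma root_coroot_ash:
  "\<lbrakk>\<alpha> \<in> roots D\<rbrakk> \<Longrightarrow> \<alpha> (coroot D \<beta>) *\<^sub>R coroot D \<alpha> = B (coroot D \<alpha>) (coroot D \<beta>) *\<^sub>R ash \<alpha>"
  using form_coroot[of \<alpha> "coroot D \<beta>"] form_pos[OF coroot_nonzero, of \<alpha>]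
  by (simp add: ash_def field_simps)

lemma neg_root: "\<alpha> \<in> roots D \<Longrightarrow> (\<lambda>v. - \<alpha> v) \<in> roots D"
  using reflect_root[of \<alpha> \<alpha>] by (simp add: root_coroot)

lemma ash_neg: "\<alpha> \<in> roots D \<Longrightarrow> ash (\<lambda>v. - \<alpha> v) = - ash \<alpha>"
  by (rule ash_unique[OF neg_root, symmetric]) (simp_all add: form_simps form_ash)

lemma coroot_neg: "\<alpha> \<in> roots D \<Longrightarrow> coroot D (\<lambda>v. - \<alpha> v) = - coroot D \<alpha>"
  using coroot_conv_ash[of \<alpha>] coroot_conv_ash[OF neg_root, of \<alpha>] by (simp add: ash_neg form_simps)

lemma refl_neg: "\<alpha> \<in> roots D \<Longrightarrow> s (\<lambda>v. - \<alpha> v) = s \<alpha>"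
  by (auto simp: refl_def coroot_neg)

text \<open>By linearity of \<beta>, precomposition with \<open>s \<alpha>\<close> is the reflection
  of functionals from \<open>real_root_system\<close>. The action on roots is written in this form
  below.\<close>

lemma comp_refl_root: "\<lbrakk>\<alpha> \<in> roots D; \<beta> \<in> roots D\<rbrakk> \<Longrightarrow> \<beta> \<circ> s \<alpha> \<in> roots D"
  using reflect_root[of \<alpha> \<beta>] by (simp add: refl_def root_simps comp_def mult.commute)

lemma comp_refl_comp_refl: "\<alpha> \<in> roots D \<Longrightarrow> \<beta> \<circ> s \<alpha> \<circ> s \<alpha> = \<beta>"
  by (auto simp: refl_refl)

lemma form_refl_swap: "\<alpha> \<in> roots D \<Longrightarrow> B (s \<alpha> u) w = B u (s \<alpha> w)"
  using form_weyl[OF refl_in_W, of \<alpha> u "s \<alpha> w"] by (simp add: refl_refl)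

lemma ash_comp_refl: "\<lbrakk>\<alpha> \<in> roots D; \<beta> \<in> roots D\<rbrakk> \<Longrightarrow> ash (\<beta> \<circ> s \<alpha>) = s \<alpha> (ash \<beta>)"
  by (rule ash_unique[OF comp_refl_root, symmetric]) (simp_all add: form_refl_swap form_ash)

lemma coroot_comp_refl: "\<lbrakk>\<alpha> \<in> roots D; \<beta> \<in> roots D\<rbrakk> \<Longrightarrow> coroot D (\<beta> \<circ> s \<alpha>) = s \<alpha> (coroot D \<beta>)"
  using coroot_conv_ash[of \<beta>] coroot_conv_ash[OF comp_refl_root, of \<alpha> \<beta>] form_weyl[OF refl_in_W, of \<alpha>]
  by (simp add: ash_comp_refl linear_cmul[OF refl_linear])

lemma refl_comp: "\<lbrakk>\<alpha> \<in> roots D; \<beta> \<in> roots D\<rbrakk> \<Longrightarrow> s (\<beta> \<circ> s \<alpha>) = s \<alpha> \<circ> s \<beta> \<circ> s \<alpha>"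
  using refl_linear[of \<alpha>]
  by (auto simp: coroot_comp_refl refl_def[of D "\<beta> \<circ> s \<alpha>"] refl_def[of D \<beta>] linear_diff linear_cmul refl_refl)

lemma param_comp: "\<lbrakk>\<alpha> \<in> roots D; \<beta> \<in> roots D\<rbrakk> \<Longrightarrow> param D (\<beta> \<circ> s \<alpha>) = param D \<beta>"
  using inv_param refl_in_W unfolding invariant_param_def by blast

lemma comp_refl_self: "\<alpha> \<in> roots D \<Longrightarrow> \<alpha> \<circ> s \<alpha> = (\<lambda>v. - \<alpha> v)"
  by (auto simp: refl_def root_simps root_coroot)

lemma param_neg: "\<alpha> \<in> roots D \<Longrightarrow> param D (\<lambda>v. - \<alpha> v) = param D \<alpha>"
  using param_comp[of \<alpha> \<alpha>] by (simp add: comp_refl_self)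

section \<open>Positive roots and simple reflections\<close>

lemma pos_roots_subset: "\<Phi>pos \<subseteq> roots D"
  by (auto simp: pos_roots_def)

lemma pos_root [simp, intro]: "\<alpha> \<in> \<Phi>pos \<Longrightarrow> \<alpha> \<in> roots D"
  using pos_roots_subset by blast

lemma finite_pos_roots [simp, intro]: "finite \<Phi>pos"
  using finite_subset[OF pos_roots_subset finite_roots] .

lemma simple_root [simp, intro]: "\<alpha> \<in> \<Delta> \<Longrightarrow> \<alpha> \<in> roots D"
  and simple_independent: "\<lbrakk>\<And>v. (\<Sum>\<alpha>\<in>\<Delta>. c \<alpha> * \<alpha> v) = 0; \<alpha> \<in> \<Delta>\<rbrakk> \<Longrightarrow> c \<alpha> = 0"
  and pos_or_neg: "\<beta> \<in> roots D \<Longrightarrow> \<beta> \<in> \<Phi>pos \<or> (\<lambda>v. - \<beta> v) \<in> \<Phi>pos"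
  using simple unfolding simple_system_def by blast+

lemma finite_simple [simp, intro]: "finite \<Delta>"
  using finite_subset[OF _ finite_roots, of \<Delta>] by auto

lemma simple_coeffs_unique:
  "\<lbrakk>\<And>v. (\<Sum>\<alpha>\<in>\<Delta>. c \<alpha> * \<alpha> v) = (\<Sum>\<alpha>\<in>\<Delta>. d \<alpha> * \<alpha> v); \<alpha> \<in> \<Delta>\<rbrakk> \<Longrightarrow> c \<alpha> = d \<alpha>"
  using simple_independent[of "\<lambda>\<alpha>. c \<alpha> - d \<alpha>" \<alpha>] by (simp add: left_diff_distrib sum_subtractf)

lemma simple_pos [simp, intro]:
  assumes "\<gamma> \<in> \<Delta>"
  shows "\<gamma> \<in> \<Phi>pos"
proof -
  have "(\<Sum>\<alpha>\<in>\<Delta>. (if \<alpha> = \<gamma> then 1 else 0) * \<alpha> v) = \<gamma> v" for v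
  proof -
    have "(\<Sum>\<alpha>\<in>\<Delta>. (if \<alpha> = \<gamma> then 1 else 0) * \<alpha> v) = (\<Sum>\<alpha>\<in>\<Delta>. if \<alpha> = \<gamma> then \<gamma> v else 0)"
      by (intro sum.cong) auto
    then show ?thesis using assms by simp
  qed
  then have "\<gamma> = (\<lambda>v. \<Sum>\<alpha>\<in>\<Delta>. (if \<alpha> = \<gamma> then 1 else 0) * \<alpha> v)"
    by (intro ext) (rule sym)
  moreover have "\<forall>\<alpha>\<in>\<Delta>. 0 \<le> (if \<alpha> = \<gamma> then 1 else 0 :: real)" by simp
  ultimately have "\<exists>c. (\<forall>\<alpha>\<in>\<Delta>. 0 \<le> c \<alpha>) \<and> \<gamma> = (\<lambda>v. \<Sum>\<alpha>\<in>\<Delta>. c \<alpha> * \<alpha> v)"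
    by (intro exI[of _ "\<lambda>\<alpha>. if \<alpha> = \<gamma> then 1 else 0"] conjI)
  then show ?thesis
    using simple_root[OF assms] unfolding pos_roots_def by blast
qed

lemma pos_root_coeffs:
  assumes "\<beta> \<in> \<Phi>pos"
  shows "\<exists>c. (\<forall>\<alpha>\<in>\<Delta>. 0 \<le> c \<alpha>) \<and> (\<forall>v. \<beta> v = (\<Sum>\<alpha>\<in>\<Delta>. c \<alpha> * \<alpha> v))"
proof -
  obtain c where c: "\<forall>\<alpha>\<in>\<Delta>. 0 \<le> c \<alpha>" "\<beta> = (\<lambda>v. \<Sum>\<alpha>\<in>\<Delta>. c \<alpha> * \<alpha> v)"
    using assms unfolding pos_roots_def by blast
  have "\<beta> v = (\<Sum>\<alpha>\<in>\<Delta>. c \<alpha> * \<alpha> v)" for v by (rule fun_cong[OF c(2)])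
  then show ?thesis using c(1) by blast
qed

text \<open>The coefficients of \<beta> over the simple roots would be both nonnegative and
  nonpositive. They would vanish, and so would \<beta>, although \<beta> takes the value 2 on its
  coroot.\<close>

lemma pos_root_not_neg: "\<beta> \<in> \<Phi>pos \<Longrightarrow> (\<lambda>v. - \<beta> v) \<notin> \<Phi>pos"
proof
  assume \<beta>: "\<beta> \<in> \<Phi>pos" and n: "(\<lambda>v. - \<beta> v) \<in> \<Phi>pos"
  obtain c where c: "\<And>\<alpha>. \<alpha> \<in> \<Delta> \<Longrightarrow> 0 \<le> c \<alpha>" "\<And>v. \<beta> v = (\<Sum>\<alpha>\<in>\<Delta>. c \<alpha> * \<alpha> v)"
    using pos_root_coeffs[OF \<beta>] by blast
  obtain d where d: "\<And>\<alpha>. \<alpha> \<in> \<Delta> \<Longrightarrow> 0 \<le> d \<alpha>" "\<And>v. - \<beta> v = (\<Sum>\<alpha>\<in>\<Delta>. d \<alpha> * \<alpha> v)"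
    using pos_root_coeffs[OF n] by blast
  have "(\<Sum>\<alpha>\<in>\<Delta>. c \<alpha> * \<alpha> v) = (\<Sum>\<alpha>\<in>\<Delta>. - d \<alpha> * \<alpha> v)" for v
    using c(2)[of v] d(2)[of v] by (simp add: sum_negf)
  then have "c \<alpha> = - d \<alpha>" if "\<alpha> \<in> \<Delta>" for \<alpha> using that by (rule simple_coeffs_unique)
  then have "c \<alpha> = 0" if "\<alpha> \<in> \<Delta>" for \<alpha> using c(1)[OF that] d(1)[OF that] that by force
  then have "\<beta> v = 0" for v using c(2) by simp
  then show False using root_coroot[of \<beta>] \<beta> by (metis pos_root zero_neq_numeral)
qed

text \<open>Reflecting in \<gamma> subtracts a multiple of \<gamma>, so only the coefficient at
  \<gamma> moves. Both the positivity of the reflected root and the drop of its height are read off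
  from this.\<close>

lemma comp_simple_refl_coeffs:
  assumes "\<gamma> \<in> \<Delta>" "\<And>v. \<beta> v = (\<Sum>\<alpha>\<in>\<Delta>. c \<alpha> * \<alpha> v)" "\<beta> \<in> roots D"
  shows "(\<beta> \<circ> s \<gamma>) v = (\<Sum>\<alpha>\<in>\<Delta>. (if \<alpha> = \<gamma> then c \<alpha> - \<beta> (coroot D \<gamma>) else c \<alpha>) * \<alpha> v)"
proof -
  have "(\<Sum>\<alpha>\<in>\<Delta>. (if \<alpha> = \<gamma> then c \<alpha> - \<beta> (coroot D \<gamma>) else c \<alpha>) * \<alpha> v)
      = (\<Sum>\<alpha>\<in>\<Delta>. c \<alpha> * \<alpha> v - (if \<alpha> = \<gamma> then \<beta> (coroot D \<gamma>) * \<gamma> v else 0))"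
    by (intro sum.cong) (auto simp: left_diff_distrib)
  also have "\<dots> = \<beta> v - \<beta> (coroot D \<gamma>) * \<gamma> v"
    using assms(1) by (simp add: sum_subtractf assms(2)[symmetric])
  finally show ?thesis using assms(3) by (simp add: refl_def root_simps)
qed

text \<open>If the reflected root were negative, every coefficient of \<beta> away from \<gamma>
  would be both nonnegative and nonpositive, since the reflection does not touch it. Then \<beta> is
  a multiple of \<gamma>; reducedness makes the factor 1 or -1, positivity makes it 1.\<close>

lemma simple_refl_pos:
  assumes \<gamma>: "\<gamma> \<in> \<Delta>" and \<beta>: "\<beta> \<in> \<Phi>pos" and ne: "\<beta> \<noteq> \<gamma>"
  shows "\<beta> \<circ> s \<gamma> \<in> \<Phi>pos"
proof (rule ccontr)
  assume "\<beta> \<circ> s \<gamma> \<notin> \<Phi>pos"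
  then have n: "(\<lambda>v. - (\<beta> \<circ> s \<gamma>) v) \<in> \<Phi>pos"
    using pos_or_neg[OF comp_refl_root, of \<gamma> \<beta>] \<gamma> \<beta> by auto
  obtain c where c: "\<And>\<alpha>. \<alpha> \<in> \<Delta> \<Longrightarrow> 0 \<le> c \<alpha>" "\<And>v. \<beta> v = (\<Sum>\<alpha>\<in>\<Delta>. c \<alpha> * \<alpha> v)"
    using pos_root_coeffs[OF \<beta>] by blast
  obtain d where d: "\<And>\<alpha>. \<alpha> \<in> \<Delta> \<Longrightarrow> 0 \<le> d \<alpha>" "\<And>v. - (\<beta> \<circ> s \<gamma>) v = (\<Sum>\<alpha>\<in>\<Delta>. d \<alpha> * \<alpha> v)"
    using pos_root_coeffs[OF n] by blast
  have "(\<Sum>\<alpha>\<in>\<Delta>. (if \<alpha> = \<gamma> then c \<alpha> - \<beta> (coroot D \<gamma>) else c \<alpha>) * \<alpha> v) = (\<Sum>\<alpha>\<in>\<Delta>. - d \<alpha> * \<alpha> v)" for v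
    using comp_simple_refl_coeffs[OF \<gamma> c(2), of v] d(2)[of v] \<beta> by (simp add: sum_negf)
  then have "(if \<alpha> = \<gamma> then c \<alpha> - \<beta> (coroot D \<gamma>) else c \<alpha>) = - d \<alpha>" if "\<alpha> \<in> \<Delta>" for \<alpha>
    using that by (rule simple_coeffs_unique)
  then have "c \<alpha> = - d \<alpha>" if "\<alpha> \<in> \<Delta>" "\<alpha> \<noteq> \<gamma>" for \<alpha> using that by fastforce
  then have c0: "c \<alpha> = 0" if "\<alpha> \<in> \<Delta>" "\<alpha> \<noteq> \<gamma>" for \<alpha> using c(1)[OF that(1)] d(1)[OF that(1)] that by force
  have "\<beta> v = c \<gamma> * \<gamma> v" for v
  proof -
    have "\<beta> v = (\<Sum>\<alpha>\<in>\<Delta>. if \<alpha> = \<gamma> then c \<gamma> * \<gamma> v else 0)"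
      unfolding c(2) using c0 by (intro sum.cong) auto
    then show ?thesis using \<gamma> by simp
  qed
  then have eq: "\<beta> = (\<lambda>v. c \<gamma> * \<gamma> v)" by auto
  then have "c \<gamma> = 1 \<or> c \<gamma> = - 1" using root_reduced[of \<gamma> "c \<gamma>"] \<gamma> \<beta> by auto
  then have "c \<gamma> = 1" using c(1)[OF \<gamma>] by auto
  then show False using eq ne by auto
qed

text \<open>The map is an involution and serves as its own inverse. It does not reach \<gamma>,
  because only the negative of \<gamma> is sent there and that root is not positive.\<close>

lemma simple_refl_permutes:
  assumes "\<gamma> \<in> \<Delta>"
  shows "bij_betw (\<lambda>\<beta>. \<beta> \<circ> s \<gamma>) (\<Phi>pos - {\<gamma>}) (\<Phi>pos - {\<gamma>})"
proof (rule bij_betw_byWitness[where f' = "\<lambda>\<beta>. \<beta> \<circ> s \<gamma>"])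
  have "\<beta> \<circ> s \<gamma> \<noteq> \<gamma>" if "\<beta> \<in> \<Phi>pos" for \<beta>
    using comp_refl_comp_refl[of \<gamma> \<beta>] comp_refl_self[of \<gamma>] assms that pos_root_not_neg[of \<gamma>] by auto
  then show "(\<lambda>\<beta>. \<beta> \<circ> s \<gamma>) ` (\<Phi>pos - {\<gamma>}) \<subseteq> \<Phi>pos - {\<gamma>}"
    using assms simple_refl_pos by auto
  then show "(\<lambda>\<beta>. \<beta> \<circ> s \<gamma>) ` (\<Phi>pos - {\<gamma>}) \<subseteq> \<Phi>pos - {\<gamma>}" .
qed (use assms comp_refl_comp_refl in auto)

text \<open>A positive root \<open>\<beta>\<close> of least height whose reflection is missing cannot be simple; as \<open>\<beta> (coroot \<beta>) > 0\<close>,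
  some simple reflection maps it to a positive root of smaller height.\<close>

lemma refl_generated_by_simple:
  assumes id: "id \<in> S" and simple: "\<And>\<gamma>. \<gamma> \<in> \<Delta> \<Longrightarrow> s \<gamma> \<in> S"
    and comp: "\<And>g h. \<lbrakk>g \<in> S; h \<in> S\<rbrakk> \<Longrightarrow> g \<circ> h \<in> S"
    and \<alpha>: "\<alpha> \<in> roots D"
  shows "s \<alpha> \<in> S"
proof -
  have "\<forall>\<beta>. \<exists>c. \<beta> \<in> \<Phi>pos \<longrightarrow> (\<forall>\<alpha>\<in>\<Delta>. 0 \<le> c \<alpha>) \<and> (\<forall>v. \<beta> v = (\<Sum>\<alpha>\<in>\<Delta>. c \<alpha> * \<alpha> v))"
    by (metis pos_root_coeffs)
  then obtain C where C0: "\<And>\<beta> \<alpha>. \<lbrakk>\<beta> \<in> \<Phi>pos; \<alpha> \<in> \<Delta>\<rbrakk> \<Longrightarrow> 0 \<le> C \<beta> \<alpha>"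
    and C: "\<And>\<beta> v. \<beta> \<in> \<Phi>pos \<Longrightarrow> \<beta> v = (\<Sum>\<alpha>\<in>\<Delta>. C \<beta> \<alpha> * \<alpha> v)"
    by metis
  define ht where "ht \<beta> = (\<Sum>\<alpha>\<in>\<Delta>. C \<beta> \<alpha>)" for \<beta>
  have pos: "s \<beta> \<in> S" if "\<beta> \<in> \<Phi>pos" for \<beta>
  proof (rule ccontr)
    assume "s \<beta> \<notin> S"
    let ?X = "{\<beta> \<in> \<Phi>pos. s \<beta> \<notin> S}"
    have X: "finite ?X" "?X \<noteq> {}" using that \<open>s \<beta> \<notin> S\<close> by auto
    define \<beta>0 where "\<beta>0 = arg_min_on ht ?X"
    have \<beta>0: "\<beta>0 \<in> ?X"
      unfolding \<beta>0_def by (rule arg_min_if_finite(1)[OF X])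
    have min: "ht \<beta>0 \<le> ht \<beta>" if "\<beta> \<in> ?X" for \<beta>
      unfolding \<beta>0_def by (rule arg_min_least[OF X that])
    have b: "\<beta>0 \<in> \<Phi>pos" and nS: "s \<beta>0 \<notin> S" using \<beta>0 by auto
    have "(\<Sum>\<alpha>\<in>\<Delta>. C \<beta>0 \<alpha> * \<alpha> (coroot D \<beta>0)) > 0"
      using C[OF b, of "coroot D \<beta>0"] root_coroot[of \<beta>0] b by simp
    then have "\<not> (\<forall>\<delta>\<in>\<Delta>. C \<beta>0 \<delta> * \<delta> (coroot D \<beta>0) \<le> 0)"
      using sum_nonpos[of \<Delta> "\<lambda>\<delta>. C \<beta>0 \<delta> * \<delta> (coroot D \<beta>0)"] by auto
    then obtain \<delta> where \<delta>: "\<delta> \<in> \<Delta>" "C \<beta>0 \<delta> * \<delta> (coroot D \<beta>0) > 0"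
      by (auto simp: not_le)
    then have pos\<delta>: "\<delta> (coroot D \<beta>0) > 0"
      using C0[OF b \<delta>(1)] by (simp add: zero_less_mult_iff)
    \<comment> \<open>The value of either root on the coroot of the other has the sign of B on the
      two coroots. Positivity thus passes by symmetry from \<delta> on the coroot of \<beta>0 to
      \<beta>0 on the coroot of \<delta>, and the latter is the amount by which the height
      drops.\<close>
    have "2 * B (coroot D \<delta>) (coroot D \<beta>0) > 0"
      using pos\<delta> \<delta>(1) form_pos[OF coroot_nonzero, of \<delta>]
      by (subst form_coroot) (auto intro: mult_pos_pos)
    then have "\<beta>0 (coroot D \<delta>) * B (coroot D \<beta>0) (coroot D \<beta>0) > 0"
      using form_coroot[of \<beta>0 "coroot D \<delta>"] form_sym[of "coroot D \<delta>" "coroot D \<beta>0"] b by simp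
    then have pos\<beta>: "\<beta>0 (coroot D \<delta>) > 0"
      using form_pos[OF coroot_nonzero, of \<beta>0] b by (simp add: zero_less_mult_iff)
    have "\<beta>0 \<noteq> \<delta>" using nS simple \<delta>(1) by blast
    then have b': "\<beta>0 \<circ> s \<delta> \<in> \<Phi>pos" using simple_refl_pos \<delta>(1) b by blast
    have "(\<Sum>\<alpha>\<in>\<Delta>. C (\<beta>0 \<circ> s \<delta>) \<alpha> * \<alpha> v)
        = (\<Sum>\<alpha>\<in>\<Delta>. (if \<alpha> = \<delta> then C \<beta>0 \<alpha> - \<beta>0 (coroot D \<delta>) else C \<beta>0 \<alpha>) * \<alpha> v)" for v
      using comp_simple_refl_coeffs[OF \<delta>(1) C[OF b], of v] C[OF b', of v] b by simp
    then have "C (\<beta>0 \<circ> s \<delta>) \<alpha> = (if \<alpha> = \<delta> then C \<beta>0 \<alpha> - \<beta>0 (coroot D \<delta>) else C \<beta>0 \<alpha>)" if "\<alpha> \<in> \<Delta>" for \<alpha>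
      using that by (rule simple_coeffs_unique)
    then have "ht (\<beta>0 \<circ> s \<delta>) = (\<Sum>\<alpha>\<in>\<Delta>. C \<beta>0 \<alpha> - (if \<alpha> = \<delta> then \<beta>0 (coroot D \<delta>) else 0))"
      unfolding ht_def by (intro sum.cong) auto
    also have "\<dots> = ht \<beta>0 - \<beta>0 (coroot D \<delta>)"
      using \<delta>(1) by (simp add: sum_subtractf ht_def)
    finally have "\<beta>0 \<circ> s \<delta> \<notin> ?X" using min[of "\<beta>0 \<circ> s \<delta>"] pos\<beta> by auto
    then have "s (\<beta>0 \<circ> s \<delta>) \<in> S" using b' by auto
    then have "s \<delta> \<circ> s (\<beta>0 \<circ> s \<delta>) \<circ> s \<delta> \<in> S" using comp simple \<delta>(1) by blast
    moreover have "s \<delta> \<circ> s (\<beta>0 \<circ> s \<delta>) \<circ> s \<delta> = s \<beta>0"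
      using refl_comp[of \<delta> "\<beta>0 \<circ> s \<delta>"] \<delta>(1) b b' by (simp add: comp_refl_comp_refl)
    ultimately show False using nS by simp
  qed
  then show ?thesis
    using pos_or_neg[OF \<alpha>] pos[of "\<lambda>v. - \<alpha> v"] by (auto simp: refl_neg[OF \<alpha>])
qed

text \<open>The group is generated by all reflections, but the Hecke relations and the permutation
  of positive roots concern simple ones. This induction bridges the gap: the elements satisfying Q
  contain the simple reflections and are closed under composition.\<close>

lemma weyl_induct [consumes 1, case_names id simple comp]:
  assumes "g \<in> carrier W" and "Q id" and "\<And>\<gamma>. \<gamma> \<in> \<Delta> \<Longrightarrow> Q (s \<gamma>)"
    and "\<And>g h. \<lbrakk>g \<in> carrier W; h \<in> carrier W; Q g; Q h\<rbrakk> \<Longrightarrow> Q (g \<circ> h)"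
  shows "Q g"
proof -
  have "s \<alpha> \<in> {g \<in> carrier W. Q g}" if "\<alpha> \<in> roots D" for \<alpha>
  proof (rule refl_generated_by_simple[OF _ _ _ that])
    show "id \<in> {g \<in> carrier W. Q g}" using weyl_id assms(2) by blast
    show "s \<gamma> \<in> {g \<in> carrier W. Q g}" if "\<gamma> \<in> \<Delta>" for \<gamma> using that assms(3) by blast
    show "g \<circ> h \<in> {g \<in> carrier W. Q g}"
      if "g \<in> {g \<in> carrier W. Q g}" "h \<in> {g \<in> carrier W. Q g}" for g h
      using that assms(4) weyl_comp by blast
  qed
  then have "Q (s \<alpha>)" if "\<alpha> \<in> roots D" for \<alpha> using that by blast
  with assms(1,2) show ?thesis
    by (rule weyl_induct_roots) (assumption | rule assms(4))+
qed

text \<open>Both \<open>Omega_W\<close> and \<open>Omega_W'\<close> are sums over pairs of positive roots of a function \<open>F\<close> that is odd in either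
  argument. A simple reflection changes the sign of exactly one positive root, \<open>\<gamma>\<close>, and the pairs involving \<open>\<gamma>\<close>
  cancel.\<close>

lemma sum_pos_roots_simple_refl:
  fixes F :: "('v \<Rightarrow> real) \<Rightarrow> ('v \<Rightarrow> real) \<Rightarrow> 'b::ab_group_add"
  assumes \<gamma>: "\<gamma> \<in> \<Delta>"
    and torsion_free: "\<And>x :: 'b. x + x = 0 \<Longrightarrow> x = 0"
    and odd1: "\<And>\<alpha> \<beta>. \<lbrakk>\<alpha> \<in> roots D; \<beta> \<in> roots D\<rbrakk> \<Longrightarrow> F (\<lambda>v. - \<alpha> v) \<beta> = - F \<alpha> \<beta>"
    and odd2: "\<And>\<alpha> \<beta>. \<lbrakk>\<alpha> \<in> roots D; \<beta> \<in> roots D\<rbrakk> \<Longrightarrow> F \<alpha> (\<lambda>v. - \<beta> v) = - F \<alpha> \<beta>"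
    and cancel: "\<And>\<beta>. \<beta> \<in> roots D \<Longrightarrow> F \<gamma> (\<beta> \<circ> s \<gamma>) + F (\<beta> \<circ> s \<gamma>) \<gamma> = - (F \<gamma> \<beta> + F \<beta> \<gamma>)"
  shows "(\<Sum>\<alpha>\<in>\<Phi>pos. \<Sum>\<beta>\<in>\<Phi>pos. F (\<alpha> \<circ> s \<gamma>) (\<beta> \<circ> s \<gamma>)) = (\<Sum>\<alpha>\<in>\<Phi>pos. \<Sum>\<beta>\<in>\<Phi>pos. F \<alpha> \<beta>)"
proof -
  let ?P = "\<Phi>pos - {\<gamma>}"
  have rm: "sum H \<Phi>pos = H \<gamma> + sum H ?P" for H :: "('v \<Rightarrow> real) \<Rightarrow> 'b"
    using \<gamma> by (intro sum.remove) auto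
  have split: "(\<Sum>\<alpha>\<in>\<Phi>pos. \<Sum>\<beta>\<in>\<Phi>pos. G \<alpha> \<beta>)
      = G \<gamma> \<gamma> + (\<Sum>\<beta>\<in>?P. G \<gamma> \<beta> + G \<beta> \<gamma>) + (\<Sum>\<alpha>\<in>?P. \<Sum>\<beta>\<in>?P. G \<alpha> \<beta>)"
    for G :: "('v \<Rightarrow> real) \<Rightarrow> ('v \<Rightarrow> real) \<Rightarrow> 'b"
    by (simp add: rm sum.distrib add_ac)
  have perm: "(\<Sum>\<beta>\<in>?P. g (\<beta> \<circ> s \<gamma>)) = sum g ?P" for g :: "('v \<Rightarrow> real) \<Rightarrow> 'b"
    by (rule sum.reindex_bij_betw[OF simple_refl_permutes[OF \<gamma>]])
  \<comment> \<open>Reindexing by \<open>s \<gamma>\<close> and then using \<open>cancel\<close>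
    shows that this sum is its own negative. Absence of 2-torsion makes it zero.\<close>
  have cross: "(\<Sum>\<beta>\<in>?P. F \<gamma> \<beta> + F \<beta> \<gamma>) = 0"
  proof -
    have "(\<Sum>\<beta>\<in>?P. F \<gamma> \<beta> + F \<beta> \<gamma>) = (\<Sum>\<beta>\<in>?P. - (F \<gamma> \<beta> + F \<beta> \<gamma>))"
      by (subst perm[symmetric]) (intro sum.cong, auto simp: cancel)
    then show ?thesis
      unfolding sum_negf by (intro torsion_free[OF iffD1[OF eq_neg_iff_add_eq_0]])
  qed
  have g: "\<gamma> \<circ> s \<gamma> = (\<lambda>v. - \<gamma> v)" using \<gamma> by (simp add: comp_refl_self)
  have root: "\<beta> \<circ> s \<gamma> \<in> roots D" if "\<beta> \<in> ?P" for \<beta>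
    using that \<gamma> comp_refl_root by blast
  have "(\<Sum>\<alpha>\<in>?P. \<Sum>\<beta>\<in>?P. F (\<alpha> \<circ> s \<gamma>) (\<beta> \<circ> s \<gamma>)) = (\<Sum>\<alpha>\<in>?P. \<Sum>\<beta>\<in>?P. F \<alpha> \<beta>)"
    using perm[of "\<lambda>\<alpha>. \<Sum>\<beta>\<in>?P. F \<alpha> \<beta>"] perm by simp
  moreover have "(\<Sum>\<beta>\<in>?P. F (\<gamma> \<circ> s \<gamma>) (\<beta> \<circ> s \<gamma>) + F (\<beta> \<circ> s \<gamma>) (\<gamma> \<circ> s \<gamma>)) = 0"
  proof -
    have "(\<Sum>\<beta>\<in>?P. F (\<gamma> \<circ> s \<gamma>) (\<beta> \<circ> s \<gamma>) + F (\<beta> \<circ> s \<gamma>) (\<gamma> \<circ> s \<gamma>))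
        = (\<Sum>\<beta>\<in>?P. F \<gamma> \<beta> + F \<beta> \<gamma>)"
    proof (intro sum.cong refl)
      fix \<beta> assume \<beta>: "\<beta> \<in> ?P"
      have "F (\<gamma> \<circ> s \<gamma>) (\<beta> \<circ> s \<gamma>) + F (\<beta> \<circ> s \<gamma>) (\<gamma> \<circ> s \<gamma>)
          = - (F \<gamma> (\<beta> \<circ> s \<gamma>) + F (\<beta> \<circ> s \<gamma>) \<gamma>)"
        unfolding g using \<gamma> root[OF \<beta>] by (simp add: odd1 odd2 del: comp_apply)
      also have "\<dots> = F \<gamma> \<beta> + F \<beta> \<gamma>" using \<beta> by (subst cancel) auto
      finally show "F (\<gamma> \<circ> s \<gamma>) (\<beta> \<circ> s \<gamma>) + F (\<beta> \<circ> s \<gamma>) (\<gamma> \<circ> s \<gamma>) = F \<gamma> \<beta> + F \<beta> \<gamma>" .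
    qed
    then show ?thesis using cross by simp
  qed
  \<comment> \<open>On the diagonal both arguments change sign, so the two signs cancel.\<close>
  moreover have "F (\<gamma> \<circ> s \<gamma>) (\<gamma> \<circ> s \<gamma>) = F \<gamma> \<gamma>"
    using \<gamma> neg_root[of \<gamma>] by (simp add: g odd1 odd2)
  ultimately show ?thesis using cross by (simp add: split)
qed

end

section \<open>The complexification\<close>

interpretation cx: vector_space "cscale :: complex \<Rightarrow> 'v::real_vector cx \<Rightarrow> 'v cx"
  by (rule vector_space_cscale)

lemma cdual_add: "l \<in> cdual \<Longrightarrow> l (u + w) = l u + l w"
  and cdual_cscale: "l \<in> cdual \<Longrightarrow> l (cscale c u) = c * l u"
  unfolding cdual_def mem_Collect_eq
  using Vector_Spaces.linear.axioms(3) module_hom.add module_hom.scale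
  by (metis Vector_Spaces.linear_iff)+

lemma cdual_sum: "l \<in> cdual \<Longrightarrow> l (\<Sum>i\<in>S. cscale (c i) (f i)) = (\<Sum>i\<in>S. c i * l (f i))"
  using cdual_cscale[of l 0 0]
  by (induction S rule: infinite_finite_induct) (auto simp: cdual_add cdual_cscale)

lemma cdualI: "\<lbrakk>\<And>u w. l (u + w) = l u + l w; \<And>c u. l (cscale c u) = c * l u\<rbrakk> \<Longrightarrow> l \<in> cdual"
  unfolding cdual_def mem_Collect_eq Vector_Spaces.linear_iff
  by (simp add: vector_space_cscale) (unfold_locales, auto simp: algebra_simps)

context root_datum
begin

abbreviation "BC \<equiv> cext_form B"

lemma cext_form_simps:
  "BC (u + u') w = BC u w + BC u' w" "BC u (w + w') = BC u w + BC u w'"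
  "BC (cscale c u) w = c * BC u w" "BC u (cscale c w) = c * BC u w"
  by (simp_all add: cext_form_def cscale_def form_simps complex_eq_iff algebra_simps)

lemma cext_form_sym: "BC u w = BC w u"
  by (simp add: cext_form_def form_sym)

lemma cext_form_sum: "BC (\<Sum>i\<in>S. cscale (c i) (f i)) w = (\<Sum>i\<in>S. c i * BC (f i) w)"
  using cext_form_simps(3)[of 0 0 w]
  by (induction S rule: infinite_finite_induct) (auto simp: cext_form_simps)

text \<open>The extended form is complex bilinear, not Hermitian, and has isotropic vectors in
  general, so pairing x with itself does not suffice. Pairing x with its complex conjugate gives the
  sum of the values of B on real and imaginary part, which is positive unless both vanish.\<close>

lemma cext_form_nondegenerate:
  assumes "\<And>w. BC u w = BC u' w"
  shows "u = u'"
proof -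
  define x where "x = u - u'"
  have "BC x w = 0" for w
    using assms[of w] cext_form_simps(1)[of x u' w] by (simp add: x_def)
  from this[of "(fst x, - snd x)"] have "B (fst x) (fst x) + B (snd x) (snd x) = 0"
    by (simp add: cext_form_def form_simps complex_eq_iff)
  then have "fst x = 0 \<and> snd x = 0"
    using form_pos[of "fst x"] form_pos[of "snd x"] form_simps(5)[of 0] by (smt (verit))
  then show ?thesis unfolding x_def by (metis eq_iff_diff_eq_0 prod.collapse zero_prod_def)
qed

lemma cext_simps:
  assumes "\<alpha> \<in> roots D"
  shows "cext \<alpha> (u + w) = cext \<alpha> u + cext \<alpha> w" "cext \<alpha> (cscale c u) = c * cext \<alpha> u"
  using assms by (simp_all add: cext_def cscale_def root_simps complex_eq_iff algebra_simps)

lemma cext_cdual: "\<alpha> \<in> roots D \<Longrightarrow> cext \<alpha> \<in> cdual"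
  by (rule cdualI) (simp_all add: cext_simps)

lemma cext_neg: "cext (\<lambda>v. - \<alpha> v) = (\<lambda>u. - cext \<alpha> u)"
  by (auto simp: cext_def)

text \<open>\<open>aC \<alpha>\<close> and \<open>cor \<alpha>\<close> are the Riesz vector and the coroot of \<open>\<alpha>\<close>, viewed in the complexification.\<close>

definition aC :: "('v \<Rightarrow> real) \<Rightarrow> 'v cx" where "aC \<alpha> = (ash \<alpha>, 0)"

lemma cext_form_aC: "\<alpha> \<in> roots D \<Longrightarrow> BC (aC \<alpha>) u = cext \<alpha> u"
  by (simp add: aC_def cext_form_def cext_def form_ash form_simps)

lemma sharp_cext: "\<alpha> \<in> roots D \<Longrightarrow> sharp B (cext \<alpha>) = aC \<alpha>"
  unfolding sharp_def by (rule the_equality) (auto simp: cext_form_aC intro: cext_form_nondegenerate)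

lemma dual_form_cext: "\<lbrakk>\<alpha> \<in> roots D; \<beta> \<in> roots D\<rbrakk> \<Longrightarrow> dual_form B (cext \<alpha>) (cext \<beta>) = cext \<alpha> (aC \<beta>)"
  by (simp add: dual_form_def sharp_cext cext_form_aC)

lemma cext_aC: "\<alpha> \<in> roots D \<Longrightarrow> cext \<alpha> (aC \<beta>) = complex_of_real (B (ash \<alpha>) (ash \<beta>))"
  by (simp add: aC_def cext_def form_ash root_simps)

abbreviation sC :: "('v \<Rightarrow> real) \<Rightarrow> 'v cx \<Rightarrow> 'v cx" where "sC \<alpha> \<equiv> map_prod (s \<alpha>) (s \<alpha>)"

definition cor :: "('v \<Rightarrow> real) \<Rightarrow> 'v cx" where "cor \<alpha> = (coroot D \<alpha>, 0)"

text \<open>The reflection formula is stated as a sum, so that any map respecting addition and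
  scaling can be applied to it directly.\<close>

lemma sC_eq: "\<alpha> \<in> roots D \<Longrightarrow> sC \<alpha> u + cscale (cext \<alpha> u) (cor \<alpha>) = u"
  by (cases u) (simp add: refl_def cor_def cscale_def cext_def)

lemma sC_sC: "\<alpha> \<in> roots D \<Longrightarrow> sC \<alpha> (sC \<alpha> u) = u"
  by (cases u) (simp add: refl_refl)

lemma cext_sC: "cext \<beta> (sC \<alpha> u) = cext (\<beta> \<circ> s \<alpha>) u"
  by (cases u) (simp add: cext_def)

lemma cext_sC_self: "\<alpha> \<in> roots D \<Longrightarrow> cext \<alpha> (sC \<alpha> u) = - cext \<alpha> u"
  by (simp add: cext_sC comp_refl_self cext_neg del: comp_apply)

lemma sC_aC_self: "\<alpha> \<in> roots D \<Longrightarrow> sC \<alpha> (aC \<alpha>) = cscale (- 1) (aC \<alpha>)"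
  using form_coroot[of \<alpha> "coroot D \<alpha>"] coroot_nonzero[of \<alpha>]
  by (simp add: aC_def cscale_def refl_def ash_def root_simps root_coroot)
     (simp add: scaleR_2 flip: scaleR_left.add scaleR_diff_left)

end

section \<open>Expansions in a basis and its two dual bases\<close>

locale root_datum_basis = root_datum D for D :: "'v::real_vector hecke_datum" +
  fixes I :: "'i set" and v vu :: "'i \<Rightarrow> 'v cx" and vs :: "'i \<Rightarrow> 'v cx \<Rightarrow> complex"
  assumes basis: "basis_with_duals D I v vu vs"
begin

lemma finite_I [simp, intro]: "finite I"
  and BC_v_vu: "\<lbrakk>i \<in> I; j \<in> I\<rbrakk> \<Longrightarrow> BC (v i) (vu j) = (if i = j then 1 else 0)"
  and vs_cdual [simp, intro]: "i \<in> I \<Longrightarrow> vs i \<in> cdual"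
  and vs_v: "\<lbrakk>i \<in> I; j \<in> I\<rbrakk> \<Longrightarrow> vs i (v j) = (if i = j then 1 else 0)"
  using basis unfolding basis_with_duals_def by auto

lemma basis_coefficients: "\<exists>c. u = (\<Sum>i\<in>I. cscale (c i) (v i))"
proof -
  have inj: "inj_on v I" and "u \<in> cx.span (v ` I)"
    using basis unfolding basis_with_duals_def by auto
  then obtain c where "u = (\<Sum>w\<in>v ` I. cscale (c w) w)"
    by (auto simp: cx.span_finite)
  then have "u = (\<Sum>i\<in>I. cscale (c (v i)) (v i))"
    by (simp add: sum.reindex[OF inj])
  then show ?thesis by (rule exI[of _ "\<lambda>i. c (v i)"])
qed

lemma basis_expansion: "(\<Sum>i\<in>I. cscale (BC u (vu i)) (v i)) = u"
proof -
  obtain c where c: "u = (\<Sum>i\<in>I. cscale (c i) (v i))" using basis_coefficients by blast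
  have "BC u (vu j) = c j" if "j \<in> I" for j
    unfolding c using that by (simp add: cext_form_sum BC_v_vu if_distrib[of "(*) _"] cong: if_cong)
  then show ?thesis by (subst (2) c) simp
qed

lemma vs_expansion: "(\<Sum>i\<in>I. cscale (vs i u) (v i)) = u"
proof -
  obtain c where c: "u = (\<Sum>i\<in>I. cscale (c i) (v i))" using basis_coefficients by blast
  have "vs j u = c j" if "j \<in> I" for j
    unfolding c using that by (simp add: cdual_sum vs_v if_distrib[of "(*) _"] cong: if_cong)
  then show ?thesis by (subst (2) c) simp
qed

text \<open>That \<open>vu\<close> spans is a consequence of duality: both sides have the same
  pairing with every w, as one sees by expanding w in the basis \<open>v\<close>, and the form is
  nondegenerate.\<close>

lemma dual_basis_expansion: "(\<Sum>i\<in>I. cscale (BC u (v i)) (vu i)) = u"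
proof (rule cext_form_nondegenerate)
  fix w
  have "BC (vu i) w = (\<Sum>j\<in>I. BC w (vu j) * BC (vu i) (v j))" for i
    by (subst basis_expansion[of w, symmetric]) (simp add: cext_form_sym[of "vu i"] cext_form_sum)
  also have "\<dots> i = BC w (vu i)" if "i \<in> I" for i
    using that by (simp add: cext_form_sym[of "vu i"] BC_v_vu if_distrib[of "(*) _"] cong: if_cong)
  finally have "BC (\<Sum>i\<in>I. cscale (BC u (v i)) (vu i)) w = (\<Sum>i\<in>I. BC u (v i) * BC w (vu i))"
    by (simp add: cext_form_sum)
  also have "\<dots> = BC w u"
    using cext_form_sum[of "\<lambda>i. BC w (vu i)" v I u]
    by (simp add: basis_expansion cext_form_sym[of u] mult.commute)
  finally show "BC (\<Sum>i\<in>I. cscale (BC u (v i)) (vu i)) w = BC u w" by (simp add: cext_form_sym)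
qed

lemma root_dual_basis: "\<alpha> \<in> roots D \<Longrightarrow> (\<Sum>i\<in>I. cscale (cext \<alpha> (v i)) (vu i)) = aC \<alpha>"
  using dual_basis_expansion[of "aC \<alpha>"] by (simp add: cext_form_aC)

lemma root_basis: "\<alpha> \<in> roots D \<Longrightarrow> (\<Sum>i\<in>I. cscale (cext \<alpha> (vu i)) (v i)) = aC \<alpha>"
  using basis_expansion[of "aC \<alpha>"] by (simp add: cext_form_aC)

lemma cdual_expansion:
  assumes "l \<in> cdual"
  shows "l u = (\<Sum>i\<in>I. l (v i) * vs i u)"
  using cdual_sum[OF assms, of "\<lambda>i. vs i u" v I] by (simp add: vs_expansion mult.commute)

end

section \<open>The group algebra of the Weyl group\<close>

context root_datum
begin

abbreviation "C \<equiv> CW D"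
abbreviation mult_C (infixl "\<star>" 70) where "x \<star> y \<equiv> x \<otimes>\<^bsub>C\<^esub> y"

lemma monoid_W: "monoid W"
  using group_W by (rule group.is_monoid)

sublocale C: complex_algebra "CW D"
  unfolding CW_def by (rule complex_algebra_monoid_algebra[OF monoid_W])

abbreviation "\<delta> g \<equiv> Poly_Mapping.single g (1::complex)"

lemma carrier_C: "carrier C = {f. Poly_Mapping.keys f \<subseteq> carrier W}"
  and add_C: "(\<oplus>\<^bsub>C\<^esub>) = (+)"
  and one_C: "\<one>\<^bsub>C\<^esub> = Poly_Mapping.single id 1"
  and smult_C: "(\<odot>\<^bsub>C\<^esub>) = (\<lambda>c. Poly_Mapping.map ((*) c))"
  by (simp_all add: CW_def weyl_one)

lemma mult_C_single:
  "\<lbrakk>g \<in> carrier W; h \<in> carrier W\<rbrakk> \<Longrightarrow>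
    Poly_Mapping.single g a \<star> Poly_Mapping.single h b = Poly_Mapping.single (g \<circ> h) (a * b)"
  by (simp add: CW_def weyl_mult_comp)

lemma single_in_C [simp, intro]: "g \<in> carrier W \<Longrightarrow> Poly_Mapping.single g c \<in> carrier C"
  by (simp add: carrier_C)

lemma minus_C: "\<lbrakk>x \<in> carrier C; y \<in> carrier C\<rbrakk> \<Longrightarrow> x \<ominus>\<^bsub>C\<^esub> y = x - y"
  unfolding CW_def by (rule minus_monoid_algebra[OF monoid_W])

lemma finsum_C: "(\<And>i. i \<in> S \<Longrightarrow> f i \<in> carrier C) \<Longrightarrow> finsum C f S = (\<Sum>i\<in>S. f i)"
  unfolding CW_def by (rule finsum_monoid_algebra[OF monoid_W])

lemma sW_closed [simp, intro]: "\<alpha> \<in> roots D \<Longrightarrow> sW D \<alpha> \<in> carrier C"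
  by (auto simp: sW_def)

lemma sW_sW: "\<alpha> \<in> roots D \<Longrightarrow> sW D \<alpha> \<star> sW D \<alpha> = \<one>\<^bsub>C\<^esub>"
  by (simp add: sW_def mult_C_single refl_comp_refl one_C)

lemma sW_cancel: "\<lbrakk>\<gamma> \<in> roots D; x \<in> carrier C\<rbrakk> \<Longrightarrow> sW D \<gamma> \<star> (sW D \<gamma> \<star> x) = x"
  by (simp add: sW_sW flip: C.m_assoc)

lemma sW_neg: "\<alpha> \<in> roots D \<Longrightarrow> sW D (\<lambda>v. - \<alpha> v) = sW D \<alpha>"
  by (simp add: sW_def refl_neg)

lemma sW_conj:
  "\<lbrakk>\<alpha> \<in> roots D; \<beta> \<in> roots D\<rbrakk> \<Longrightarrow> sW D \<alpha> \<star> sW D \<beta> \<star> sW D \<alpha> = sW D (\<beta> \<circ> s \<alpha>)"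
  by (simp add: sW_def mult_C_single weyl_comp refl_comp)

text \<open>A reflection is its own inverse, so this two-sided multiplication is conjugation, and it
  is multiplicative because the two inner reflections cancel.\<close>

lemma conj_hom:
  assumes "\<alpha> \<in> roots D"
  shows "complex_algebra_hom C C (\<lambda>a. sW D \<alpha> \<star> a \<star> sW D \<alpha>)"
proof unfold_locales
  have "sW D \<alpha> \<star> (x \<star> y) \<star> sW D \<alpha>
      = sW D \<alpha> \<star> x \<star> sW D \<alpha> \<star> (sW D \<alpha> \<star> y \<star> sW D \<alpha>)"
    if "x \<in> carrier C" "y \<in> carrier C" for x y
  proof -
    have "sW D \<alpha> \<star> (x \<star> y) \<star> sW D \<alpha>
        = sW D \<alpha> \<star> x \<star> (sW D \<alpha> \<star> sW D \<alpha>) \<star> (y \<star> sW D \<alpha>)"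
      using that assms by (simp only: sW_sW C.m_assoc C.m_closed C.r_one C.l_one sW_closed)
    then show ?thesis using that assms by (simp add: C.m_assoc)
  qed
  then show "alg_hom C C (\<lambda>a. sW D \<alpha> \<star> a \<star> sW D \<alpha>)"
    using assms unfolding alg_hom_def
    by (auto simp: sW_sW C.l_distr C.r_distr C.smult_mult_l C.smult_mult_r)
qed

text \<open>Invariance is first rephrased as commuting with group elements. That property is
  multiplicative in the group element, so it spreads from simple reflections to the whole group, and
  inverses appear only in the last line.\<close>

lemma CW_invI:
  assumes a: "a \<in> carrier C"
    and conj: "\<And>\<gamma>. \<gamma> \<in> \<Delta> \<Longrightarrow> sW D \<gamma> \<star> a \<star> sW D \<gamma> = a"
  shows "a \<in> CW_inv D"
proof -
  interpret W: group W by (rule group_W)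
  have comm: "\<delta> g \<star> a = a \<star> \<delta> g" if "g \<in> carrier W" for g
    using that
  proof (induction rule: weyl_induct)
    case id
    show ?case unfolding one_C[symmetric] using a by simp
  next
    case (simple \<gamma>)
    have "sW D \<gamma> \<star> a \<star> sW D \<gamma> \<star> sW D \<gamma> = a \<star> sW D \<gamma>"
      using conj[OF simple] by simp
    then show ?case
      using simple a by (simp add: C.m_assoc sW_sW) (simp add: sW_def)
  next
    case (comp g h)
    have gh: "\<delta> (g \<circ> h) = \<delta> g \<star> \<delta> h"
      using comp by (simp add: mult_C_single)
    have "\<delta> g \<star> (\<delta> h \<star> a)
        = \<delta> g \<star> a \<star> \<delta> h"
      using comp(1,2,4) a by (simp add: C.m_assoc)
    then show ?case
      unfolding gh using comp a by (simp add: C.m_assoc)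
  qed
  have "\<delta> g \<star> a \<star> \<delta> (inv\<^bsub>W\<^esub> g) = a" if g: "g \<in> carrier W" for g
  proof -
    have "\<delta> g \<star> \<delta> (inv\<^bsub>W\<^esub> g) = \<one>\<^bsub>C\<^esub>"
      using g W.r_inv[OF g] by (simp add: CW_def)
    then show ?thesis using a g by (simp add: comm C.m_assoc)
  qed
  then show ?thesis using a by (auto simp: CW_inv_def)
qed

text \<open>By \<open>equivariant\<close>, conjugating the sum by a simple reflection amounts to
  reflecting both indices in every term. \<open>sum_pos_roots_simple_refl\<close> then returns the
  original sum, and simple reflections suffice by \<open>CW_invI\<close>.\<close>

lemma pair_sum_CW_inv:
  assumes F: "\<And>\<alpha> \<beta>. \<lbrakk>\<alpha> \<in> roots D; \<beta> \<in> roots D\<rbrakk> \<Longrightarrow> F \<alpha> \<beta> \<in> carrier C"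
    and odd1: "\<And>\<alpha> \<beta>. \<lbrakk>\<alpha> \<in> roots D; \<beta> \<in> roots D\<rbrakk> \<Longrightarrow> F (\<lambda>v. - \<alpha> v) \<beta> = - F \<alpha> \<beta>"
    and odd2: "\<And>\<alpha> \<beta>. \<lbrakk>\<alpha> \<in> roots D; \<beta> \<in> roots D\<rbrakk> \<Longrightarrow> F \<alpha> (\<lambda>v. - \<beta> v) = - F \<alpha> \<beta>"
    and cancel: "\<And>\<gamma> \<beta>. \<lbrakk>\<gamma> \<in> \<Delta>; \<beta> \<in> roots D\<rbrakk> \<Longrightarrow> F \<gamma> (\<beta> \<circ> s \<gamma>) + F (\<beta> \<circ> s \<gamma>) \<gamma> = - (F \<gamma> \<beta> + F \<beta> \<gamma>)"
    and equivariant: "\<And>\<gamma> \<alpha> \<beta>. \<lbrakk>\<gamma> \<in> \<Delta>; \<alpha> \<in> roots D; \<beta> \<in> roots D\<rbrakk> \<Longrightarrow>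
      sW D \<gamma> \<star> F \<alpha> \<beta> \<star> sW D \<gamma> = F (\<alpha> \<circ> s \<gamma>) (\<beta> \<circ> s \<gamma>)"
  shows "c \<odot>\<^bsub>C\<^esub> (\<Oplus>\<^bsub>C\<^esub>\<alpha>\<in>\<Phi>pos. \<Oplus>\<^bsub>C\<^esub>\<beta>\<in>\<Phi>pos. F \<alpha> \<beta>) \<in> CW_inv D"
proof (rule CW_invI)
  show "c \<odot>\<^bsub>C\<^esub> (\<Oplus>\<^bsub>C\<^esub>\<alpha>\<in>\<Phi>pos. \<Oplus>\<^bsub>C\<^esub>\<beta>\<in>\<Phi>pos. F \<alpha> \<beta>) \<in> carrier C"
    using F by auto
  fix \<gamma> assume \<gamma>: "\<gamma> \<in> \<Delta>"
  interpret conj: complex_algebra_hom C C "\<lambda>a. sW D \<gamma> \<star> a \<star> sW D \<gamma>"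
    using \<gamma> by (intro conj_hom) auto
  \<comment> \<open>Coefficients are complex numbers, so doubling is injective.\<close>
  have tf: "x = 0" if "x + x = 0" for x :: "('v \<Rightarrow> 'v) \<Rightarrow>\<^sub>0 complex"
  proof (rule poly_mapping_eqI)
    fix k
    have "Poly_Mapping.lookup x k + Poly_Mapping.lookup x k = 0"
      using that by (metis lookup_add lookup_zero)
    then show "Poly_Mapping.lookup x k = Poly_Mapping.lookup 0 k" by simp
  qed
  let ?S = "\<Oplus>\<^bsub>C\<^esub>\<alpha>\<in>\<Phi>pos. \<Oplus>\<^bsub>C\<^esub>\<beta>\<in>\<Phi>pos. F \<alpha> \<beta>"
  have S: "?S \<in> carrier C" using F by auto
  have "sW D \<gamma> \<star> ?S \<star> sW D \<gamma>
      = (\<Oplus>\<^bsub>C\<^esub>\<alpha>\<in>\<Phi>pos. \<Oplus>\<^bsub>C\<^esub>\<beta>\<in>\<Phi>pos. sW D \<gamma> \<star> F \<alpha> \<beta> \<star> sW D \<gamma>)"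
    using F \<gamma> by (subst conj.hom_finsum, force) (intro C.finsum_eqI conj.hom_finsum, auto)
  also have "\<dots> = (\<Oplus>\<^bsub>C\<^esub>\<alpha>\<in>\<Phi>pos. \<Oplus>\<^bsub>C\<^esub>\<beta>\<in>\<Phi>pos. F (\<alpha> \<circ> s \<gamma>) (\<beta> \<circ> s \<gamma>))"
    using F \<gamma> by (intro C.finsum_eqI) (auto simp: equivariant comp_refl_root simp del: comp_apply)
  also have "\<dots> = (\<Sum>\<alpha>\<in>\<Phi>pos. \<Sum>\<beta>\<in>\<Phi>pos. F (\<alpha> \<circ> s \<gamma>) (\<beta> \<circ> s \<gamma>))"
    using F \<gamma> by (subst finsum_C, force simp: comp_refl_root simp del: comp_apply)
      (intro sum.cong finsum_C, auto simp: comp_refl_root simp del: comp_apply)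
  also have "\<dots> = (\<Sum>\<alpha>\<in>\<Phi>pos. \<Sum>\<beta>\<in>\<Phi>pos. F \<alpha> \<beta>)"
    by (rule sum_pos_roots_simple_refl[OF \<gamma> tf odd1 odd2 cancel[OF \<gamma>]])
  also have "\<dots> = ?S"
    using F by (subst finsum_C, force) (intro sum.cong finsum_C[symmetric], auto)
  finally show "sW D \<gamma> \<star> (c \<odot>\<^bsub>C\<^esub> ?S) \<star> sW D \<gamma> = c \<odot>\<^bsub>C\<^esub> ?S"
    using S conj.hom_smult[of ?S c] by simp
qed

section \<open>Invariance of the two elements built from pairs of positive roots\<close>

lemma smult_C_neg: "x \<in> carrier C \<Longrightarrow> (- c) \<odot>\<^bsub>C\<^esub> x = - (c \<odot>\<^bsub>C\<^esub> x)"
  by (rule poly_mapping_eqI) (simp add: smult_C)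

lemma form_ash_comp:
  "\<lbrakk>\<gamma> \<in> roots D; \<alpha> \<in> roots D; \<beta> \<in> roots D\<rbrakk> \<Longrightarrow> B (ash (\<alpha> \<circ> s \<gamma>)) (ash (\<beta> \<circ> s \<gamma>)) = B (ash \<alpha>) (ash \<beta>)"
  by (simp add: ash_comp_refl form_weyl refl_in_W)

lemma form_coroot_comp:
  "\<lbrakk>\<gamma> \<in> roots D; \<alpha> \<in> roots D; \<beta> \<in> roots D\<rbrakk> \<Longrightarrow>
    B (coroot D (\<alpha> \<circ> s \<gamma>)) (coroot D (\<beta> \<circ> s \<gamma>)) = B (coroot D \<alpha>) (coroot D \<beta>)"
  by (simp add: coroot_comp_refl form_weyl refl_in_W)

lemma root_refl_self: "\<gamma> \<in> roots D \<Longrightarrow> \<gamma> (s \<gamma> u) = - \<gamma> u"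
  by (simp add: refl_def root_simps root_coroot)

lemma form_ash_comp_self:
  "\<lbrakk>\<gamma> \<in> roots D; \<beta> \<in> roots D\<rbrakk> \<Longrightarrow> B (ash \<gamma>) (ash (\<beta> \<circ> s \<gamma>)) = - B (ash \<gamma>) (ash \<beta>)"
  by (simp add: form_ash ash_comp_refl root_refl_self)

lemma form_coroot_comp_self:
  "\<lbrakk>\<gamma> \<in> roots D; \<beta> \<in> roots D\<rbrakk> \<Longrightarrow> B (coroot D \<gamma>) (coroot D (\<beta> \<circ> s \<gamma>)) = - B (coroot D \<gamma>) (coroot D \<beta>)"
  using form_coroot[of \<gamma> "coroot D \<beta>"] form_coroot[of \<gamma> "s \<gamma> (coroot D \<beta>)"]
  by (simp add: coroot_comp_refl root_refl_self)

text \<open>Replacing \<beta> by its reflection in \<gamma> reverses the sign of B(\<gamma>,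
  \<beta>) and turns the product of the two reflections into the product in the opposite order. The
  terms for (\<gamma>, \<beta>) and (\<beta>, \<gamma>) are therefore exchanged up to sign, which is
  the cancellation that is required. Oddness in each root comes from the form, since a root and its
  negative have the same reflection.\<close>

lemma Omega_W_inv: "Omega_W D \<in> CW_inv D"
proof -
  define F where "F \<alpha> \<beta> = (param D \<alpha> * param D \<beta> * complex_of_real (B (ash \<alpha>) (ash \<beta>))) \<odot>\<^bsub>C\<^esub> (sW D \<alpha> \<star> sW D \<beta>)"
    for \<alpha> \<beta>
  have eq: "Omega_W D = (1/4) \<odot>\<^bsub>C\<^esub> (\<Oplus>\<^bsub>C\<^esub>\<alpha>\<in>\<Phi>pos. \<Oplus>\<^bsub>C\<^esub>\<beta>\<in>\<Phi>pos. F \<alpha> \<beta>)"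
    unfolding Omega_W_def F_def
    by (intro arg_cong[of _ _ "smult C (1/4)"] C.finsum_eqI) (auto simp: dual_form_cext cext_aC)
  have swap: "F \<gamma> (\<beta> \<circ> s \<gamma>) = - F \<beta> \<gamma>" "F (\<beta> \<circ> s \<gamma>) \<gamma> = - F \<gamma> \<beta>"
    if "\<gamma> \<in> roots D" "\<beta> \<in> roots D" for \<gamma> \<beta>
  proof -
    show "F \<gamma> (\<beta> \<circ> s \<gamma>) = - F \<beta> \<gamma>" "F (\<beta> \<circ> s \<gamma>) \<gamma> = - F \<gamma> \<beta>"
      using that
      by (simp_all add: F_def param_comp form_ash_comp_self form_sym[of "ash (\<beta> \<circ> s \<gamma>)"] smult_C_neg
          C.m_assoc sW_cancel sW_sW form_sym[of "ash \<beta>"] mult_ac del: comp_apply flip: sW_conj)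
  qed
  show ?thesis
    unfolding eq
  proof (rule pair_sum_CW_inv)
    fix \<gamma> \<alpha> \<beta> assume \<gamma>: "\<gamma> \<in> \<Delta>" and r: "\<alpha> \<in> roots D" "\<beta> \<in> roots D"
    then interpret conj: complex_algebra_hom C C "\<lambda>a. sW D \<gamma> \<star> a \<star> sW D \<gamma>"
      by (intro conj_hom) auto
    show "sW D \<gamma> \<star> F \<alpha> \<beta> \<star> sW D \<gamma> = F (\<alpha> \<circ> s \<gamma>) (\<beta> \<circ> s \<gamma>)"
      using \<gamma> r unfolding F_def
      by (simp add: conj.hom_smult conj.hom_mult sW_conj form_ash_comp param_comp del: comp_apply)
  qed (use swap in \<open>auto simp: F_def sW_neg param_neg ash_neg form_simps smult_C_neg simp del: comp_apply\<close>)
qed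

text \<open>Exchanging the two roots negates the commutator, so its square, and with it F, is
  symmetric. Reflecting \<beta> in \<gamma> also just negates the commutator with
  \<open>s \<gamma>\<close>, while it reverses the sign of the form on the coroots; hence F changes
  sign. The same holds for orthogonal pairs, where the coefficient is 0.\<close>

lemma Omega_W'_inv: "Omega_W' D \<in> CW_inv D"
proof -
  define F where "F \<alpha> \<beta> = pair_coeff D \<alpha> \<beta> \<odot>\<^bsub>C\<^esub> (commutator C (sW D \<alpha>) (sW D \<beta>) [^]\<^bsub>C\<^esub> (2::nat))" for \<alpha> \<beta>
  have sq: "(\<ominus>\<^bsub>C\<^esub> x) [^]\<^bsub>C\<^esub> (2::nat) = x [^]\<^bsub>C\<^esub> (2::nat)" if "x \<in> carrier C" for x
    using that by (simp add: numeral_2_eq_2 C.l_minus C.r_minus)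
  have F_sym: "F \<beta> \<alpha> = F \<alpha> \<beta>" if "\<alpha> \<in> roots D" "\<beta> \<in> roots D" for \<alpha> \<beta>
    using that by (simp add: F_def pair_coeff_def C.commutator_minus_swap[of "sW D \<alpha>" "sW D \<beta>"] sq
        form_sym[of "coroot D \<beta>"] mult_ac)
  have neg: "F \<gamma> (\<beta> \<circ> s \<gamma>) = - F \<gamma> \<beta>"
    if "\<gamma> \<in> roots D" "\<beta> \<in> roots D" for \<gamma> \<beta>
  proof -
    have "commutator C (sW D \<gamma>) (sW D (\<beta> \<circ> s \<gamma>)) = commutator C (sW D \<beta>) (sW D \<gamma>)"
      using that by (simp add: commutator_def C.m_assoc sW_cancel sW_sW del: comp_apply flip: sW_conj)
    then show ?thesis
      using that by (simp add: F_def pair_coeff_def C.commutator_minus_swap[of "sW D \<gamma>" "sW D \<beta>"] sq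
          form_coroot_comp_self param_comp smult_C_neg del: comp_apply)
  qed
  show ?thesis
    unfolding Omega_W'_def F_def[symmetric]
  proof (rule pair_sum_CW_inv)
    fix \<gamma> \<alpha> \<beta> assume \<gamma>: "\<gamma> \<in> \<Delta>" and r: "\<alpha> \<in> roots D" "\<beta> \<in> roots D"
    then interpret conj: complex_algebra_hom C C "\<lambda>a. sW D \<gamma> \<star> a \<star> sW D \<gamma>"
      by (intro conj_hom) auto
    show "sW D \<gamma> \<star> F \<alpha> \<beta> \<star> sW D \<gamma> = F (\<alpha> \<circ> s \<gamma>) (\<beta> \<circ> s \<gamma>)"
      using \<gamma> r unfolding F_def
      by (simp add: conj.hom_smult conj.hom_nat_pow conj.hom_commutator sW_conj pair_coeff_def
          form_coroot_comp param_comp del: comp_apply)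
  next
    fix \<gamma> \<beta> assume "\<gamma> \<in> \<Delta>" "\<beta> \<in> roots D"
    then show "F \<gamma> (\<beta> \<circ> s \<gamma>) + F (\<beta> \<circ> s \<gamma>) \<gamma> = - (F \<gamma> \<beta> + F \<beta> \<gamma>)"
      using F_sym[of \<gamma> "\<beta> \<circ> s \<gamma>"] F_sym[of \<gamma> \<beta>] neg[of \<gamma> \<beta>] comp_refl_root[of \<gamma> \<beta>] by simp
  qed (auto simp: F_def pair_coeff_def sW_neg param_neg coroot_neg form_simps smult_C_neg)
qed

end

section \<open>Linear maps into an algebra\<close>

text \<open>The target is an algebra record with a carrier, so linearity is stated for its
  operations. The notion covers \<open>V_to_H\<close>, \<open>tilde\<close>, \<open>T_elt\<close>
  and maps into the tensor product, which lets one contraction rule serve them all.\<close>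

definition lin_into :: "(complex, 'a) module \<Rightarrow> ('v::real_vector cx \<Rightarrow> 'a) \<Rightarrow> bool" where
  "lin_into A f \<longleftrightarrow> range f \<subseteq> carrier A \<and> (\<forall>u w. f (u + w) = f u \<oplus>\<^bsub>A\<^esub> f w) \<and> (\<forall>c u. f (cscale c u) = c \<odot>\<^bsub>A\<^esub> f u)"

lemma lin_intoD:
  assumes "lin_into A f"
  shows "f u \<in> carrier A" "f (u + w) = f u \<oplus>\<^bsub>A\<^esub> f w" "f (cscale c u) = c \<odot>\<^bsub>A\<^esub> f u"
  using assms unfolding lin_into_def by blast+

lemma (in complex_algebra) lin_into_sum:
  assumes "lin_into A f"
  shows "f (\<Sum>i\<in>S. cscale (c i) (w i)) = (\<Oplus>i\<in>S. c i \<odot> f (w i))"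
proof -
  note f = lin_intoD[OF assms]
  have "f 0 = \<zero>" using f(3)[of 0 0] f(1)[of 0] by simp
  then show ?thesis
    by (induction S rule: infinite_finite_induct) (auto simp: f finsum_insert)
qed

lemma (in complex_algebra) lin_into_minus:
  assumes "lin_into A f"
  shows "f (cscale (- c) u) = \<ominus> (c \<odot> f u)"
  using lin_intoD(3)[OF assms, of "- c" u] lin_intoD(1)[OF assms, of u] by (simp add: smult_minus_left)

lemma (in complex_algebra) lin_into_mult_r:
  "\<lbrakk>lin_into A f; a \<in> carrier A\<rbrakk> \<Longrightarrow> lin_into A (\<lambda>u. f u \<otimes> a)"
  by (auto simp: lin_into_def l_distr smult_mult_l image_subset_iff)

lemma (in complex_algebra) lin_into_mult_l:
  "\<lbrakk>lin_into A f; a \<in> carrier A\<rbrakk> \<Longrightarrow> lin_into A (\<lambda>u. a \<otimes> f u)"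
  by (auto simp: lin_into_def r_distr smult_mult_r image_subset_iff)

lemma (in complex_algebra) lin_into_diff:
  assumes "lin_into A f" "lin_into A g"
  shows "lin_into A (\<lambda>u. f u \<ominus> g u)"
proof -
  note f = lin_intoD[OF assms(1)] and g = lin_intoD[OF assms(2)]
  have "(a \<oplus> b) \<ominus> (c \<oplus> d) = (a \<ominus> c) \<oplus> (b \<ominus> d)"
    if "a \<in> carrier A" "b \<in> carrier A" "c \<in> carrier A" "d \<in> carrier A" for a b c d
    using that by algebra
  then show ?thesis by (auto simp: lin_into_def f g smult_diff_right)
qed

lemma (in complex_algebra_hom) lin_into_hom: "lin_into A f \<Longrightarrow> lin_into A' (\<lambda>u. h (f u))"
  by (auto simp: lin_into_def hom_add hom_smult image_subset_iff)

context root_datum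
begin

lemma lin_into_sC:
  assumes "lin_into A f" "\<alpha> \<in> roots D"
  shows "lin_into A (\<lambda>u. f (sC \<alpha> u))"
proof -
  have "sC \<alpha> (u + w) = sC \<alpha> u + sC \<alpha> w" "sC \<alpha> (cscale c u) = cscale c (sC \<alpha> u)" for u w c
    using refl_linear[OF assms(2)]
    by (cases u; cases w; simp add: cscale_def linear_add linear_diff linear_cmul)+
  then show ?thesis by (auto simp: lin_into_def lin_intoD[OF assms(1)])
qed

end

context root_datum_basis
begin

lemma contract_dual_basis:
  assumes "complex_algebra A" "lin_into A f" "\<alpha> \<in> roots D"
  shows "(\<Oplus>\<^bsub>A\<^esub>i\<in>I. cext \<alpha> (v i) \<odot>\<^bsub>A\<^esub> f (vu i)) = f (aC \<alpha>)"
    and "(\<Oplus>\<^bsub>A\<^esub>i\<in>I. cext \<alpha> (vu i) \<odot>\<^bsub>A\<^esub> f (v i)) = f (aC \<alpha>)"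
  using complex_algebra.lin_into_sum[OF assms(1,2), where S = I]
  by (simp_all add: root_dual_basis[OF assms(3)] root_basis[OF assms(3)] flip: complex_algebra.lin_into_sum[OF assms(1,2)])

text \<open>This trades a sum over the basis for a sum over positive roots. After exchanging the
  sums, the basis sum for a fixed root collapses to the value at its Riesz vector; the map may
  depend on the root, as it does when it multiplies by \<open>sW D \<alpha>\<close>.\<close>

lemma contract_root_sum:
  assumes "complex_algebra A" "\<And>\<alpha>. \<alpha> \<in> \<Phi>pos \<Longrightarrow> lin_into A (f \<alpha>)"
  shows "(\<Oplus>\<^bsub>A\<^esub>i\<in>I. \<Oplus>\<^bsub>A\<^esub>\<alpha>\<in>\<Phi>pos. (c \<alpha> * cext \<alpha> (v i)) \<odot>\<^bsub>A\<^esub> f \<alpha> (vu i)) = (\<Oplus>\<^bsub>A\<^esub>\<alpha>\<in>\<Phi>pos. c \<alpha> \<odot>\<^bsub>A\<^esub> f \<alpha> (aC \<alpha>))"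
    and "(\<Oplus>\<^bsub>A\<^esub>i\<in>I. \<Oplus>\<^bsub>A\<^esub>\<alpha>\<in>\<Phi>pos. (c \<alpha> * cext \<alpha> (vu i)) \<odot>\<^bsub>A\<^esub> f \<alpha> (v i)) = (\<Oplus>\<^bsub>A\<^esub>\<alpha>\<in>\<Phi>pos. c \<alpha> \<odot>\<^bsub>A\<^esub> f \<alpha> (aC \<alpha>))"
proof -
  interpret complex_algebra A by fact
  note f = lin_intoD[OF assms(2)]
  have *: "(\<Oplus>\<^bsub>A\<^esub>i\<in>I. \<Oplus>\<^bsub>A\<^esub>\<alpha>\<in>\<Phi>pos. (c \<alpha> * cext \<alpha> (a i)) \<odot>\<^bsub>A\<^esub> f \<alpha> (b i)) = (\<Oplus>\<^bsub>A\<^esub>\<alpha>\<in>\<Phi>pos. c \<alpha> \<odot>\<^bsub>A\<^esub> f \<alpha> (aC \<alpha>))"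
    if ab: "\<And>\<alpha>. \<alpha> \<in> \<Phi>pos \<Longrightarrow> (\<Oplus>\<^bsub>A\<^esub>i\<in>I. cext \<alpha> (a i) \<odot>\<^bsub>A\<^esub> f \<alpha> (b i)) = f \<alpha> (aC \<alpha>)" for a b
  proof -
    have "(\<Oplus>\<^bsub>A\<^esub>i\<in>I. \<Oplus>\<^bsub>A\<^esub>\<alpha>\<in>\<Phi>pos. (c \<alpha> * cext \<alpha> (a i)) \<odot>\<^bsub>A\<^esub> f \<alpha> (b i))
        = (\<Oplus>\<^bsub>A\<^esub>\<alpha>\<in>\<Phi>pos. \<Oplus>\<^bsub>A\<^esub>i\<in>I. (c \<alpha> * cext \<alpha> (a i)) \<odot>\<^bsub>A\<^esub> f \<alpha> (b i))"
      using f by (intro finsum_finsum_swap) auto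
    also have "\<dots> = (\<Oplus>\<^bsub>A\<^esub>\<alpha>\<in>\<Phi>pos. c \<alpha> \<odot>\<^bsub>A\<^esub> f \<alpha> (aC \<alpha>))"
    proof (rule finsum_eqI)
      fix \<alpha> assume \<alpha>: "\<alpha> \<in> \<Phi>pos"
      have "(\<Oplus>\<^bsub>A\<^esub>i\<in>I. (c \<alpha> * cext \<alpha> (a i)) \<odot>\<^bsub>A\<^esub> f \<alpha> (b i)) = (\<Oplus>\<^bsub>A\<^esub>i\<in>I. c \<alpha> \<odot>\<^bsub>A\<^esub> (cext \<alpha> (a i) \<odot>\<^bsub>A\<^esub> f \<alpha> (b i)))"
        using f \<alpha> by (intro finsum_eqI) (auto simp: smult_smult)
      then show "(\<Oplus>\<^bsub>A\<^esub>i\<in>I. (c \<alpha> * cext \<alpha> (a i)) \<odot>\<^bsub>A\<^esub> f \<alpha> (b i)) = c \<alpha> \<odot>\<^bsub>A\<^esub> f \<alpha> (aC \<alpha>)"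
        using f \<alpha> by (simp add: finsum_smult ab)
    qed (use f in auto)
    finally show ?thesis .
  qed
  show "(\<Oplus>\<^bsub>A\<^esub>i\<in>I. \<Oplus>\<^bsub>A\<^esub>\<alpha>\<in>\<Phi>pos. (c \<alpha> * cext \<alpha> (v i)) \<odot>\<^bsub>A\<^esub> f \<alpha> (vu i)) = (\<Oplus>\<^bsub>A\<^esub>\<alpha>\<in>\<Phi>pos. c \<alpha> \<odot>\<^bsub>A\<^esub> f \<alpha> (aC \<alpha>))"
    "(\<Oplus>\<^bsub>A\<^esub>i\<in>I. \<Oplus>\<^bsub>A\<^esub>\<alpha>\<in>\<Phi>pos. (c \<alpha> * cext \<alpha> (vu i)) \<odot>\<^bsub>A\<^esub> f \<alpha> (v i)) = (\<Oplus>\<^bsub>A\<^esub>\<alpha>\<in>\<Phi>pos. c \<alpha> \<odot>\<^bsub>A\<^esub> f \<alpha> (aC \<alpha>))"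
    using contract_dual_basis[OF assms] by (intro *; auto)+
qed

text \<open>Reflecting both bases produces two correction terms. After contraction one pairs the
  coroot with the Riesz vector and the other pairs the negated Riesz vector with the coroot. They
  cancel because the two vectors are proportional; no commutation between the values of f and g is
  involved.\<close>

lemma casimir_invariant:
  assumes A: "complex_algebra A" and f: "lin_into A f" and g: "lin_into A g" and \<alpha>: "\<alpha> \<in> roots D"
  shows "(\<Oplus>\<^bsub>A\<^esub>i\<in>I. f (sC \<alpha> (v i)) \<otimes>\<^bsub>A\<^esub> g (sC \<alpha> (vu i))) = (\<Oplus>\<^bsub>A\<^esub>i\<in>I. f (v i) \<otimes>\<^bsub>A\<^esub> g (vu i))"
proof -
  interpret complex_algebra A by fact
  note fD = lin_intoD[OF f] and gD = lin_intoD[OF g]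
  let ?S = "\<lambda>h. finsum A h I"
  have fs: "f (sC \<alpha> u) = f u \<ominus>\<^bsub>A\<^esub> cext \<alpha> u \<odot>\<^bsub>A\<^esub> f (cor \<alpha>)" for u
  proof -
    have "f u = f (sC \<alpha> u) \<oplus>\<^bsub>A\<^esub> cext \<alpha> u \<odot>\<^bsub>A\<^esub> f (cor \<alpha>)"
      using sC_eq[OF \<alpha>, of u] fD(2,3) by metis
    then show ?thesis using fD(1) by (simp add: minus_eq a_assoc r_neg)
  qed
  have gs: "g (sC \<alpha> u) = g u \<ominus>\<^bsub>A\<^esub> cext \<alpha> u \<odot>\<^bsub>A\<^esub> g (cor \<alpha>)" for u
  proof -
    have "g u = g (sC \<alpha> u) \<oplus>\<^bsub>A\<^esub> cext \<alpha> u \<odot>\<^bsub>A\<^esub> g (cor \<alpha>)"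
      using sC_eq[OF \<alpha>, of u] gD(2,3) by metis
    then show ?thesis using gD(1) by (simp add: minus_eq a_assoc r_neg)
  qed
  have dist: "a \<otimes>\<^bsub>A\<^esub> (b \<ominus>\<^bsub>A\<^esub> c) = a \<otimes>\<^bsub>A\<^esub> b \<ominus>\<^bsub>A\<^esub> a \<otimes>\<^bsub>A\<^esub> c" "(b \<ominus>\<^bsub>A\<^esub> c) \<otimes>\<^bsub>A\<^esub> a = b \<otimes>\<^bsub>A\<^esub> a \<ominus>\<^bsub>A\<^esub> c \<otimes>\<^bsub>A\<^esub> a"
    if "a \<in> carrier A" "b \<in> carrier A" "c \<in> carrier A" for a b c
    using that by algebra+
  \<comment> \<open>The reflection is left unexpanded inside the last term; this avoids a separate
    term quadratic in \<alpha>.\<close>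
  have "f (sC \<alpha> (v i)) \<otimes>\<^bsub>A\<^esub> g (sC \<alpha> (vu i)) = f (v i) \<otimes>\<^bsub>A\<^esub> g (vu i)
      \<ominus>\<^bsub>A\<^esub> cext \<alpha> (v i) \<odot>\<^bsub>A\<^esub> (f (cor \<alpha>) \<otimes>\<^bsub>A\<^esub> g (vu i))
      \<ominus>\<^bsub>A\<^esub> cext \<alpha> (vu i) \<odot>\<^bsub>A\<^esub> (f (sC \<alpha> (v i)) \<otimes>\<^bsub>A\<^esub> g (cor \<alpha>))" for i
    unfolding gs[of "vu i"] using fD(1) gD(1)
    by (simp add: dist smult_mult_r) (simp add: fs[of "v i"] dist smult_mult_l)
  then have "?S (\<lambda>i. f (sC \<alpha> (v i)) \<otimes>\<^bsub>A\<^esub> g (sC \<alpha> (vu i))) = ?S (\<lambda>i. f (v i) \<otimes>\<^bsub>A\<^esub> g (vu i))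
      \<ominus>\<^bsub>A\<^esub> ?S (\<lambda>i. cext \<alpha> (v i) \<odot>\<^bsub>A\<^esub> (f (cor \<alpha>) \<otimes>\<^bsub>A\<^esub> g (vu i)))
      \<ominus>\<^bsub>A\<^esub> ?S (\<lambda>i. cext \<alpha> (vu i) \<odot>\<^bsub>A\<^esub> (f (sC \<alpha> (v i)) \<otimes>\<^bsub>A\<^esub> g (cor \<alpha>)))"
    using fD(1) gD(1) by (simp add: finsum_diff)
  also have "?S (\<lambda>i. cext \<alpha> (v i) \<odot>\<^bsub>A\<^esub> (f (cor \<alpha>) \<otimes>\<^bsub>A\<^esub> g (vu i))) = f (cor \<alpha>) \<otimes>\<^bsub>A\<^esub> g (aC \<alpha>)"
    by (rule contract_dual_basis(1)[OF A lin_into_mult_l[OF g fD(1)] \<alpha>])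
  also have "?S (\<lambda>i. cext \<alpha> (vu i) \<odot>\<^bsub>A\<^esub> (f (sC \<alpha> (v i)) \<otimes>\<^bsub>A\<^esub> g (cor \<alpha>))) = f (sC \<alpha> (aC \<alpha>)) \<otimes>\<^bsub>A\<^esub> g (cor \<alpha>)"
    by (rule contract_dual_basis(2)[OF A lin_into_mult_r[OF lin_into_sC[OF f \<alpha>] gD(1)] \<alpha>])
  also have "f (sC \<alpha> (aC \<alpha>)) \<otimes>\<^bsub>A\<^esub> g (cor \<alpha>) = \<ominus>\<^bsub>A\<^esub> (f (cor \<alpha>) \<otimes>\<^bsub>A\<^esub> g (aC \<alpha>))"
  proof -
    \<comment> \<open>This is the factor of proportionality in the definition of \<open>ash\<close>;
      it is moved from one tensor slot to the other.\<close>
    define k where "k = complex_of_real (2 / B (coroot D \<alpha>) (coroot D \<alpha>))"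
    have "aC \<alpha> = cscale k (cor \<alpha>)" by (simp add: aC_def cor_def cscale_def ash_def k_def)
    moreover have "f (sC \<alpha> (aC \<alpha>)) = \<ominus>\<^bsub>A\<^esub> f (aC \<alpha>)"
      using lin_into_minus[OF f, of 1 "aC \<alpha>"] fD(1) \<alpha> by (simp add: sC_aC_self)
    ultimately show ?thesis
      using fD gD by (simp add: l_minus smult_mult_l smult_mult_r)
  qed
  also have "x \<ominus>\<^bsub>A\<^esub> y \<ominus>\<^bsub>A\<^esub> (\<ominus>\<^bsub>A\<^esub> y) = x" if "x \<in> carrier A" "y \<in> carrier A" for x y
    using that by algebra
  finally show ?thesis using fD(1) gD(1) by simp
qed

end

section \<open>The graded affine Hecke algebra\<close>

lemma free_algebra_closed:
  assumes "x \<in> carrier (free_algebra G)" "y \<in> carrier (free_algebra G)"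
  shows "x - y \<in> carrier (free_algebra G)" "x + y \<in> carrier (free_algebra G)"
    "Poly_Mapping.map ((*) c) x \<in> carrier (free_algebra G)"
proof -
  interpret complex_algebra "free_algebra G" by (rule complex_algebra_free_algebra)
  have "x \<ominus>\<^bsub>free_algebra G\<^esub> y = x - y"
    unfolding free_algebra_def
    by (rule minus_monoid_algebra[OF monoid_free]) (use assms in \<open>simp_all only: free_algebra_def\<close>)
  then show "x - y \<in> carrier (free_algebra G)"
    using minus_closed[OF assms] by simp
  show "x + y \<in> carrier (free_algebra G)" "Poly_Mapping.map ((*) c) x \<in> carrier (free_algebra G)"
    using a_closed[OF assms] smult_closed[OF assms(1)] by (simp_all add: add_free_algebra smult_free_algebra)
qed

lemma linear_relations_closed:
  assumes "\<And>u. u \<in> U \<Longrightarrow> j u \<in> G" "\<And>u w. \<lbrakk>u \<in> U; w \<in> U\<rbrakk> \<Longrightarrow> pl u w \<in> U" "\<And>c u. u \<in> U \<Longrightarrow> sc c u \<in> U"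
  shows "linear_relations j U pl sc \<subseteq> carrier (free_algebra G)"
  using assms by (auto simp: linear_relations_def intro!: free_algebra_closed gen_closed)

context root_datum
begin

abbreviation "H \<equiv> hecke_algebra D"
abbreviation mult_H (infixl "\<cdot>" 70) where "x \<cdot> y \<equiv> x \<otimes>\<^bsub>H\<^esub> y"
abbreviation "Ws \<equiv> W_to_H D"
abbreviation "Vs \<equiv> V_to_H D"

lemma hecke_presentation: "presentation (hecke_gens D) (hecke_relations D)"
proof
  interpret F: complex_algebra "free_algebra (hecke_gens D)" by (rule complex_algebra_free_algebra)
  have g: "gen (Inl a) \<in> carrier (free_algebra (hecke_gens D))" if "a \<in> carrier C" for a
    using that unfolding hecke_gens_def by (intro gen_closed InlI)
  have g': "gen (Inr u) \<in> carrier (free_algebra (hecke_gens D))" for u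
    unfolding hecke_gens_def by (intro gen_closed InrI UNIV_I)
  have l: "linear_relations Inl (carrier C) (add C) (smult C) \<subseteq> carrier (free_algebra (hecke_gens D))"
    "linear_relations Inr UNIV (+) cscale \<subseteq> carrier (free_algebra (hecke_gens D))"
    by (rule linear_relations_closed; auto simp: hecke_gens_def)+
  show "hecke_relations D \<subseteq> carrier (free_algebra (hecke_gens D))"
    unfolding hecke_relations_def Let_def
    by (intro Un_least l) (auto intro!: free_algebra_closed(1) g g' F.m_closed F.smult_closed)
qed

lemma complex_algebra_hecke: "complex_algebra H"
proof -
  interpret presentation "hecke_gens D" "hecke_relations D" by (rule hecke_presentation)
  show ?thesis unfolding hecke_algebra_def by (rule proj.A'.complex_algebra_axioms)
qed

sublocale H: complex_algebra H by (rule complex_algebra_hecke)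

section \<open>The maps from the group algebra and from V to the Hecke algebra\<close>

lemma W_to_H_hom: "complex_algebra_hom C H Ws"
proof -
  interpret P: presentation "hecke_gens D" "hecke_relations D" by (rule hecke_presentation)
  have lin: "linear_relations Inl (carrier C) (add C) (smult C) \<subseteq> hecke_relations D"
    by (auto simp: hecke_relations_def Let_def)
  have g [simp]: "Inl a \<in> hecke_gens D" if "a \<in> carrier C" for a
    using that unfolding hecke_gens_def by (rule InlI)
  have mult: "Ws (a \<star> b) = Ws a \<cdot> Ws b" if "a \<in> carrier C" "b \<in> carrier C" for a b
  proof -
    have "gen (Inl (a \<star> b)) - gen (Inl a) \<otimes>\<^bsub>P.F\<^esub> gen (Inl b) \<in> hecke_relations D"
      using that unfolding hecke_relations_def Let_def by blast
    from P.relation[OF this] show ?thesis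
      using that by (simp add: W_to_H_def hecke_algebra_def P.presented_gen_eq gen_closed P.proj.hom_mult)
  qed
  have one: "Ws \<one>\<^bsub>C\<^esub> = \<one>\<^bsub>H\<^esub>"
  proof -
    have "gen (Inl \<one>\<^bsub>C\<^esub>) - \<one>\<^bsub>P.F\<^esub> \<in> hecke_relations D"
      unfolding hecke_relations_def Let_def by blast
    from P.relation[OF this] show ?thesis
      by (simp add: W_to_H_def hecke_algebra_def P.presented_gen_eq gen_closed)
  qed
  show ?thesis
  proof (intro complex_algebra_hom.intro complex_algebra_hom_axioms.intro C.complex_algebra_axioms
      H.complex_algebra_axioms, unfold alg_hom_def, intro conjI ballI allI)
    show "Ws \<in> carrier C \<rightarrow> carrier H"
      by (auto simp: W_to_H_def hecke_algebra_def)
    show "Ws (x \<oplus>\<^bsub>C\<^esub> y) = Ws x \<oplus>\<^bsub>H\<^esub> Ws y" if "x \<in> carrier C" "y \<in> carrier C" for x y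
      unfolding W_to_H_def hecke_algebra_def using that by (intro P.presented_gen_add[OF lin]) auto
    show "Ws (c \<odot>\<^bsub>C\<^esub> x) = c \<odot>\<^bsub>H\<^esub> Ws x" if "x \<in> carrier C" for c x
      unfolding W_to_H_def hecke_algebra_def using that by (intro P.presented_gen_smult[OF lin]) auto
  qed (simp_all add: mult one)
qed

sublocale Ws: complex_algebra_hom C H Ws by (rule W_to_H_hom)

lemma V_to_H_lin: "lin_into H Vs"
  and V_to_H_comm: "Vs u \<cdot> Vs w = Vs w \<cdot> Vs u"
  and V_to_H_sW: "\<gamma> \<in> \<Delta> \<Longrightarrow> Vs u \<cdot> Ws (sW D \<gamma>) =
    Ws (sW D \<gamma>) \<cdot> Vs (sC \<gamma> u) \<oplus>\<^bsub>H\<^esub> (param D \<gamma> * cext \<gamma> u) \<odot>\<^bsub>H\<^esub> \<one>\<^bsub>H\<^esub>"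
proof -
  interpret P: presentation "hecke_gens D" "hecke_relations D" by (rule hecke_presentation)
  have lin: "linear_relations Inr UNIV (+) cscale \<subseteq> hecke_relations D"
    by (auto simp: hecke_relations_def Let_def)
  have g [simp]: "Inl a \<in> hecke_gens D" if "a \<in> carrier C" for a
    using that unfolding hecke_gens_def by (rule InlI)
  have g' [simp]: "Inr u \<in> hecke_gens D" for u
    unfolding hecke_gens_def by (rule InrI[OF UNIV_I])
  show "lin_into H Vs"
    unfolding lin_into_def V_to_H_def hecke_algebra_def
    using P.presented_gen_add[OF lin] P.presented_gen_smult[OF lin] by auto
  show "Vs u \<cdot> Vs w = Vs w \<cdot> Vs u"
  proof -
    have "gen (Inr u) \<otimes>\<^bsub>P.F\<^esub> gen (Inr w) - gen (Inr w) \<otimes>\<^bsub>P.F\<^esub> gen (Inr u) \<in> hecke_relations D"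
      unfolding hecke_relations_def Let_def by blast
    from P.relation[OF this] show ?thesis
      by (simp add: V_to_H_def hecke_algebra_def P.presented_gen_eq gen_closed P.proj.hom_mult)
  qed
  show "Vs u \<cdot> Ws (sW D \<gamma>) =
    Ws (sW D \<gamma>) \<cdot> Vs (sC \<gamma> u) \<oplus>\<^bsub>H\<^esub> (param D \<gamma> * cext \<gamma> u) \<odot>\<^bsub>H\<^esub> \<one>\<^bsub>H\<^esub>" if "\<gamma> \<in> \<Delta>"
  proof -
    have "gen (Inr u) \<otimes>\<^bsub>P.F\<^esub> gen (Inl (sW D \<gamma>)) - gen (Inl (sW D \<gamma>)) \<otimes>\<^bsub>P.F\<^esub> gen (Inr (sC \<gamma> u))
        - (param D \<gamma> * cext \<gamma> u) \<odot>\<^bsub>P.F\<^esub> \<one>\<^bsub>P.F\<^esub> \<in> hecke_relations D"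
      using that unfolding hecke_relations_def Let_def by blast
    \<comment> \<open>The defining relation subtracts two terms in turn; it is regrouped as a
      difference of two elements so that \<open>P.relation\<close> turns it into an
      equation.\<close>
    then have "gen (Inr u) \<otimes>\<^bsub>P.F\<^esub> gen (Inl (sW D \<gamma>)) - (gen (Inl (sW D \<gamma>)) \<otimes>\<^bsub>P.F\<^esub> gen (Inr (sC \<gamma> u))
        \<oplus>\<^bsub>P.F\<^esub> (param D \<gamma> * cext \<gamma> u) \<odot>\<^bsub>P.F\<^esub> \<one>\<^bsub>P.F\<^esub>) \<in> hecke_relations D"
      by (simp add: add_free_algebra diff_diff_eq)
    from P.relation[OF this] that show ?thesis
      by (simp add: V_to_H_def W_to_H_def hecke_algebra_def P.presented_gen_eq gen_closed
          P.proj.hom_mult P.proj.hom_add P.proj.hom_smult)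
  qed
qed

lemmas Vs = lin_intoD[OF V_to_H_lin]

text \<open>The generators include all of the group algebra. Commuting with simple reflections
  extends to group elements by multiplicativity and to the group algebra by linearity.\<close>

lemma commutes_with_V_and_simple_imp_central:
  assumes z: "z \<in> carrier H" and V: "\<And>u. z \<cdot> Vs u = Vs u \<cdot> z"
    and W: "\<And>\<gamma>. \<gamma> \<in> \<Delta> \<Longrightarrow> z \<cdot> Ws (sW D \<gamma>) = Ws (sW D \<gamma>) \<cdot> z"
  shows "z \<in> alg_center H"
proof -
  interpret P: presentation "hecke_gens D" "hecke_relations D" by (rule hecke_presentation)
  have comm: "z \<cdot> Ws (\<delta> g) = Ws (\<delta> g) \<cdot> z" if "g \<in> carrier W" for g
    using that
  proof (induction rule: weyl_induct)
    case id
    show ?case using z unfolding one_C[symmetric] by simp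
  next
    case (simple \<gamma>)
    then show ?case using W[of \<gamma>] by (simp add: sW_def)
  next
    case (comp g h)
    have gh: "Ws (\<delta> (g \<circ> h)) = Ws (\<delta> g) \<cdot> Ws (\<delta> h)"
      using comp by (simp add: mult_C_single flip: Ws.hom_mult)
    have c: "Ws (\<delta> g) \<in> carrier H" "Ws (\<delta> h) \<in> carrier H" using comp by auto
    have "z \<cdot> (Ws (\<delta> g) \<cdot> Ws (\<delta> h)) = Ws (\<delta> g) \<cdot> (z \<cdot> Ws (\<delta> h))"
      using c z comp(3) by (simp flip: H.m_assoc)
    then show ?case unfolding gh using c z comp(4) by (simp add: H.m_assoc)
  qed
  have Wa: "z \<cdot> Ws a = Ws a \<cdot> z" if a: "a \<in> carrier C" for a
  proof -
    let ?f = "\<lambda>g. Poly_Mapping.lookup a g \<odot>\<^bsub>C\<^esub> \<delta> g"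
    have k: "g \<in> carrier W" if "g \<in> Poly_Mapping.keys a" for g using a that by (auto simp: carrier_C)
    have "a = (\<Oplus>\<^bsub>C\<^esub>g\<in>Poly_Mapping.keys a. ?f g)"
      using k poly_mapping_sum_single[of "Poly_Mapping.keys a" a] by (subst finsum_C) (auto simp: smult_C)
    then have "Ws a = Ws (\<Oplus>\<^bsub>C\<^esub>g\<in>Poly_Mapping.keys a. ?f g)" by simp
    also have "\<dots> = (\<Oplus>\<^bsub>H\<^esub>g\<in>Poly_Mapping.keys a. Ws (?f g))"
      using k by (intro Ws.hom_finsum) auto
    finally have eq: "Ws a = (\<Oplus>\<^bsub>H\<^esub>g\<in>Poly_Mapping.keys a. Ws (?f g))" .
    have "z \<cdot> (\<Oplus>\<^bsub>H\<^esub>g\<in>Poly_Mapping.keys a. Ws (?f g)) = (\<Oplus>\<^bsub>H\<^esub>g\<in>Poly_Mapping.keys a. z \<cdot> Ws (?f g))"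
      using k z by (intro H.finsum_mult_l) auto
    also have "\<dots> = (\<Oplus>\<^bsub>H\<^esub>g\<in>Poly_Mapping.keys a. Ws (?f g) \<cdot> z)"
      using k z comm by (intro H.finsum_eqI) (auto simp: Ws.hom_smult H.smult_mult_l H.smult_mult_r)
    also have "\<dots> = (\<Oplus>\<^bsub>H\<^esub>g\<in>Poly_Mapping.keys a. Ws (?f g)) \<cdot> z"
      using k z by (intro H.finsum_mult_r[symmetric]) auto
    finally show ?thesis unfolding eq .
  qed
  show ?thesis
    unfolding hecke_algebra_def
  proof (rule P.commutes_with_generators_imp_central)
    fix x assume "x \<in> hecke_gens D"
    then consider a where "x = Inl a" "a \<in> carrier C" | u where "x = Inr u"
      by (auto simp: hecke_gens_def)
    then show "z \<otimes>\<^bsub>P.P\<^esub> presented_gen (hecke_gens D) (hecke_relations D) x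
        = presented_gen (hecke_gens D) (hecke_relations D) x \<otimes>\<^bsub>P.P\<^esub> z"
      using V Wa by cases (simp_all add: V_to_H_def W_to_H_def hecke_algebra_def)
  qed (use z in \<open>simp add: hecke_algebra_def\<close>)
qed

section \<open>The elements T and their equivariant correction \<open>tilde\<close>\<close>

lemma T_elt_eq: "T_elt D u = (\<Oplus>\<^bsub>C\<^esub>\<alpha>\<in>\<Phi>pos. (param D \<alpha> / 2 * cext \<alpha> u) \<odot>\<^bsub>C\<^esub> sW D \<alpha>)"
  unfolding T_elt_def
  by (subst C.finsum_smult[symmetric]) (auto simp: C.smult_smult intro!: C.finsum_eqI)

lemma T_elt_lin: "lin_into C (T_elt D)"
  unfolding lin_into_def
proof (intro conjI allI)
  show "range (T_elt D) \<subseteq> carrier C" by (auto simp: T_elt_eq)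
  show "T_elt D (u + w) = T_elt D u \<oplus>\<^bsub>C\<^esub> T_elt D w" for u w
    unfolding T_elt_eq
    by (subst C.finsum_add[symmetric]; (rule C.finsum_eqI)?)
      (auto simp: cext_simps(1) distrib_left add_divide_distrib C.smult_l_distr)
  show "T_elt D (cscale c u) = c \<odot>\<^bsub>C\<^esub> T_elt D u" for c u
    unfolding T_elt_eq
    by (subst C.finsum_smult[symmetric]) (auto simp: cext_simps(2) C.smult_smult mult_ac intro!: C.finsum_eqI)
qed

lemmas T_elt = lin_intoD[OF T_elt_lin]

text \<open>Conjugation permutes the terms of all positive roots other than \<gamma>. The term of
  \<gamma> itself is fixed, whereas in \<open>T_elt D (sC \<gamma> u)\<close> it occurs with the
  opposite sign. The defect is twice that term, and the factor 2 absorbs the 1/2 in T.\<close>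

lemma T_elt_conj_simple:
  assumes \<gamma>: "\<gamma> \<in> \<Delta>"
  shows "sW D \<gamma> \<star> T_elt D u \<star> sW D \<gamma> = T_elt D (sC \<gamma> u) \<oplus>\<^bsub>C\<^esub> (param D \<gamma> * cext \<gamma> u) \<odot>\<^bsub>C\<^esub> sW D \<gamma>"
proof -
  interpret conj: complex_algebra_hom C C "\<lambda>a. sW D \<gamma> \<star> a \<star> sW D \<gamma>"
    using \<gamma> by (intro conj_hom) auto
  define f where "f \<alpha> u = (param D \<alpha> / 2 * cext \<alpha> u) \<odot>\<^bsub>C\<^esub> sW D \<alpha>" for \<alpha> u
  have f_closed: "f \<alpha> u \<in> carrier C" if "\<alpha> \<in> roots D" for \<alpha> u using that by (simp add: f_def)
  have T: "T_elt D u = (\<Sum>\<alpha>\<in>\<Phi>pos. f \<alpha> u)" for u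
    unfolding T_elt_eq f_def by (rule finsum_C) auto
  let ?P = "\<Phi>pos - {\<gamma>}"
  have split: "(\<Sum>\<alpha>\<in>\<Phi>pos. g \<alpha>) = g \<gamma> + sum g ?P" for g :: "('v \<Rightarrow> real) \<Rightarrow> ('v \<Rightarrow> 'v) \<Rightarrow>\<^sub>0 complex"
    using \<gamma> by (intro sum.remove) auto
  have eq: "sW D \<gamma> \<star> f \<alpha> u \<star> sW D \<gamma> = f (\<alpha> \<circ> s \<gamma>) (sC \<gamma> u)" if "\<alpha> \<in> roots D" for \<alpha>
    using that \<gamma> conj.hom_smult[of "sW D \<alpha>"]
    by (simp add: f_def sW_conj param_comp cext_sC comp_refl_comp_refl del: comp_apply)
  have "sW D \<gamma> \<star> T_elt D u \<star> sW D \<gamma> = (\<Oplus>\<^bsub>C\<^esub>\<alpha>\<in>\<Phi>pos. sW D \<gamma> \<star> f \<alpha> u \<star> sW D \<gamma>)"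
    unfolding T_elt_eq f_def using \<gamma> by (intro conj.hom_finsum) auto
  also have "\<dots> = (\<Sum>\<alpha>\<in>\<Phi>pos. sW D \<gamma> \<star> f \<alpha> u \<star> sW D \<gamma>)"
    using \<gamma> f_closed by (intro finsum_C) auto
  also have "\<dots> = (\<Sum>\<alpha>\<in>\<Phi>pos. f (\<alpha> \<circ> s \<gamma>) (sC \<gamma> u))"
    by (intro sum.cong refl eq) auto
  also have "\<dots> = f (\<gamma> \<circ> s \<gamma>) (sC \<gamma> u) + (\<Sum>\<alpha>\<in>?P. f \<alpha> (sC \<gamma> u))"
    unfolding split using sum.reindex_bij_betw[OF simple_refl_permutes[OF \<gamma>], of "\<lambda>\<alpha>. f \<alpha> (sC \<gamma> u)"] by simp
  also have "\<dots> = T_elt D (sC \<gamma> u) + (f (\<gamma> \<circ> s \<gamma>) (sC \<gamma> u) - f \<gamma> (sC \<gamma> u))"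
    by (simp add: T split)
  also have "f (\<gamma> \<circ> s \<gamma>) (sC \<gamma> u) = f \<gamma> u"
    using \<gamma> by (simp add: f_def comp_refl_self param_neg sW_neg cext_neg cext_sC_self del: comp_apply)
  also have "f \<gamma> u - f \<gamma> (sC \<gamma> u) = (param D \<gamma> * cext \<gamma> u) \<odot>\<^bsub>C\<^esub> sW D \<gamma>"
    using \<gamma> by (intro poly_mapping_eqI) (simp add: f_def cext_sC_self smult_C lookup_minus algebra_simps)
  finally show ?thesis by (simp add: add_C)
qed

lemma tilde_eq: "tilde D u = Vs u \<ominus>\<^bsub>H\<^esub> Ws (T_elt D u)"
  by (simp add: tilde_def)

lemma tilde_lin: "lin_into H (tilde D)"
  unfolding tilde_eq[abs_def] by (intro H.lin_into_diff V_to_H_lin Ws.lin_into_hom T_elt_lin)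

lemmas tilde = lin_intoD[OF tilde_lin]

text \<open>Neither V nor T is equivariant under \<open>s \<gamma>\<close>. Multiplied by
  \<open>s \<gamma>\<close>, the defect of T becomes the scalar k(\<gamma>) \<gamma>(u), which is
  also the defect in the Hecke relation, so it drops out of the difference.\<close>

lemma tilde_simple:
  assumes \<gamma>: "\<gamma> \<in> \<Delta>"
  shows "Ws (sW D \<gamma>) \<cdot> tilde D u = tilde D (sC \<gamma> u) \<cdot> Ws (sW D \<gamma>)"
proof -
  let ?s = "Ws (sW D \<gamma>)" and ?k = "(param D \<gamma> * cext \<gamma> u) \<odot>\<^bsub>H\<^esub> \<one>\<^bsub>H\<^esub>"
  have cl: "sW D \<gamma> \<in> carrier C" "?s \<in> carrier H" "?k \<in> carrier H" "Ws (T_elt D u) \<in> carrier H"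
    "Ws (T_elt D (sC \<gamma> u)) \<in> carrier H" "Vs u \<in> carrier H" "Vs (sC \<gamma> u) \<in> carrier H"
    using \<gamma> T_elt Vs by auto
  \<comment> \<open>The Hecke relation is used at the reflected vector, where \<gamma> changes sign;
    this is why the scalar is subtracted.\<close>
  have V: "Vs (sC \<gamma> u) \<cdot> ?s = ?s \<cdot> Vs u \<ominus>\<^bsub>H\<^esub> ?k"
    using V_to_H_sW[OF \<gamma>, of "sC \<gamma> u"] \<gamma> cl
    by (simp add: sC_sC cext_sC_self H.smult_minus_left H.minus_eq)
  have "sW D \<gamma> \<star> T_elt D u = sW D \<gamma> \<star> T_elt D u \<star> sW D \<gamma> \<star> sW D \<gamma>"
    using cl \<gamma> T_elt by (simp add: C.m_assoc sW_sW)
  also have "\<dots> = T_elt D (sC \<gamma> u) \<star> sW D \<gamma> \<oplus>\<^bsub>C\<^esub> (param D \<gamma> * cext \<gamma> u) \<odot>\<^bsub>C\<^esub> \<one>\<^bsub>C\<^esub>"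
    using cl \<gamma> T_elt by (simp add: T_elt_conj_simple C.l_distr C.smult_mult_l sW_sW)
  finally have "Ws (sW D \<gamma> \<star> T_elt D u) = Ws (T_elt D (sC \<gamma> u) \<star> sW D \<gamma> \<oplus>\<^bsub>C\<^esub> (param D \<gamma> * cext \<gamma> u) \<odot>\<^bsub>C\<^esub> \<one>\<^bsub>C\<^esub>)"
    by simp
  then have T: "?s \<cdot> Ws (T_elt D u) = Ws (T_elt D (sC \<gamma> u)) \<cdot> ?s \<oplus>\<^bsub>H\<^esub> ?k"
    using cl T_elt by (simp add: Ws.hom_mult Ws.hom_add Ws.hom_smult)
  have alg: "st \<oplus>\<^bsub>H\<^esub> \<ominus>\<^bsub>H\<^esub> (ts \<oplus>\<^bsub>H\<^esub> k) = (st \<oplus>\<^bsub>H\<^esub> \<ominus>\<^bsub>H\<^esub> k) \<oplus>\<^bsub>H\<^esub> \<ominus>\<^bsub>H\<^esub> ts"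
    if "st \<in> carrier H" "ts \<in> carrier H" "k \<in> carrier H" for st ts k
    using that by (simp add: H.minus_add H.a_ac)
  show ?thesis
    using cl by (simp add: tilde_eq H.minus_eq H.l_distr H.r_distr H.l_minus H.r_minus T V alg)
qed

lemma tilde_weyl:
  assumes "g \<in> carrier W"
  shows "Ws (\<delta> g) \<cdot> tilde D u = tilde D (map_prod g g u) \<cdot> Ws (\<delta> g)"
  using assms
proof (induction arbitrary: u rule: weyl_induct)
  case id
  show ?case unfolding one_C[symmetric] using tilde by simp
next
  case (simple \<gamma>)
  then show ?case using tilde_simple[of \<gamma> u] by (simp add: sW_def)
next
  case (comp g h)
  let ?g = "Ws (\<delta> g)" and ?h = "Ws (\<delta> h)"
  have gh: "Ws (\<delta> (g \<circ> h)) = ?g \<cdot> ?h"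
    using comp by (simp add: mult_C_single flip: Ws.hom_mult)
  have c: "?g \<in> carrier H" "?h \<in> carrier H" using comp by auto
  have "?g \<cdot> ?h \<cdot> tilde D u = ?g \<cdot> tilde D (map_prod h h u) \<cdot> ?h"
    using c tilde comp(4) by (simp add: H.m_assoc)
  also have "\<dots> = tilde D (map_prod g g (map_prod h h u)) \<cdot> (?g \<cdot> ?h)"
    using c tilde comp(3) by (simp add: H.m_assoc)
  finally show ?case unfolding gh by (cases u) simp
qed

lemma tilde_refl:
  "\<alpha> \<in> roots D \<Longrightarrow> Ws (sW D \<alpha>) \<cdot> tilde D u = tilde D (sC \<alpha> u) \<cdot> Ws (sW D \<alpha>)"
  using tilde_weyl[of "s \<alpha>" u] by (simp add: sW_def refl_in_W)

lemma tilde_aC_anticommute: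
  "\<alpha> \<in> roots D \<Longrightarrow> tilde D (aC \<alpha>) \<cdot> Ws (sW D \<alpha>) \<oplus>\<^bsub>H\<^esub> Ws (sW D \<alpha>) \<cdot> tilde D (aC \<alpha>) = \<zero>\<^bsub>H\<^esub>"
  using tilde_refl[of \<alpha> "aC \<alpha>"] H.lin_into_minus[OF tilde_lin, of 1 "aC \<alpha>"] tilde
  by (simp add: sC_aC_self H.l_minus H.r_neg)

lemma commutator_tilde_sW:
  assumes \<alpha>: "\<alpha> \<in> roots D"
  shows "commutator H (tilde D x) (Ws (sW D \<alpha>)) = (- cext \<alpha> x) \<odot>\<^bsub>H\<^esub> (Ws (sW D \<alpha>) \<cdot> tilde D (cor \<alpha>))"
proof -
  have "tilde D x = tilde D (sC \<alpha> x) \<oplus>\<^bsub>H\<^esub> cext \<alpha> x \<odot>\<^bsub>H\<^esub> tilde D (cor \<alpha>)"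
    using sC_eq[OF \<alpha>, of x] tilde(2,3) by metis
  then have "Ws (sW D \<alpha>) \<cdot> tilde D x
      = tilde D x \<cdot> Ws (sW D \<alpha>) \<oplus>\<^bsub>H\<^esub> cext \<alpha> x \<odot>\<^bsub>H\<^esub> (Ws (sW D \<alpha>) \<cdot> tilde D (cor \<alpha>))"
    using tilde(1) \<alpha> tilde_refl[OF \<alpha>, of "sC \<alpha> x"]
    by (simp add: H.r_distr H.smult_mult_r sC_sC)
  then show ?thesis
    using tilde(1) \<alpha> by (simp add: commutator_def H.minus_eq H.minus_add H.smult_minus_left H.r_neg1 H.r_neg2)
qed

lemma Ws_T_elt: "Ws (T_elt D u) = (\<Oplus>\<^bsub>H\<^esub>\<alpha>\<in>\<Phi>pos. (param D \<alpha> / 2 * cext \<alpha> u) \<odot>\<^bsub>H\<^esub> Ws (sW D \<alpha>))"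
  unfolding T_elt_eq by (subst Ws.hom_finsum) (auto simp: Ws.hom_smult intro!: H.finsum_eqI)

lemma commutator_tilde_T:
  "commutator H (tilde D x) (Ws (T_elt D y)) =
    (\<Oplus>\<^bsub>H\<^esub>\<alpha>\<in>\<Phi>pos. (- param D \<alpha> / 2 * cext \<alpha> y * cext \<alpha> x) \<odot>\<^bsub>H\<^esub> (Ws (sW D \<alpha>) \<cdot> tilde D (cor \<alpha>)))"
  unfolding Ws_T_elt
  by (subst H.commutator_finsum_r)
    (auto simp: tilde(1) H.commutator_smult_r commutator_tilde_sW H.smult_smult intro!: H.finsum_eqI)

lemma commutator_tilde:
  "commutator H (tilde D x) (tilde D y) = \<ominus>\<^bsub>H\<^esub> commutator H (Ws (T_elt D x)) (Ws (T_elt D y))"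
proof -
  let ?T = "\<lambda>x. Ws (T_elt D x)"
  have cl: "?T x \<in> carrier H" "tilde D x \<in> carrier H" "Vs x \<in> carrier H" for x using T_elt tilde Vs by auto
  have V: "Vs x = tilde D x \<oplus>\<^bsub>H\<^esub> ?T x" for x
    using cl by (simp add: tilde_eq H.minus_eq H.a_assoc H.l_neg)
  \<comment> \<open>The bracket of b with c is written as minus that of c with b. Both mixed
    brackets then have the form of \<open>commutator_tilde_T\<close> and cancel by its
    symmetry.\<close>
  have expand: "commutator H (a \<oplus>\<^bsub>H\<^esub> b) (c \<oplus>\<^bsub>H\<^esub> d)
      = commutator H a c \<oplus>\<^bsub>H\<^esub> commutator H b d \<oplus>\<^bsub>H\<^esub> (commutator H a d \<ominus>\<^bsub>H\<^esub> commutator H c b)"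
    if "a \<in> carrier H" "b \<in> carrier H" "c \<in> carrier H" "d \<in> carrier H" for a b c d
    using that unfolding commutator_def by algebra
  have "commutator H (Vs x) (Vs y) = \<zero>\<^bsub>H\<^esub>"
    using cl V_to_H_comm[of x y] by (simp add: commutator_def H.minus_eq H.r_neg)
  then have "commutator H (tilde D x) (tilde D y) \<oplus>\<^bsub>H\<^esub> commutator H (?T x) (?T y) \<oplus>\<^bsub>H\<^esub>
      (commutator H (tilde D x) (?T y) \<ominus>\<^bsub>H\<^esub> commutator H (tilde D y) (?T x)) = \<zero>\<^bsub>H\<^esub>"
    using cl by (simp add: V expand)
  moreover have "commutator H (tilde D y) (?T x) = commutator H (tilde D x) (?T y)"
    by (simp add: commutator_tilde_T mult_ac)
  ultimately have "commutator H (tilde D x) (tilde D y) \<oplus>\<^bsub>H\<^esub> commutator H (?T x) (?T y) = \<zero>\<^bsub>H\<^esub>"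
    using cl by (simp add: H.minus_eq H.r_neg)
  then show ?thesis using cl by (simp add: H.minus_equality)
qed

end

section \<open>The Casimir element of the Hecke algebra\<close>

context root_datum_basis
begin

abbreviation "\<Omega>H \<equiv> Omega_H D I v vu"

lemma Omega_H_closed [simp]: "\<Omega>H \<in> carrier H"
  unfolding Omega_H_def using Vs by auto

text \<open>Moving \<open>s \<gamma>\<close> from right to left past each product reflects both
  factors, which \<open>casimir_invariant\<close> undoes in the sum. The scalars in the Hecke
  relation leave two further sums. They contract to k(\<gamma>) times the reflected Riesz vector of
  \<gamma> and k(\<gamma>) times that vector itself, and the reflection negates it.\<close>

lemma Omega_H_central: "\<Omega>H \<in> alg_center H"
proof (rule commutes_with_V_and_simple_imp_central)
  fix u
  have "Vs (v i) \<cdot> Vs (vu i) \<cdot> Vs u = Vs u \<cdot> (Vs (v i) \<cdot> Vs (vu i))" for i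
    using Vs(1) V_to_H_comm[of u] by (metis H.m_assoc)
  then show "\<Omega>H \<cdot> Vs u = Vs u \<cdot> \<Omega>H"
    unfolding Omega_H_def using Vs(1) by (simp add: H.finsum_mult_l H.finsum_mult_r)
next
  fix \<gamma> assume \<gamma>: "\<gamma> \<in> \<Delta>"
  let ?s = "Ws (sW D \<gamma>)"
  have s: "?s \<in> carrier H" using \<gamma> by auto
  have swap: "Vs u \<cdot> ?s = ?s \<cdot> Vs (sC \<gamma> u) \<oplus>\<^bsub>H\<^esub> (param D \<gamma> * cext \<gamma> u) \<odot>\<^bsub>H\<^esub> \<one>\<^bsub>H\<^esub>" for u
    by (rule V_to_H_sW[OF \<gamma>])
  have "Vs (v i) \<cdot> Vs (vu i) \<cdot> ?s = ?s \<cdot> (Vs (sC \<gamma> (v i)) \<cdot> Vs (sC \<gamma> (vu i)))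
      \<oplus>\<^bsub>H\<^esub> (param D \<gamma> \<odot>\<^bsub>H\<^esub> (cext \<gamma> (v i) \<odot>\<^bsub>H\<^esub> Vs (sC \<gamma> (vu i)))
      \<oplus>\<^bsub>H\<^esub> param D \<gamma> \<odot>\<^bsub>H\<^esub> (cext \<gamma> (vu i) \<odot>\<^bsub>H\<^esub> Vs (v i)))" (is "?L i = ?A i \<oplus>\<^bsub>H\<^esub> (?X i \<oplus>\<^bsub>H\<^esub> ?Y i)") for i
  proof -
    have "?L i = Vs (v i) \<cdot> ?s \<cdot> Vs (sC \<gamma> (vu i)) \<oplus>\<^bsub>H\<^esub> ?Y i"
      using Vs(1) s by (simp add: H.m_assoc swap[of "vu i"] H.r_distr H.smult_mult_r H.smult_smult)
    also have "\<dots> = ?A i \<oplus>\<^bsub>H\<^esub> ?X i \<oplus>\<^bsub>H\<^esub> ?Y i"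
      unfolding swap[of "v i"] using Vs(1) s by (simp add: H.m_assoc H.l_distr H.smult_mult_l H.smult_smult)
    finally show ?thesis using Vs(1) s by (simp add: H.a_assoc)
  qed
  then have "\<Omega>H \<cdot> ?s = (\<Oplus>\<^bsub>H\<^esub>i\<in>I. ?A i \<oplus>\<^bsub>H\<^esub> (?X i \<oplus>\<^bsub>H\<^esub> ?Y i))"
    unfolding Omega_H_def using Vs(1) s by (simp add: H.finsum_mult_r)
  also have "\<dots> = (\<Oplus>\<^bsub>H\<^esub>i\<in>I. ?A i) \<oplus>\<^bsub>H\<^esub> ((\<Oplus>\<^bsub>H\<^esub>i\<in>I. ?X i) \<oplus>\<^bsub>H\<^esub> (\<Oplus>\<^bsub>H\<^esub>i\<in>I. ?Y i))"
    using Vs(1) s by (simp add: H.finsum_add)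
  also have "(\<Oplus>\<^bsub>H\<^esub>i\<in>I. ?A i) = ?s \<cdot> \<Omega>H"
  proof -
    have "(\<Oplus>\<^bsub>H\<^esub>i\<in>I. ?A i) = ?s \<cdot> (\<Oplus>\<^bsub>H\<^esub>i\<in>I. Vs (sC \<gamma> (v i)) \<cdot> Vs (sC \<gamma> (vu i)))"
      using Vs(1) s by (simp add: H.finsum_mult_l)
    then show ?thesis
      using casimir_invariant[OF H.complex_algebra_axioms V_to_H_lin V_to_H_lin, of \<gamma>] \<gamma> by (simp add: Omega_H_def)
  qed
  also have "(\<Oplus>\<^bsub>H\<^esub>i\<in>I. ?Y i) = param D \<gamma> \<odot>\<^bsub>H\<^esub> Vs (aC \<gamma>)"
    using Vs(1) \<gamma> contract_dual_basis(2)[OF H.complex_algebra_axioms V_to_H_lin, of \<gamma>] by (simp add: H.finsum_smult)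
  also have "(\<Oplus>\<^bsub>H\<^esub>i\<in>I. ?X i) = param D \<gamma> \<odot>\<^bsub>H\<^esub> Vs (sC \<gamma> (aC \<gamma>))"
  proof -
    have "lin_into H (\<lambda>u. Vs (sC \<gamma> u))"
      using \<gamma> by (intro lin_into_sC V_to_H_lin) auto
    then show ?thesis
      using Vs(1) \<gamma> contract_dual_basis(1)[OF H.complex_algebra_axioms, of "\<lambda>u. Vs (sC \<gamma> u)" \<gamma>] by (simp add: H.finsum_smult)
  qed
  also have "param D \<gamma> \<odot>\<^bsub>H\<^esub> Vs (sC \<gamma> (aC \<gamma>)) \<oplus>\<^bsub>H\<^esub> param D \<gamma> \<odot>\<^bsub>H\<^esub> Vs (aC \<gamma>) = \<zero>\<^bsub>H\<^esub>"
    using \<gamma> Vs(1) H.lin_into_minus[OF V_to_H_lin, of 1 "aC \<gamma>"]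
    by (simp add: sC_aC_self H.smult_minus_right H.l_neg)
  finally show "\<Omega>H \<cdot> ?s = ?s \<cdot> \<Omega>H" using s by simp
qed simp

lemma sum_tilde_tilde: "(\<Oplus>\<^bsub>H\<^esub>i\<in>I. tilde D (vu i) \<cdot> tilde D (v i)) = \<Omega>H \<ominus>\<^bsub>H\<^esub> Ws (Omega_W D)"
proof -
  let ?T = "\<lambda>x. Ws (T_elt D x)" and ?t = "tilde D" and ?S = "\<lambda>f. finsum H f I"
  have cl: "?T x \<in> carrier H" "?t x \<in> carrier H" "Vs x \<in> carrier H" for x using T_elt tilde Vs by auto
  have V: "Vs x = ?t x \<oplus>\<^bsub>H\<^esub> ?T x" for x
    using cl by (simp add: tilde_eq H.minus_eq H.a_assoc H.l_neg)
  have expand: "(a \<oplus>\<^bsub>H\<^esub> b) \<cdot> (c \<oplus>\<^bsub>H\<^esub> d) = a \<cdot> c \<oplus>\<^bsub>H\<^esub> b \<cdot> d \<oplus>\<^bsub>H\<^esub> (a \<cdot> d \<oplus>\<^bsub>H\<^esub> b \<cdot> c)"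
    if "a \<in> carrier H" "b \<in> carrier H" "c \<in> carrier H" "d \<in> carrier H" for a b c d
    using that by algebra
  \<comment> \<open>Elements of V commute, so the factors can be put in the order in which
    \<open>tilde\<close> factors come out of the commutator of the two operators.\<close>
  have "\<Omega>H = ?S (\<lambda>i. Vs (vu i) \<cdot> Vs (v i))"
    unfolding Omega_H_def using cl V_to_H_comm by (intro H.finsum_eqI) auto
  also have "\<dots> = ?S (\<lambda>i. ?t (vu i) \<cdot> ?t (v i)) \<oplus>\<^bsub>H\<^esub> ?S (\<lambda>i. ?T (vu i) \<cdot> ?T (v i))
      \<oplus>\<^bsub>H\<^esub> (?S (\<lambda>i. ?t (vu i) \<cdot> ?T (v i)) \<oplus>\<^bsub>H\<^esub> ?S (\<lambda>i. ?T (vu i) \<cdot> ?t (v i)))"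
    using cl by (simp add: V expand H.finsum_add)
  also have "?S (\<lambda>i. ?T (vu i) \<cdot> ?T (v i)) = Ws (Omega_W D)"
  proof -
    have T: "lin_into H (\<lambda>u. ?T u \<cdot> Ws (sW D \<alpha>))" if "\<alpha> \<in> \<Phi>pos" for \<alpha>
      using that by (intro H.lin_into_mult_r Ws.lin_into_hom T_elt_lin) auto
    have "?S (\<lambda>i. ?T (vu i) \<cdot> ?T (v i))
        = (\<Oplus>\<^bsub>H\<^esub>i\<in>I. \<Oplus>\<^bsub>H\<^esub>\<alpha>\<in>\<Phi>pos. (param D \<alpha> / 2 * cext \<alpha> (v i)) \<odot>\<^bsub>H\<^esub> (?T (vu i) \<cdot> Ws (sW D \<alpha>)))"
      unfolding Ws_T_elt[of "v _"]
      by (intro H.finsum_eqI, subst H.finsum_mult_l) (auto simp: cl H.smult_mult_r intro!: H.finsum_eqI)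
    also have "\<dots> = (\<Oplus>\<^bsub>H\<^esub>\<alpha>\<in>\<Phi>pos. (param D \<alpha> / 2) \<odot>\<^bsub>H\<^esub> (?T (aC \<alpha>) \<cdot> Ws (sW D \<alpha>)))"
      by (rule contract_root_sum(1)[OF H.complex_algebra_axioms T])
    \<comment> \<open>The 1/4 of \<open>Omega_W\<close> is the product of the factors 1/2 of two
      T's, and evaluating one root on the Riesz vector of the other gives the dual form.\<close>
    also have "\<dots> = (\<Oplus>\<^bsub>H\<^esub>\<alpha>\<in>\<Phi>pos. \<Oplus>\<^bsub>H\<^esub>\<beta>\<in>\<Phi>pos. (1/4 * (param D \<beta> * param D \<alpha> * cext \<beta> (aC \<alpha>))) \<odot>\<^bsub>H\<^esub> (Ws (sW D \<beta>) \<cdot> Ws (sW D \<alpha>)))"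
      unfolding Ws_T_elt
      by (intro H.finsum_eqI, subst H.finsum_mult_r)
        (auto simp: H.smult_mult_l H.smult_smult mult_ac simp flip: H.finsum_smult intro!: H.finsum_eqI)
    also have "\<dots> = (\<Oplus>\<^bsub>H\<^esub>\<alpha>\<in>\<Phi>pos. \<Oplus>\<^bsub>H\<^esub>\<beta>\<in>\<Phi>pos. (1/4 * (param D \<alpha> * param D \<beta> * cext \<alpha> (aC \<beta>))) \<odot>\<^bsub>H\<^esub> (Ws (sW D \<alpha>) \<cdot> Ws (sW D \<beta>)))"
      by (rule H.finsum_finsum_swap) auto
    also have "\<dots> = Ws (Omega_W D)"
    proof -
      have "Ws (Omega_W D) = (1/4) \<odot>\<^bsub>H\<^esub> (\<Oplus>\<^bsub>H\<^esub>\<alpha>\<in>\<Phi>pos. \<Oplus>\<^bsub>H\<^esub>\<beta>\<in>\<Phi>pos. (param D \<alpha> * param D \<beta> * cext \<alpha> (aC \<beta>)) \<odot>\<^bsub>H\<^esub> (Ws (sW D \<alpha>) \<cdot> Ws (sW D \<beta>)))"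
        unfolding Omega_W_def
        by (subst Ws.hom_smult, force, subst Ws.hom_finsum, force)
          (intro arg_cong[of _ _ "smult H (1/4)"] H.finsum_eqI, subst Ws.hom_finsum,
            auto simp: Ws.hom_smult Ws.hom_mult dual_form_cext intro!: H.finsum_eqI)
      also have "\<dots> = (\<Oplus>\<^bsub>H\<^esub>\<alpha>\<in>\<Phi>pos. \<Oplus>\<^bsub>H\<^esub>\<beta>\<in>\<Phi>pos. (1/4 * (param D \<alpha> * param D \<beta> * cext \<alpha> (aC \<beta>))) \<odot>\<^bsub>H\<^esub> (Ws (sW D \<alpha>) \<cdot> Ws (sW D \<beta>)))"
        by (subst H.finsum_smult[symmetric], force)
          (intro H.finsum_eqI, subst H.finsum_smult[symmetric], auto simp: H.smult_smult intro!: H.finsum_eqI)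
      finally show ?thesis by simp
    qed
    finally show ?thesis .
  qed
  also have "?S (\<lambda>i. ?t (vu i) \<cdot> ?T (v i)) \<oplus>\<^bsub>H\<^esub> ?S (\<lambda>i. ?T (vu i) \<cdot> ?t (v i)) = \<zero>\<^bsub>H\<^esub>"
  proof -
    have 1: "lin_into H (\<lambda>u. ?t u \<cdot> Ws (sW D \<alpha>))" "lin_into H (\<lambda>u. Ws (sW D \<alpha>) \<cdot> ?t u)" if "\<alpha> \<in> \<Phi>pos" for \<alpha>
      using that by (auto intro!: H.lin_into_mult_r H.lin_into_mult_l tilde_lin)
    have "?S (\<lambda>i. ?t (vu i) \<cdot> ?T (v i))
        = (\<Oplus>\<^bsub>H\<^esub>i\<in>I. \<Oplus>\<^bsub>H\<^esub>\<alpha>\<in>\<Phi>pos. (param D \<alpha> / 2 * cext \<alpha> (v i)) \<odot>\<^bsub>H\<^esub> (?t (vu i) \<cdot> Ws (sW D \<alpha>)))"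
      unfolding Ws_T_elt
      by (intro H.finsum_eqI, subst H.finsum_mult_l) (auto simp: cl H.smult_mult_r intro!: H.finsum_eqI)
    also have "\<dots> = (\<Oplus>\<^bsub>H\<^esub>\<alpha>\<in>\<Phi>pos. (param D \<alpha> / 2) \<odot>\<^bsub>H\<^esub> (?t (aC \<alpha>) \<cdot> Ws (sW D \<alpha>)))"
      by (rule contract_root_sum(1)[OF H.complex_algebra_axioms 1(1)])
    finally have A: "?S (\<lambda>i. ?t (vu i) \<cdot> ?T (v i)) = \<dots>" .
    have "?S (\<lambda>i. ?T (vu i) \<cdot> ?t (v i))
        = (\<Oplus>\<^bsub>H\<^esub>i\<in>I. \<Oplus>\<^bsub>H\<^esub>\<alpha>\<in>\<Phi>pos. (param D \<alpha> / 2 * cext \<alpha> (vu i)) \<odot>\<^bsub>H\<^esub> (Ws (sW D \<alpha>) \<cdot> ?t (v i)))"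
      unfolding Ws_T_elt
      by (intro H.finsum_eqI, subst H.finsum_mult_r) (auto simp: cl H.smult_mult_l intro!: H.finsum_eqI)
    also have "\<dots> = (\<Oplus>\<^bsub>H\<^esub>\<alpha>\<in>\<Phi>pos. (param D \<alpha> / 2) \<odot>\<^bsub>H\<^esub> (Ws (sW D \<alpha>) \<cdot> ?t (aC \<alpha>)))"
      by (rule contract_root_sum(2)[OF H.complex_algebra_axioms 1(2)])
    finally have B: "?S (\<lambda>i. ?T (vu i) \<cdot> ?t (v i)) = \<dots>" .
    have "?S (\<lambda>i. ?t (vu i) \<cdot> ?T (v i)) \<oplus>\<^bsub>H\<^esub> ?S (\<lambda>i. ?T (vu i) \<cdot> ?t (v i))
        = (\<Oplus>\<^bsub>H\<^esub>\<alpha>\<in>\<Phi>pos. (param D \<alpha> / 2) \<odot>\<^bsub>H\<^esub> (?t (aC \<alpha>) \<cdot> Ws (sW D \<alpha>) \<oplus>\<^bsub>H\<^esub> Ws (sW D \<alpha>) \<cdot> ?t (aC \<alpha>)))"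
      unfolding A B by (subst H.finsum_add[symmetric]; (rule H.finsum_eqI)?) (auto simp: cl H.smult_r_distr)
    also have "\<dots> = (\<Oplus>\<^bsub>H\<^esub>\<alpha>\<in>\<Phi>pos. \<zero>\<^bsub>H\<^esub>)"
      by (intro H.finsum_eqI) (auto simp: tilde_aC_anticommute)
    finally show ?thesis by simp
  qed
  finally show ?thesis
    using cl Ws.hom_closed Omega_W_inv by (auto simp: CW_inv_def H.minus_eq H.a_assoc H.r_neg)
qed

end

section \<open>The Weyl algebra\<close>

lemma zero_cdual: "(\<lambda>_. 0) \<in> cdual"
  and plus_cdual: "\<lbrakk>l \<in> cdual; m \<in> cdual\<rbrakk> \<Longrightarrow> (\<lambda>u. l u + m u) \<in> cdual"
  and times_cdual: "l \<in> cdual \<Longrightarrow> (\<lambda>u. c * l u) \<in> cdual"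
  by (rule cdualI; simp add: cdual_add cdual_cscale algebra_simps)+

lemma sum_cdual: "(\<And>i. i \<in> S \<Longrightarrow> l i \<in> cdual) \<Longrightarrow> (\<lambda>u. \<Sum>i\<in>S. c i * l i u) \<in> cdual"
  by (induction S rule: infinite_finite_induct) (simp_all add: zero_cdual plus_cdual times_cdual)

context root_datum
begin

abbreviation Wl :: "(complex, 'v weyl_elt) module" where "Wl \<equiv> weyl_algebra"
abbreviation mult_Wl (infixl "\<bullet>" 70) where "x \<bullet> y \<equiv> x \<otimes>\<^bsub>Wl\<^esub> y"

lemma weyl_presentation: "presentation sympl_carrier (weyl_relations :: ('v sympl list \<Rightarrow>\<^sub>0 complex) set)"
proof
  interpret F: complex_algebra "free_algebra (sympl_carrier :: 'v sympl set)" by (rule complex_algebra_free_algebra)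
  have l: "linear_relations id sympl_carrier sympl_add sympl_scale \<subseteq> carrier (free_algebra (sympl_carrier :: 'v sympl set))"
    by (rule linear_relations_closed)
      (auto simp: sympl_carrier_def sympl_add_def sympl_scale_def plus_cdual times_cdual)
  show "weyl_relations \<subseteq> carrier (free_algebra (sympl_carrier :: 'v sympl set))"
    unfolding weyl_relations_def Let_def
    by (intro Un_least l) (auto intro!: free_algebra_closed(1) gen_closed F.m_closed F.smult_closed)
qed

lemma complex_algebra_weyl: "complex_algebra Wl"
proof -
  interpret presentation sympl_carrier "weyl_relations :: ('v sympl list \<Rightarrow>\<^sub>0 complex) set"
    by (rule weyl_presentation)
  show ?thesis unfolding weyl_algebra_def by (rule proj.A'.complex_algebra_axioms)
qed

sublocale Wl: complex_algebra Wl by (rule complex_algebra_weyl)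

lemma V_to_Wl_lin: "lin_into Wl V_to_Wl"
  and Vst_closed [simp]: "l \<in> cdual \<Longrightarrow> Vst_to_Wl l \<in> carrier Wl"
  and Vst_add: "\<lbrakk>l \<in> cdual; m \<in> cdual\<rbrakk> \<Longrightarrow> Vst_to_Wl (\<lambda>u. l u + m u) = Vst_to_Wl l \<oplus>\<^bsub>Wl\<^esub> Vst_to_Wl m"
  and Vst_smult: "l \<in> cdual \<Longrightarrow> Vst_to_Wl (\<lambda>u. c * l u) = c \<odot>\<^bsub>Wl\<^esub> Vst_to_Wl l"
  and Vst_V: "l \<in> cdual \<Longrightarrow> Vst_to_Wl l \<bullet> V_to_Wl u = V_to_Wl u \<bullet> Vst_to_Wl l \<oplus>\<^bsub>Wl\<^esub> l u \<odot>\<^bsub>Wl\<^esub> \<one>\<^bsub>Wl\<^esub>"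
proof -
  interpret P: presentation sympl_carrier "weyl_relations :: ('v sympl list \<Rightarrow>\<^sub>0 complex) set"
    by (rule weyl_presentation)
  have lin: "linear_relations id sympl_carrier sympl_add sympl_scale \<subseteq> (weyl_relations :: ('v sympl list \<Rightarrow>\<^sub>0 complex) set)"
    by (auto simp: weyl_relations_def Let_def)
  have V [simp]: "(u, \<lambda>_. 0) \<in> sympl_carrier" for u :: "'v cx" by (simp add: sympl_carrier_def zero_cdual)
  have L [simp]: "(0, l) \<in> sympl_carrier" if "l \<in> cdual" for l :: "'v cx \<Rightarrow> complex"
    using that by (simp add: sympl_carrier_def)
  show "lin_into Wl V_to_Wl"
    unfolding lin_into_def V_to_Wl_def weyl_algebra_def
  proof (intro conjI allI)
    show "presented_gen sympl_carrier weyl_relations (u + w, \<lambda>_. 0)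
      = presented_gen sympl_carrier weyl_relations (u, \<lambda>_. 0) \<oplus>\<^bsub>P.P\<^esub> presented_gen sympl_carrier weyl_relations (w, \<lambda>_. 0)"
      for u w :: "'v cx"
      using P.presented_gen_add[OF lin V V, of u w] by (simp add: sympl_add_def)
    show "presented_gen sympl_carrier weyl_relations (cscale c u, \<lambda>_. 0)
      = c \<odot>\<^bsub>P.P\<^esub> presented_gen sympl_carrier weyl_relations (u, \<lambda>_. 0)" for c and u :: "'v cx"
      using P.presented_gen_smult[OF lin V, of u c] by (simp add: sympl_scale_def)
  qed auto
  show "Vst_to_Wl l \<in> carrier Wl" if "l \<in> cdual" for l
    using that by (simp add: Vst_to_Wl_def weyl_algebra_def)
  show "Vst_to_Wl (\<lambda>u. l u + m u) = Vst_to_Wl l \<oplus>\<^bsub>Wl\<^esub> Vst_to_Wl m" if "l \<in> cdual" "m \<in> cdual" for l m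
    unfolding Vst_to_Wl_def weyl_algebra_def
    using that P.presented_gen_add[OF lin, of "(0, l)" "(0, m)"] by (simp add: sympl_add_def plus_cdual)
  show "Vst_to_Wl (\<lambda>u. c * l u) = c \<odot>\<^bsub>Wl\<^esub> Vst_to_Wl l" if "l \<in> cdual" for c l
    unfolding Vst_to_Wl_def weyl_algebra_def
    using that P.presented_gen_smult[OF lin, of "(0, l)" c] by (simp add: sympl_scale_def times_cdual)
  show "Vst_to_Wl l \<bullet> V_to_Wl u = V_to_Wl u \<bullet> Vst_to_Wl l \<oplus>\<^bsub>Wl\<^esub> l u \<odot>\<^bsub>Wl\<^esub> \<one>\<^bsub>Wl\<^esub>" if "l \<in> cdual" for l u
  proof -
    have o: "omega (0, l) (u, \<lambda>_. 0) = l u" by (simp add: omega_def)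
    have "gen (0, l) \<otimes>\<^bsub>P.F\<^esub> gen (u, \<lambda>_. 0) - gen (u, \<lambda>_. 0) \<otimes>\<^bsub>P.F\<^esub> gen (0, l)
        - omega (0, l) (u, \<lambda>_. 0) \<odot>\<^bsub>P.F\<^esub> \<one>\<^bsub>P.F\<^esub> \<in> weyl_relations"
      using V L[OF that] unfolding weyl_relations_def Let_def by blast
    then have "gen (0, l) \<otimes>\<^bsub>P.F\<^esub> gen (u, \<lambda>_. 0) - (gen (u, \<lambda>_. 0) \<otimes>\<^bsub>P.F\<^esub> gen (0, l)
        \<oplus>\<^bsub>P.F\<^esub> l u \<odot>\<^bsub>P.F\<^esub> \<one>\<^bsub>P.F\<^esub>) \<in> weyl_relations"
      by (simp add: add_free_algebra diff_diff_eq o)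
    from P.relation[OF this] that show ?thesis
      by (simp add: V_to_Wl_def Vst_to_Wl_def weyl_algebra_def P.presented_gen_eq gen_closed
          P.proj.hom_mult P.proj.hom_add P.proj.hom_smult)
  qed
qed

lemmas V_to_Wl = lin_intoD[OF V_to_Wl_lin]

text \<open>The domain of \<open>Vst_to_Wl\<close> is the set \<open>cdual\<close> of functionals
  and not the type of V, so \<open>lin_into\<close> does not describe it and finite sums are treated
  separately.\<close>

lemma Vst_sum:
  assumes "\<And>i. i \<in> S \<Longrightarrow> l i \<in> cdual"
  shows "Vst_to_Wl (\<lambda>u. \<Sum>i\<in>S. c i * l i u) = (\<Oplus>\<^bsub>Wl\<^esub>i\<in>S. c i \<odot>\<^bsub>Wl\<^esub> Vst_to_Wl (l i))"
proof -
  have 0: "Vst_to_Wl (\<lambda>u. 0) = \<zero>\<^bsub>Wl\<^esub>"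
    using Vst_smult[OF zero_cdual, of 0] by (simp add: zero_cdual)
  show ?thesis
  proof (cases "finite S")
    case True
    \<comment> \<open>Induction over subsets of S keeps the hypothesis that the functionals lie in
      \<open>cdual\<close> available; partial sums stay there by \<open>sum_cdual\<close>.\<close>
    have "T \<subseteq> S \<Longrightarrow> Vst_to_Wl (\<lambda>u. \<Sum>i\<in>T. c i * l i u) = (\<Oplus>\<^bsub>Wl\<^esub>i\<in>T. c i \<odot>\<^bsub>Wl\<^esub> Vst_to_Wl (l i))" if "finite T" for T
      using that
    proof (induction T rule: finite_induct)
      case (insert x T)
      have "Vst_to_Wl (\<lambda>u. c x * l x u + (\<Sum>i\<in>T. c i * l i u)) = c x \<odot>\<^bsub>Wl\<^esub> Vst_to_Wl (l x) \<oplus>\<^bsub>Wl\<^esub> Vst_to_Wl (\<lambda>u. \<Sum>i\<in>T. c i * l i u)"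
        using insert assms by (subst Vst_add) (auto simp: Vst_smult times_cdual intro!: sum_cdual)
      then show ?case using insert assms by (subst Wl.finsum_insert) (auto simp: subset_iff)
    qed (simp add: 0)
    then show ?thesis using True by blast
  qed (simp add: 0)
qed

section \<open>The action of commutators of reflections on V\<close>

lemma CW_act_superset:
  assumes "finite S" "Poly_Mapping.keys a \<subseteq> S"
  shows "CW_act a u = (\<Sum>g\<in>S. cscale (Poly_Mapping.lookup a g) (map_prod g g u))"
  unfolding CW_act_def using assms by (intro sum.mono_neutral_left) (auto simp: in_keys_iff)

lemma CW_act_diff: "CW_act (a - b) u = CW_act a u - CW_act b u"
proof -
  let ?S = "Poly_Mapping.keys a \<union> Poly_Mapping.keys b"
  have "Poly_Mapping.keys (a - b) \<subseteq> ?S" by (auto simp: in_keys_iff lookup_minus)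
  then show ?thesis
    by (simp add: CW_act_superset[of ?S] lookup_minus cx.scale_left_diff_distrib sum_subtractf)
qed

lemma CW_act_single: "CW_act (\<delta> g) u = map_prod g g u"
  by (simp add: CW_act_superset[of "{g}"])

lemma commutator_sW: "\<lbrakk>\<alpha> \<in> roots D; \<beta> \<in> roots D\<rbrakk> \<Longrightarrow>
  commutator C (sW D \<alpha>) (sW D \<beta>) = Poly_Mapping.single (s \<alpha> \<circ> s \<beta>) 1 - Poly_Mapping.single (s \<beta> \<circ> s \<alpha>) 1"
  by (simp add: commutator_def minus_C sW_def mult_C_single weyl_comp)

text \<open>The terms linear in the reflections cancel and only the two mixed terms survive. By
  \<open>root_coroot_ash\<close> both carry the same symmetric factor, which exhibits the commutator
  as a multiple of the skew operator spanned by the two Riesz vectors.\<close>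

lemma refl_commutator:
  assumes "\<alpha> \<in> roots D" "\<beta> \<in> roots D"
  shows "s \<alpha> (s \<beta> x) - s \<beta> (s \<alpha> x) = B (coroot D \<alpha>) (coroot D \<beta>) *\<^sub>R (\<beta> x *\<^sub>R ash \<alpha> - \<alpha> x *\<^sub>R ash \<beta>)"
proof -
  have "s \<alpha> (s \<beta> x) - s \<beta> (s \<alpha> x)
      = \<beta> x *\<^sub>R (\<alpha> (coroot D \<beta>) *\<^sub>R coroot D \<alpha>) - \<alpha> x *\<^sub>R (\<beta> (coroot D \<alpha>) *\<^sub>R coroot D \<beta>)"
    using assms by (simp add: refl_def root_simps algebra_simps)
  then show ?thesis
    using assms by (simp add: root_coroot_ash form_sym[of "coroot D \<beta>"] algebra_simps)
qed

lemma CW_act_commutator: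
  assumes "\<alpha> \<in> roots D" "\<beta> \<in> roots D"
  shows "CW_act (commutator C (sW D \<alpha>) (sW D \<beta>)) u = cscale (complex_of_real (B (coroot D \<alpha>) (coroot D \<beta>)))
    (cscale (cext \<beta> u) (aC \<alpha>) - cscale (cext \<alpha> u) (aC \<beta>))"
proof (cases u)
  case (Pair x y)
  have "CW_act (commutator C (sW D \<alpha>) (sW D \<beta>)) u = (s \<alpha> (s \<beta> x) - s \<beta> (s \<alpha> x), s \<alpha> (s \<beta> y) - s \<beta> (s \<alpha> y))"
    using assms by (simp add: commutator_sW CW_act_diff CW_act_single Pair)
  then show ?thesis
    unfolding refl_commutator[OF assms] Pair by (simp add: cscale_def cext_def aC_def)
qed

text \<open>This justifies the convention for orthogonal pairs: where the denominator of
  \<open>pair_coeff\<close> vanishes, the commutator vanishes as well.\<close>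

lemma commutator_sW_orthogonal:
  assumes "\<alpha> \<in> roots D" "\<beta> \<in> roots D" "B (coroot D \<alpha>) (coroot D \<beta>) = 0"
  shows "commutator C (sW D \<alpha>) (sW D \<beta>) = \<zero>\<^bsub>C\<^esub>"
proof -
  have "s \<alpha> \<circ> s \<beta> = s \<beta> \<circ> s \<alpha>"
    using refl_commutator[OF assms(1,2)] assms(3) by (auto simp: fun_eq_iff)
  then show ?thesis
    using assms by (simp add: commutator_def sW_def mult_C_single weyl_comp C.minus_eq C.r_neg)
qed

end

section \<open>The tensor product and the commutator\<close>

text \<open>Symmetry makes the definite description well defined, since a pair determines its two
  elements up to order.\<close>

lemma on_pair_eq:
  assumes "f \<alpha> \<beta> = f \<beta> \<alpha>"
  shows "on_pair f {\<alpha>, \<beta>} = f \<alpha> \<beta>"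
  unfolding on_pair_def using assms by (intro the_equality) (auto simp: doubleton_eq_iff)

text \<open>Here f is the symmetrisation of g, so an unordered pair collects its two orderings, and
  the diagonal contributes nothing. Adding x to P adds the pairs of x with the elements of P,
  matching a new row and a new column of the double sum.\<close>

lemma (in complex_algebra) finsum_unordered_pairs:
  assumes "finite P" "\<And>\<alpha> \<beta>. \<lbrakk>\<alpha> \<in> P; \<beta> \<in> P\<rbrakk> \<Longrightarrow> g \<alpha> \<beta> \<in> carrier A" "\<And>\<alpha>. \<alpha> \<in> P \<Longrightarrow> g \<alpha> \<alpha> = \<zero>"
    and "\<And>\<alpha> \<beta>. \<lbrakk>\<alpha> \<in> P; \<beta> \<in> P\<rbrakk> \<Longrightarrow> f \<alpha> \<beta> = g \<alpha> \<beta> \<oplus> g \<beta> \<alpha>"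
  shows "(\<Oplus>p\<in>{{\<alpha>, \<beta>} | \<alpha> \<beta>. \<alpha> \<in> P \<and> \<beta> \<in> P \<and> \<alpha> \<noteq> \<beta>}. on_pair f p) = (\<Oplus>\<alpha>\<in>P. \<Oplus>\<beta>\<in>P. g \<alpha> \<beta>)"
  using assms
proof (induction P rule: finite_induct)
  case empty
  then show ?case by simp
next
  case (insert x P)
  let ?Q = "\<lambda>P. {{\<alpha>, \<beta>} | \<alpha> \<beta>. \<alpha> \<in> P \<and> \<beta> \<in> P \<and> \<alpha> \<noteq> \<beta>}"
  have on: "on_pair f {\<alpha>, \<beta>} = g \<alpha> \<beta> \<oplus> g \<beta> \<alpha>" if "\<alpha> \<in> insert x P" "\<beta> \<in> insert x P" for \<alpha> \<beta>
    using that insert.prems by (subst on_pair_eq) (auto intro!: a_comm)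
  have Q: "?Q (insert x P) = ?Q P \<union> (\<lambda>\<beta>. {x, \<beta>}) ` P"
    using insert.hyps(2) by (auto simp: insert_commute image_iff)
  have "?Q P \<subseteq> Pow P" by auto
  then have fin: "finite (?Q P)" using insert.hyps(1) finite_subset by blast
  have inj: "inj_on (\<lambda>\<beta>. {x, \<beta>}) P"
    by (auto simp: inj_on_def doubleton_eq_iff)
  have "(\<Oplus>p\<in>?Q (insert x P). on_pair f p) = (\<Oplus>p\<in>?Q P. on_pair f p) \<oplus> (\<Oplus>p\<in>(\<lambda>\<beta>. {x, \<beta>}) ` P. on_pair f p)"
    unfolding Q
  proof (rule finsum_Un_disjoint)
    show "?Q P \<inter> (\<lambda>\<beta>. {x, \<beta>}) ` P = {}"
    proof (rule equals0I)
      fix p assume p: "p \<in> ?Q P \<inter> (\<lambda>\<beta>. {x, \<beta>}) ` P"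
      have "p \<subseteq> P" using IntD1[OF p] \<open>?Q P \<subseteq> Pow P\<close> by (rule PowD[OF subsetD, rotated])
      moreover have "x \<in> p" using IntD2[OF p] by (rule imageE) simp
      ultimately show False using insert.hyps(2) by blast
    qed
  qed (use insert.hyps(1) insert.prems fin on in auto)
  also have "(\<Oplus>p\<in>(\<lambda>\<beta>. {x, \<beta>}) ` P. on_pair f p) = (\<Oplus>\<beta>\<in>P. on_pair f {x, \<beta>})"
    using on insert.prems by (intro finsum_reindex[OF _ inj]) auto
  also have "\<dots> = (\<Oplus>\<beta>\<in>P. g x \<beta> \<oplus> g \<beta> x)"
    using insert.prems by (intro finsum_eqI on) auto
  also have "\<dots> = (\<Oplus>\<beta>\<in>P. g x \<beta>) \<oplus> (\<Oplus>\<beta>\<in>P. g \<beta> x)"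
    using insert.prems by (intro finsum_add) auto
  also have "(\<Oplus>p\<in>?Q P. on_pair f p) = (\<Oplus>\<alpha>\<in>P. \<Oplus>\<beta>\<in>P. g \<alpha> \<beta>)"
    using insert by auto
  also have "(\<Oplus>\<alpha>\<in>P. \<Oplus>\<beta>\<in>P. g \<alpha> \<beta>) \<oplus> ((\<Oplus>\<beta>\<in>P. g x \<beta>) \<oplus> (\<Oplus>\<beta>\<in>P. g \<beta> x))
      = (\<Oplus>\<beta>\<in>P. g x \<beta>) \<oplus> ((\<Oplus>\<beta>\<in>P. g \<beta> x) \<oplus> (\<Oplus>\<alpha>\<in>P. \<Oplus>\<beta>\<in>P. g \<alpha> \<beta>))"
    using insert.prems by (simp add: a_ac)
  also have "(\<Oplus>\<beta>\<in>P. g \<beta> x) \<oplus> (\<Oplus>\<alpha>\<in>P. \<Oplus>\<beta>\<in>P. g \<alpha> \<beta>) = (\<Oplus>\<alpha>\<in>P. \<Oplus>\<beta>\<in>insert x P. g \<alpha> \<beta>)"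
    using insert by (subst finsum_add[symmetric]; (intro finsum_eqI)?) (auto simp: finsum_insert Pi_iff)
  also have "(\<Oplus>\<beta>\<in>P. g x \<beta>) \<oplus> (\<Oplus>\<alpha>\<in>P. \<Oplus>\<beta>\<in>insert x P. g \<alpha> \<beta>) = (\<Oplus>\<alpha>\<in>insert x P. \<Oplus>\<beta>\<in>insert x P. g \<alpha> \<beta>)"
    using insert by (subst (3) finsum_insert) (auto simp: finsum_insert Pi_iff)
  finally show ?case .
qed

lemma (in complex_algebra) pow_2: "x \<in> carrier A \<Longrightarrow> x [^] (2::nat) = x \<otimes> x"
  by (simp add: numeral_2_eq_2)

section \<open>The tensor product of the Hecke and Weyl algebras, and sums over pairs of
  roots\<close>

context root_datum_basis
begin

abbreviation "c\<sigma> \<alpha> \<beta> \<equiv> commutator C (sW D \<alpha>) (sW D \<beta>)"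
abbreviation "\<nu> \<alpha> \<beta> \<equiv> nu'_comm D I v vs \<alpha> \<beta>"
abbreviation "X \<equiv> HW D"
abbreviation N :: "('v \<Rightarrow> real) \<Rightarrow> ('v \<Rightarrow> real) \<Rightarrow> 'v weyl_elt" where
  "N \<alpha> \<beta> \<equiv> V_to_Wl (aC \<alpha>) \<bullet> Vst_to_Wl (cext \<beta>)"

sublocale tp: tensor_product H Wl ..

lemma HW_eq: "X = tp.T"
  by (simp add: HW_def)

lemma complex_algebra_HW: "complex_algebra X"
  unfolding HW_eq by (rule tp.proj.A'.complex_algebra_axioms)

sublocale X: complex_algebra X by (rule complex_algebra_HW)

lemma tens_closed [simp, intro]: "\<lbrakk>a \<in> carrier H; p \<in> carrier Wl\<rbrakk> \<Longrightarrow> tens D a p \<in> carrier X"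
  and tens_mult: "\<lbrakk>a \<in> carrier H; p \<in> carrier Wl; b \<in> carrier H; q \<in> carrier Wl\<rbrakk> \<Longrightarrow>
    tens D a p \<otimes>\<^bsub>X\<^esub> tens D b q = tens D (a \<cdot> b) (p \<bullet> q)"
  and tens_add_l: "\<lbrakk>a \<in> carrier H; b \<in> carrier H; p \<in> carrier Wl\<rbrakk> \<Longrightarrow>
    tens D (a \<oplus>\<^bsub>H\<^esub> b) p = tens D a p \<oplus>\<^bsub>X\<^esub> tens D b p"
  and tens_add_r: "\<lbrakk>a \<in> carrier H; p \<in> carrier Wl; q \<in> carrier Wl\<rbrakk> \<Longrightarrow>
    tens D a (p \<oplus>\<^bsub>Wl\<^esub> q) = tens D a p \<oplus>\<^bsub>X\<^esub> tens D a q"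
  and tens_smult_l: "\<lbrakk>a \<in> carrier H; p \<in> carrier Wl\<rbrakk> \<Longrightarrow> tens D (c \<odot>\<^bsub>H\<^esub> a) p = c \<odot>\<^bsub>X\<^esub> tens D a p"
  and tens_smult_r: "\<lbrakk>a \<in> carrier H; p \<in> carrier Wl\<rbrakk> \<Longrightarrow> tens D a (c \<odot>\<^bsub>Wl\<^esub> p) = c \<odot>\<^bsub>X\<^esub> tens D a p"
  unfolding HW_eq tens_def
  by (simp_all add: tp.pure_tensor_mult tp.pure_tensor_add_l tp.pure_tensor_add_r
      tp.pure_tensor_smult_l tp.pure_tensor_smult_r)

lemma tens_zero [simp]:
  "p \<in> carrier Wl \<Longrightarrow> tens D \<zero>\<^bsub>H\<^esub> p = \<zero>\<^bsub>X\<^esub>" "a \<in> carrier H \<Longrightarrow> tens D a \<zero>\<^bsub>Wl\<^esub> = \<zero>\<^bsub>X\<^esub>"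
  using tens_smult_l[of "\<zero>\<^bsub>H\<^esub>" p 0] tens_smult_r[of a "\<zero>\<^bsub>Wl\<^esub>" 0] by simp_all

lemma tens_minus_l: "\<lbrakk>a \<in> carrier H; p \<in> carrier Wl\<rbrakk> \<Longrightarrow> tens D (\<ominus>\<^bsub>H\<^esub> a) p = \<ominus>\<^bsub>X\<^esub> tens D a p"
  using tens_smult_l[of a p "- 1"] by (simp add: H.smult_minus_left X.smult_minus_left)

lemma tens_minus_r: "\<lbrakk>a \<in> carrier H; p \<in> carrier Wl\<rbrakk> \<Longrightarrow> tens D a (\<ominus>\<^bsub>Wl\<^esub> p) = \<ominus>\<^bsub>X\<^esub> tens D a p"
  using tens_smult_r[of a p "- 1"] by (simp add: Wl.smult_minus_left X.smult_minus_left)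

lemma tens_finsum_l:
  assumes "\<And>i. i \<in> S \<Longrightarrow> a i \<in> carrier H" "p \<in> carrier Wl"
  shows "tens D (finsum H a S) p = (\<Oplus>\<^bsub>X\<^esub>i\<in>S. tens D (a i) p)"
proof (cases "finite S")
  case True
  then show ?thesis using assms
    by (induction S rule: finite_induct) (auto simp: H.finsum_insert X.finsum_insert Pi_iff tens_add_l)
qed (use assms in simp)

lemma tens_finsum_r:
  assumes "\<And>i. i \<in> S \<Longrightarrow> p i \<in> carrier Wl" "a \<in> carrier H"
  shows "tens D a (finsum Wl p S) = (\<Oplus>\<^bsub>X\<^esub>i\<in>S. tens D a (p i))"
proof (cases "finite S")
  case True
  then show ?thesis using assms
    by (induction S rule: finite_induct) (auto simp: Wl.finsum_insert X.finsum_insert Pi_iff tens_add_r)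
qed (use assms in simp)

lemma N_closed [simp, intro]: "\<beta> \<in> roots D \<Longrightarrow> N \<alpha> \<beta> \<in> carrier Wl"
  using V_to_Wl(1) by (auto simp: cext_cdual)

lemma Vst_expansion: "l \<in> cdual \<Longrightarrow> (\<Oplus>\<^bsub>Wl\<^esub>i\<in>I. l (v i) \<odot>\<^bsub>Wl\<^esub> Vst_to_Wl (vs i)) = Vst_to_Wl l"
  using Vst_sum[of I vs "\<lambda>i. l (v i)"] by (simp add: cdual_expansion[symmetric] flip: Vst_sum)

text \<open>For a root \<gamma>, \<open>nu'\<close> sends the rank-one operator taking u to
  \<gamma>(u) x to the product of x and \<gamma>, because \<gamma> is expanded in the dual basis
  \<open>vs\<close>. The commutator acts as a multiple of the difference of two such
  operators.\<close>

lemma nu'_comm_eq: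
  assumes "\<alpha> \<in> roots D" "\<beta> \<in> roots D"
  shows "\<nu> \<alpha> \<beta> = complex_of_real (B (coroot D \<alpha>) (coroot D \<beta>)) \<odot>\<^bsub>Wl\<^esub> (N \<alpha> \<beta> \<ominus>\<^bsub>Wl\<^esub> N \<beta> \<alpha>)"
proof -
  let ?b = "complex_of_real (B (coroot D \<alpha>) (coroot D \<beta>))"
  have diff: "V_to_Wl (u - w) = V_to_Wl u \<ominus>\<^bsub>Wl\<^esub> V_to_Wl w" for u w
    using V_to_Wl(2)[of "u - w" w] V_to_Wl(1) by (simp add: Wl.minus_eq Wl.a_assoc Wl.r_neg)
  have contract: "(\<Oplus>\<^bsub>Wl\<^esub>i\<in>I. (cext \<gamma> (v i) \<odot>\<^bsub>Wl\<^esub> V_to_Wl u) \<bullet> Vst_to_Wl (vs i)) = V_to_Wl u \<bullet> Vst_to_Wl (cext \<gamma>)"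
    if "\<gamma> \<in> roots D" for \<gamma> u
    using V_to_Wl(1) Vst_expansion[OF cext_cdual[OF that]]
    by (simp add: Wl.smult_mult_l Wl.finsum_mult_l Wl.smult_mult_r cext_cdual[OF that]
        flip: Vst_expansion[OF cext_cdual[OF that]] cong: Wl.finsum_cong)
  have "\<nu> \<alpha> \<beta> = (\<Oplus>\<^bsub>Wl\<^esub>i\<in>I. ?b \<odot>\<^bsub>Wl\<^esub> ((cext \<beta> (v i) \<odot>\<^bsub>Wl\<^esub> V_to_Wl (aC \<alpha>)) \<bullet> Vst_to_Wl (vs i)
      \<ominus>\<^bsub>Wl\<^esub> (cext \<alpha> (v i) \<odot>\<^bsub>Wl\<^esub> V_to_Wl (aC \<beta>)) \<bullet> Vst_to_Wl (vs i)))"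
    unfolding nu'_comm_def nu'_def
    using V_to_Wl(1)
    by (intro Wl.finsum_eqI)
      (auto simp: CW_act_commutator[OF assms] V_to_Wl(3) diff Wl.smult_mult_l Wl.minus_eq Wl.l_distr Wl.l_minus)
  also have "\<dots> = ?b \<odot>\<^bsub>Wl\<^esub> (N \<alpha> \<beta> \<ominus>\<^bsub>Wl\<^esub> N \<beta> \<alpha>)"
    using V_to_Wl(1) assms by (subst Wl.finsum_smult) (auto simp: Wl.finsum_diff contract)
  finally show ?thesis .
qed

lemma nu'_comm_closed [simp, intro]: "\<lbrakk>\<alpha> \<in> roots D; \<beta> \<in> roots D\<rbrakk> \<Longrightarrow> \<nu> \<alpha> \<beta> \<in> carrier Wl"
  by (auto simp: nu'_comm_eq)

text \<open>This is the form in which terms come out of the commutator of \<open>D_plus\<close> and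
  \<open>D_minus\<close>: indexed by ordered pairs, with no denominator and without
  antisymmetrisation.\<close>

definition half_term :: "('v \<Rightarrow> real) \<Rightarrow> ('v \<Rightarrow> real) \<Rightarrow> 'v hw_elt" where
  "half_term \<alpha> \<beta> = (param D \<alpha> * param D \<beta>) \<odot>\<^bsub>X\<^esub> tens D (Ws (c\<sigma> \<alpha> \<beta>)) (N \<alpha> \<beta>)"

definition pair_term :: "('v \<Rightarrow> real) \<Rightarrow> ('v \<Rightarrow> real) \<Rightarrow> 'v hw_elt" where
  "pair_term \<alpha> \<beta> = pair_coeff D \<alpha> \<beta> \<odot>\<^bsub>X\<^esub> tens D (Ws (c\<sigma> \<alpha> \<beta>)) (\<nu> \<alpha> \<beta>)"

lemma half_term_closed [simp, intro]: "\<lbrakk>\<alpha> \<in> roots D; \<beta> \<in> roots D\<rbrakk> \<Longrightarrow> half_term \<alpha> \<beta> \<in> carrier X"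
  by (auto simp: half_term_def)

text \<open>Exchanging the roots negates the commutator, so the two orderings assemble to the
  antisymmetric element in \<open>nu'_comm_eq\<close>, whose factor cancels the denominator. For
  orthogonal coroots no cancellation takes place, but both sides vanish with the commutator.\<close>

lemma pair_term_eq:
  assumes "\<alpha> \<in> roots D" "\<beta> \<in> roots D"
  shows "pair_term \<alpha> \<beta> = half_term \<alpha> \<beta> \<oplus>\<^bsub>X\<^esub> half_term \<beta> \<alpha>"
proof -
  have swap: "Ws (c\<sigma> \<beta> \<alpha>) = \<ominus>\<^bsub>H\<^esub> Ws (c\<sigma> \<alpha> \<beta>)"
    using assms by (simp add: C.commutator_minus_swap[of "sW D \<alpha>" "sW D \<beta>"] Ws.hom_minus)
  show ?thesis
  proof (cases "B (coroot D \<alpha>) (coroot D \<beta>) = 0")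
    case True
    then show ?thesis
      using assms by (simp add: pair_term_def half_term_def swap commutator_sW_orthogonal)
  next
    case False
    have cl: "Ws (c\<sigma> \<alpha> \<beta>) \<in> carrier H" "N \<alpha> \<beta> \<in> carrier Wl" "N \<beta> \<alpha> \<in> carrier Wl" using assms by auto
    have "pair_term \<alpha> \<beta> = (param D \<alpha> * param D \<beta>) \<odot>\<^bsub>X\<^esub> tens D (Ws (c\<sigma> \<alpha> \<beta>)) (N \<alpha> \<beta> \<ominus>\<^bsub>Wl\<^esub> N \<beta> \<alpha>)"
      using assms cl False by (simp add: pair_term_def pair_coeff_def nu'_comm_eq tens_smult_r X.smult_smult)
    then show ?thesis
      using assms cl by (simp add: half_term_def swap Wl.minus_eq tens_add_r tens_minus_r tens_minus_l X.smult_r_distr mult.commute)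
  qed
qed

lemma pair_sum_eq: "(\<Oplus>\<^bsub>X\<^esub>p\<in>pos_root_pairs D. on_pair pair_term p) = (\<Oplus>\<^bsub>X\<^esub>\<alpha>\<in>\<Phi>pos. \<Oplus>\<^bsub>X\<^esub>\<beta>\<in>\<Phi>pos. half_term \<alpha> \<beta>)"
  unfolding pos_root_pairs_def
proof (rule X.finsum_unordered_pairs)
  show "half_term \<alpha> \<alpha> = \<zero>\<^bsub>X\<^esub>" if "\<alpha> \<in> \<Phi>pos" for \<alpha>
    using that by (simp add: half_term_def commutator_def C.minus_eq C.r_neg)
qed (auto simp: pair_term_eq)

text \<open>The second product has the functional to the left of the vector. Putting it into the
  order of the first product costs the scalar l u, which leaves a pure Hecke term; the rest combines
  to a commutator in the Hecke algebra.\<close>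

lemma commutator_tens:
  assumes "a \<in> carrier H" "b \<in> carrier H" "l \<in> cdual"
  shows "commutator X (tens D a (V_to_Wl u)) (tens D b (Vst_to_Wl l))
    = tens D (commutator H a b) (V_to_Wl u \<bullet> Vst_to_Wl l) \<ominus>\<^bsub>X\<^esub> l u \<odot>\<^bsub>X\<^esub> tens D (b \<cdot> a) \<one>\<^bsub>Wl\<^esub>"
proof -
  note cl = assms V_to_Wl(1)
  have alg: "x \<oplus>\<^bsub>X\<^esub> \<ominus>\<^bsub>X\<^esub> (y \<oplus>\<^bsub>X\<^esub> z) = x \<oplus>\<^bsub>X\<^esub> \<ominus>\<^bsub>X\<^esub> y \<oplus>\<^bsub>X\<^esub> \<ominus>\<^bsub>X\<^esub> z"
    if "x \<in> carrier X" "y \<in> carrier X" "z \<in> carrier X" for x y z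
    using that by (simp add: X.minus_add X.a_assoc)
  show ?thesis
    using cl by (simp add: commutator_def tens_mult Vst_V X.minus_eq H.minus_eq tens_add_r tens_add_l
        tens_minus_l tens_smult_r alg)
qed

text \<open>After replacing the commutator by that of two T's, the sum over j contracts the
  \<open>vs j\<close> to a root and the sum over i contracts the \<open>vu i\<close> to a Riesz
  vector. Each T contributes a factor 1/2, whence the 1/4.\<close>

lemma sum_commutator_tilde:
  "(\<Oplus>\<^bsub>X\<^esub>i\<in>I. \<Oplus>\<^bsub>X\<^esub>j\<in>I. tens D (commutator H (tilde D (v i)) (tilde D (v j))) (V_to_Wl (vu i) \<bullet> Vst_to_Wl (vs j)))
    = \<ominus>\<^bsub>X\<^esub> ((1/4) \<odot>\<^bsub>X\<^esub> (\<Oplus>\<^bsub>X\<^esub>\<alpha>\<in>\<Phi>pos. \<Oplus>\<^bsub>X\<^esub>\<beta>\<in>\<Phi>pos. half_term \<alpha> \<beta>))"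
proof -
  let ?T = "\<lambda>x. Ws (T_elt D x)" and ?cs = "\<lambda>\<alpha> \<beta>. commutator H (Ws (sW D \<alpha>)) (Ws (sW D \<beta>))"
  have cl: "?T x \<in> carrier H" "V_to_Wl x \<in> carrier Wl" for x using T_elt V_to_Wl by auto
  have inner: "(\<Oplus>\<^bsub>X\<^esub>j\<in>I. tens D (commutator H a (?T (v j))) (p \<bullet> Vst_to_Wl (vs j)))
      = (\<Oplus>\<^bsub>X\<^esub>\<beta>\<in>\<Phi>pos. (param D \<beta> / 2) \<odot>\<^bsub>X\<^esub> tens D (commutator H a (Ws (sW D \<beta>))) (p \<bullet> Vst_to_Wl (cext \<beta>)))"
    if a: "a \<in> carrier H" and p: "p \<in> carrier Wl" for a p
  proof -
    have "commutator H a (?T (v j)) = (\<Oplus>\<^bsub>H\<^esub>\<beta>\<in>\<Phi>pos. (param D \<beta> / 2 * cext \<beta> (v j)) \<odot>\<^bsub>H\<^esub> commutator H a (Ws (sW D \<beta>)))" for j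
      unfolding Ws_T_elt using a by (subst H.commutator_finsum_r) (auto simp: H.commutator_smult_r intro!: H.finsum_eqI)
    then have "(\<Oplus>\<^bsub>X\<^esub>j\<in>I. tens D (commutator H a (?T (v j))) (p \<bullet> Vst_to_Wl (vs j)))
      = (\<Oplus>\<^bsub>X\<^esub>j\<in>I. \<Oplus>\<^bsub>X\<^esub>\<beta>\<in>\<Phi>pos. (param D \<beta> / 2 * cext \<beta> (v j)) \<odot>\<^bsub>X\<^esub> tens D (commutator H a (Ws (sW D \<beta>))) (p \<bullet> Vst_to_Wl (vs j)))"
      using a p by (intro X.finsum_eqI) (auto simp: tens_finsum_l tens_smult_l intro!: X.finsum_eqI)
    also have "\<dots> = (\<Oplus>\<^bsub>X\<^esub>\<beta>\<in>\<Phi>pos. \<Oplus>\<^bsub>X\<^esub>j\<in>I. (param D \<beta> / 2 * cext \<beta> (v j)) \<odot>\<^bsub>X\<^esub> tens D (commutator H a (Ws (sW D \<beta>))) (p \<bullet> Vst_to_Wl (vs j)))"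
      using a p by (intro X.finsum_finsum_swap) auto
    also have "\<dots> = (\<Oplus>\<^bsub>X\<^esub>\<beta>\<in>\<Phi>pos. (param D \<beta> / 2) \<odot>\<^bsub>X\<^esub> tens D (commutator H a (Ws (sW D \<beta>))) (p \<bullet> Vst_to_Wl (cext \<beta>)))"
    proof (rule X.finsum_eqI)
      fix \<beta> assume \<beta>: "\<beta> \<in> \<Phi>pos"
      let ?c = "commutator H a (Ws (sW D \<beta>))"
      have c: "?c \<in> carrier H" using a \<beta> by auto
      have "p \<bullet> Vst_to_Wl (cext \<beta>) = (\<Oplus>\<^bsub>Wl\<^esub>j\<in>I. cext \<beta> (v j) \<odot>\<^bsub>Wl\<^esub> (p \<bullet> Vst_to_Wl (vs j)))"
        using p \<beta> by (subst Vst_expansion[symmetric])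
          (auto simp: cext_cdual Wl.finsum_mult_l Wl.smult_mult_r intro!: Wl.finsum_eqI)
      then have "tens D ?c (p \<bullet> Vst_to_Wl (cext \<beta>)) = (\<Oplus>\<^bsub>X\<^esub>j\<in>I. cext \<beta> (v j) \<odot>\<^bsub>X\<^esub> tens D ?c (p \<bullet> Vst_to_Wl (vs j)))"
        using p c by (auto simp: tens_finsum_r tens_smult_r intro!: X.finsum_eqI)
      then show "(\<Oplus>\<^bsub>X\<^esub>j\<in>I. (param D \<beta> / 2 * cext \<beta> (v j)) \<odot>\<^bsub>X\<^esub> tens D ?c (p \<bullet> Vst_to_Wl (vs j)))
          = (param D \<beta> / 2) \<odot>\<^bsub>X\<^esub> tens D ?c (p \<bullet> Vst_to_Wl (cext \<beta>))"
        using p c by (simp flip: X.finsum_smult add: X.smult_smult cong: X.finsum_cong)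
    qed (use a p in \<open>auto simp: cext_cdual\<close>)
    finally show ?thesis .
  qed
  have outer: "(\<Oplus>\<^bsub>X\<^esub>i\<in>I. tens D (commutator H (?T (v i)) (Ws (sW D \<beta>))) (V_to_Wl (vu i) \<bullet> q))
      = (\<Oplus>\<^bsub>X\<^esub>\<alpha>\<in>\<Phi>pos. (param D \<alpha> / 2) \<odot>\<^bsub>X\<^esub> tens D (?cs \<alpha> \<beta>) (V_to_Wl (aC \<alpha>) \<bullet> q))"
    if \<beta>: "\<beta> \<in> \<Phi>pos" and q: "q \<in> carrier Wl" for \<beta> q
  proof -
    have "commutator H (?T (v i)) (Ws (sW D \<beta>)) = (\<Oplus>\<^bsub>H\<^esub>\<alpha>\<in>\<Phi>pos. (param D \<alpha> / 2 * cext \<alpha> (v i)) \<odot>\<^bsub>H\<^esub> ?cs \<alpha> \<beta>)" for i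
      unfolding Ws_T_elt using \<beta> by (subst H.commutator_finsum_l) (auto simp: H.commutator_smult_l intro!: H.finsum_eqI)
    then have "(\<Oplus>\<^bsub>X\<^esub>i\<in>I. tens D (commutator H (?T (v i)) (Ws (sW D \<beta>))) (V_to_Wl (vu i) \<bullet> q))
      = (\<Oplus>\<^bsub>X\<^esub>i\<in>I. \<Oplus>\<^bsub>X\<^esub>\<alpha>\<in>\<Phi>pos. (param D \<alpha> / 2 * cext \<alpha> (v i)) \<odot>\<^bsub>X\<^esub> tens D (?cs \<alpha> \<beta>) (V_to_Wl (vu i) \<bullet> q))"
      using \<beta> q by (intro X.finsum_eqI) (auto simp: cl tens_finsum_l tens_smult_l intro!: X.finsum_eqI)
    also have "\<dots> = (\<Oplus>\<^bsub>X\<^esub>\<alpha>\<in>\<Phi>pos. (param D \<alpha> / 2) \<odot>\<^bsub>X\<^esub> tens D (?cs \<alpha> \<beta>) (V_to_Wl (aC \<alpha>) \<bullet> q))"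
    proof (rule contract_root_sum(1)[OF X.complex_algebra_axioms])
      fix \<alpha> assume "\<alpha> \<in> \<Phi>pos"
      then show "lin_into X (\<lambda>u. tens D (?cs \<alpha> \<beta>) (V_to_Wl u \<bullet> q))"
        using \<beta> q by (auto simp: lin_into_def V_to_Wl Wl.l_distr Wl.smult_mult_l tens_add_r tens_smult_r simp del: split_paired_All)
    qed
    finally show ?thesis .
  qed
  have "(\<Oplus>\<^bsub>X\<^esub>i\<in>I. \<Oplus>\<^bsub>X\<^esub>j\<in>I. tens D (commutator H (tilde D (v i)) (tilde D (v j))) (V_to_Wl (vu i) \<bullet> Vst_to_Wl (vs j)))
      = (\<Oplus>\<^bsub>X\<^esub>i\<in>I. \<Oplus>\<^bsub>X\<^esub>j\<in>I. \<ominus>\<^bsub>X\<^esub> tens D (commutator H (?T (v i)) (?T (v j))) (V_to_Wl (vu i) \<bullet> Vst_to_Wl (vs j)))"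
    by (intro X.finsum_eqI) (auto simp: commutator_tilde cl tens_minus_l)
  also have "\<dots> = \<ominus>\<^bsub>X\<^esub> (\<Oplus>\<^bsub>X\<^esub>i\<in>I. \<Oplus>\<^bsub>X\<^esub>j\<in>I. tens D (commutator H (?T (v i)) (?T (v j))) (V_to_Wl (vu i) \<bullet> Vst_to_Wl (vs j)))"
    by (subst X.finsum_minus[symmetric]; (intro X.finsum_eqI)?) (auto simp: cl X.finsum_minus)
  also have "(\<Oplus>\<^bsub>X\<^esub>i\<in>I. \<Oplus>\<^bsub>X\<^esub>j\<in>I. tens D (commutator H (?T (v i)) (?T (v j))) (V_to_Wl (vu i) \<bullet> Vst_to_Wl (vs j)))
      = (\<Oplus>\<^bsub>X\<^esub>i\<in>I. \<Oplus>\<^bsub>X\<^esub>\<beta>\<in>\<Phi>pos. (param D \<beta> / 2) \<odot>\<^bsub>X\<^esub> tens D (commutator H (?T (v i)) (Ws (sW D \<beta>))) (V_to_Wl (vu i) \<bullet> Vst_to_Wl (cext \<beta>)))"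
    by (intro X.finsum_eqI inner) (auto simp: cl cext_cdual)
  also have "\<dots> = (\<Oplus>\<^bsub>X\<^esub>\<beta>\<in>\<Phi>pos. \<Oplus>\<^bsub>X\<^esub>i\<in>I. (param D \<beta> / 2) \<odot>\<^bsub>X\<^esub> tens D (commutator H (?T (v i)) (Ws (sW D \<beta>))) (V_to_Wl (vu i) \<bullet> Vst_to_Wl (cext \<beta>)))"
    by (rule X.finsum_finsum_swap) (auto simp: cl cext_cdual)
  also have "\<dots> = (\<Oplus>\<^bsub>X\<^esub>\<beta>\<in>\<Phi>pos. \<Oplus>\<^bsub>X\<^esub>\<alpha>\<in>\<Phi>pos. (1/4) \<odot>\<^bsub>X\<^esub> half_term \<alpha> \<beta>)"
  proof (rule X.finsum_eqI)
    fix \<beta> assume \<beta>: "\<beta> \<in> \<Phi>pos"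
    have "(\<Oplus>\<^bsub>X\<^esub>i\<in>I. (param D \<beta> / 2) \<odot>\<^bsub>X\<^esub> tens D (commutator H (?T (v i)) (Ws (sW D \<beta>))) (V_to_Wl (vu i) \<bullet> Vst_to_Wl (cext \<beta>)))
        = (param D \<beta> / 2) \<odot>\<^bsub>X\<^esub> (\<Oplus>\<^bsub>X\<^esub>\<alpha>\<in>\<Phi>pos. (param D \<alpha> / 2) \<odot>\<^bsub>X\<^esub> tens D (?cs \<alpha> \<beta>) (N \<alpha> \<beta>))"
      using \<beta> by (subst X.finsum_smult) (auto simp: cl cext_cdual outer)
    also have "\<dots> = (\<Oplus>\<^bsub>X\<^esub>\<alpha>\<in>\<Phi>pos. (1/4) \<odot>\<^bsub>X\<^esub> half_term \<alpha> \<beta>)"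
      using \<beta> by (subst X.finsum_smult[symmetric]; (intro X.finsum_eqI)?)
        (auto simp: half_term_def Ws.hom_commutator X.smult_smult mult_ac)
    finally show "(\<Oplus>\<^bsub>X\<^esub>i\<in>I. (param D \<beta> / 2) \<odot>\<^bsub>X\<^esub> tens D (commutator H (?T (v i)) (Ws (sW D \<beta>))) (V_to_Wl (vu i) \<bullet> Vst_to_Wl (cext \<beta>)))
        = (\<Oplus>\<^bsub>X\<^esub>\<alpha>\<in>\<Phi>pos. (1/4) \<odot>\<^bsub>X\<^esub> half_term \<alpha> \<beta>)" .
  qed auto
  also have "\<dots> = (\<Oplus>\<^bsub>X\<^esub>\<alpha>\<in>\<Phi>pos. \<Oplus>\<^bsub>X\<^esub>\<beta>\<in>\<Phi>pos. (1/4) \<odot>\<^bsub>X\<^esub> half_term \<alpha> \<beta>)"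
    by (rule X.finsum_finsum_swap) auto
  also have "\<dots> = (1/4) \<odot>\<^bsub>X\<^esub> (\<Oplus>\<^bsub>X\<^esub>\<alpha>\<in>\<Phi>pos. \<Oplus>\<^bsub>X\<^esub>\<beta>\<in>\<Phi>pos. half_term \<alpha> \<beta>)"
    by (subst X.finsum_smult[symmetric]; (intro X.finsum_eqI)?) (auto simp: X.finsum_smult)
  finally show ?thesis .
qed

text \<open>The scalars are the coordinates of \<open>vu i\<close> in the basis \<open>v\<close>, so
  by linearity of \<open>tilde\<close> the inner sum replaces \<open>v j\<close> by
  \<open>vu i\<close>.\<close>

lemma sum_contracted_tilde:
  "(\<Oplus>\<^bsub>X\<^esub>i\<in>I. \<Oplus>\<^bsub>X\<^esub>j\<in>I. vs j (vu i) \<odot>\<^bsub>X\<^esub> tens D (tilde D (v j) \<cdot> tilde D (v i)) \<one>\<^bsub>Wl\<^esub>)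
    = tens D (\<Omega>H \<ominus>\<^bsub>H\<^esub> Ws (Omega_W D)) \<one>\<^bsub>Wl\<^esub>"
proof -
  have "(\<Oplus>\<^bsub>X\<^esub>j\<in>I. vs j (vu i) \<odot>\<^bsub>X\<^esub> tens D (tilde D (v j) \<cdot> tilde D (v i)) \<one>\<^bsub>Wl\<^esub>)
      = tens D (tilde D (vu i) \<cdot> tilde D (v i)) \<one>\<^bsub>Wl\<^esub>" for i
  proof -
    have "lin_into X (\<lambda>u. tens D (tilde D u \<cdot> tilde D (v i)) \<one>\<^bsub>Wl\<^esub>)"
      by (auto simp: lin_into_def tilde H.l_distr H.smult_mult_l tens_add_l tens_smult_l simp del: split_paired_All)
    from X.lin_into_sum[OF this, of "\<lambda>j. vs j (vu i)" v I] show ?thesis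
      by (simp add: vs_expansion)
  qed
  then show ?thesis
    by (simp add: tilde(1) flip: tens_finsum_l sum_tilde_tilde)
qed

section \<open>The two formulas for the commutator of D+ and D-\<close>

lemma Omega_W_closed [simp]: "Omega_W D \<in> carrier C" "Omega_W' D \<in> carrier C"
  using Omega_W_inv Omega_W'_inv by (auto simp: CW_inv_def)

abbreviation "pair_sum \<equiv> \<Oplus>\<^bsub>X\<^esub>p\<in>pos_root_pairs D. on_pair pair_term p"

lemma pair_sum_closed [simp]: "pair_sum \<in> carrier X"
  unfolding pair_sum_eq by auto

lemma commutator_D_plus_D_minus:
  "commutator X (D_plus D I v vu) (D_minus D I v vs) =
    \<ominus>\<^bsub>X\<^esub> tens D \<Omega>H \<one>\<^bsub>Wl\<^esub> \<oplus>\<^bsub>X\<^esub> tens D (Ws (Omega_W D)) \<one>\<^bsub>Wl\<^esub> \<ominus>\<^bsub>X\<^esub> (1/4) \<odot>\<^bsub>X\<^esub> pair_sum"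
proof -
  have cl: "tilde D u \<in> carrier H" "V_to_Wl u \<in> carrier Wl" for u using tilde V_to_Wl by auto
  have "commutator X (D_plus D I v vu) (D_minus D I v vs)
      = (\<Oplus>\<^bsub>X\<^esub>i\<in>I. \<Oplus>\<^bsub>X\<^esub>j\<in>I. commutator X (tens D (tilde D (v i)) (V_to_Wl (vu i))) (tens D (tilde D (v j)) (Vst_to_Wl (vs j))))"
    unfolding D_plus_def D_minus_def
    by (subst X.commutator_finsum_l) (auto simp: cl X.commutator_finsum_r intro!: X.finsum_eqI)
  also have "\<dots> = (\<Oplus>\<^bsub>X\<^esub>i\<in>I. (\<Oplus>\<^bsub>X\<^esub>j\<in>I. tens D (commutator H (tilde D (v i)) (tilde D (v j))) (V_to_Wl (vu i) \<bullet> Vst_to_Wl (vs j)))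
      \<ominus>\<^bsub>X\<^esub> (\<Oplus>\<^bsub>X\<^esub>j\<in>I. vs j (vu i) \<odot>\<^bsub>X\<^esub> tens D (tilde D (v j) \<cdot> tilde D (v i)) \<one>\<^bsub>Wl\<^esub>))"
    by (intro X.finsum_eqI, subst X.finsum_diff[symmetric]; (intro X.finsum_eqI)?) (auto simp: cl commutator_tens)
  also have "\<dots> = \<ominus>\<^bsub>X\<^esub> ((1/4) \<odot>\<^bsub>X\<^esub> pair_sum) \<ominus>\<^bsub>X\<^esub> tens D (\<Omega>H \<ominus>\<^bsub>H\<^esub> Ws (Omega_W D)) \<one>\<^bsub>Wl\<^esub>"
    by (subst X.finsum_diff) (auto simp: cl sum_commutator_tilde sum_contracted_tilde pair_sum_eq)
  also have "tens D (\<Omega>H \<ominus>\<^bsub>H\<^esub> Ws (Omega_W D)) \<one>\<^bsub>Wl\<^esub> = tens D \<Omega>H \<one>\<^bsub>Wl\<^esub> \<ominus>\<^bsub>X\<^esub> tens D (Ws (Omega_W D)) \<one>\<^bsub>Wl\<^esub>"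
    by (simp add: H.minus_eq X.minus_eq tens_add_l tens_minus_l)
  also have "\<ominus>\<^bsub>X\<^esub> p \<ominus>\<^bsub>X\<^esub> (a \<ominus>\<^bsub>X\<^esub> b) = \<ominus>\<^bsub>X\<^esub> a \<oplus>\<^bsub>X\<^esub> b \<ominus>\<^bsub>X\<^esub> p"
    if "p \<in> carrier X" "a \<in> carrier X" "b \<in> carrier X" for p a b
    using that by algebra
  finally show ?thesis by simp
qed

text \<open>The two summands of \<open>Delta_comm\<close> lie in different tensor factors and
  commute, so the square has the mixed term exactly twice.\<close>

lemma Delta_comm_square:
  assumes "\<alpha> \<in> roots D" "\<beta> \<in> roots D"
  shows "pair_coeff D \<alpha> \<beta> \<odot>\<^bsub>X\<^esub> (Delta_comm D I v vs \<alpha> \<beta> [^]\<^bsub>X\<^esub> (2::nat))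
    = tens D (Ws (pair_coeff D \<alpha> \<beta> \<odot>\<^bsub>C\<^esub> (c\<sigma> \<alpha> \<beta> [^]\<^bsub>C\<^esub> (2::nat)))) \<one>\<^bsub>Wl\<^esub>
      \<oplus>\<^bsub>X\<^esub> (pair_term \<alpha> \<beta> \<oplus>\<^bsub>X\<^esub> pair_term \<alpha> \<beta>)
      \<oplus>\<^bsub>X\<^esub> tens D \<one>\<^bsub>H\<^esub> (pair_coeff D \<alpha> \<beta> \<odot>\<^bsub>Wl\<^esub> (\<nu> \<alpha> \<beta> [^]\<^bsub>Wl\<^esub> (2::nat)))"
proof -
  have cl: "c\<sigma> \<alpha> \<beta> \<in> carrier C" "Ws (c\<sigma> \<alpha> \<beta>) \<in> carrier H" "\<nu> \<alpha> \<beta> \<in> carrier Wl" using assms by auto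
  let ?a = "tens D (Ws (c\<sigma> \<alpha> \<beta>)) \<one>\<^bsub>Wl\<^esub>" and ?b = "tens D \<one>\<^bsub>H\<^esub> (\<nu> \<alpha> \<beta>)" and ?m = "tens D (Ws (c\<sigma> \<alpha> \<beta>)) (\<nu> \<alpha> \<beta>)"
  have ab: "?a \<otimes>\<^bsub>X\<^esub> ?b = ?m" "?b \<otimes>\<^bsub>X\<^esub> ?a = ?m" using cl by (simp_all add: tens_mult)
  have "Delta_comm D I v vs \<alpha> \<beta> [^]\<^bsub>X\<^esub> (2::nat) = (?a \<oplus>\<^bsub>X\<^esub> ?b) \<otimes>\<^bsub>X\<^esub> (?a \<oplus>\<^bsub>X\<^esub> ?b)"
    unfolding Delta_comm_def using cl by (intro X.pow_2) auto
  also have "\<dots> = ?a \<otimes>\<^bsub>X\<^esub> ?a \<oplus>\<^bsub>X\<^esub> (?m \<oplus>\<^bsub>X\<^esub> ?m) \<oplus>\<^bsub>X\<^esub> ?b \<otimes>\<^bsub>X\<^esub> ?b"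
    using cl by (simp add: X.l_distr X.r_distr ab X.a_assoc)
  finally show ?thesis
    using cl by (simp add: X.smult_r_distr pair_term_def tens_mult tens_smult_l tens_smult_r
        Ws.hom_smult Ws.hom_nat_pow C.pow_2 H.pow_2 Wl.pow_2 Ws.hom_mult)
qed

lemma Delta_Omega_W'_eq:
  "Delta_Omega_W' D I v vs = tens D (Ws (Omega_W' D)) \<one>\<^bsub>Wl\<^esub> \<oplus>\<^bsub>X\<^esub> (1/4) \<odot>\<^bsub>X\<^esub> pair_sum
    \<oplus>\<^bsub>X\<^esub> tens D \<one>\<^bsub>H\<^esub> (nu'_Omega_W' D I v vs)"
proof -
  let ?SS = "\<lambda>f. \<Oplus>\<^bsub>X\<^esub>\<alpha>\<in>\<Phi>pos. \<Oplus>\<^bsub>X\<^esub>\<beta>\<in>\<Phi>pos. f \<alpha> \<beta>"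
  let ?p = "\<lambda>\<alpha> \<beta>. pair_coeff D \<alpha> \<beta> \<odot>\<^bsub>C\<^esub> (c\<sigma> \<alpha> \<beta> [^]\<^bsub>C\<^esub> (2::nat))"
  let ?q = "\<lambda>\<alpha> \<beta>. pair_coeff D \<alpha> \<beta> \<odot>\<^bsub>Wl\<^esub> (\<nu> \<alpha> \<beta> [^]\<^bsub>Wl\<^esub> (2::nat))"
  have SS_add: "?SS (\<lambda>\<alpha> \<beta>. f \<alpha> \<beta> \<oplus>\<^bsub>X\<^esub> g \<alpha> \<beta>) = ?SS f \<oplus>\<^bsub>X\<^esub> ?SS g"
    if "\<And>\<alpha> \<beta>. \<lbrakk>\<alpha> \<in> \<Phi>pos; \<beta> \<in> \<Phi>pos\<rbrakk> \<Longrightarrow> f \<alpha> \<beta> \<in> carrier X" "\<And>\<alpha> \<beta>. \<lbrakk>\<alpha> \<in> \<Phi>pos; \<beta> \<in> \<Phi>pos\<rbrakk> \<Longrightarrow> g \<alpha> \<beta> \<in> carrier X"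
    for f g
    using that by (subst X.finsum_add[symmetric]; (intro X.finsum_eqI)?) (auto simp: X.finsum_add)
  have pt: "pair_term \<alpha> \<beta> \<in> carrier X" if "\<alpha> \<in> \<Phi>pos" "\<beta> \<in> \<Phi>pos" for \<alpha> \<beta>
    using that by (auto simp: pair_term_def)
  have SS_pt: "?SS pair_term = pair_sum \<oplus>\<^bsub>X\<^esub> pair_sum"
  proof -
    have "?SS pair_term = ?SS (\<lambda>\<alpha> \<beta>. half_term \<alpha> \<beta> \<oplus>\<^bsub>X\<^esub> half_term \<beta> \<alpha>)"
      by (intro X.finsum_eqI) (auto simp: pair_term_eq)
    also have "\<dots> = ?SS half_term \<oplus>\<^bsub>X\<^esub> ?SS (\<lambda>\<alpha> \<beta>. half_term \<beta> \<alpha>)"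
      by (rule SS_add) auto
    also have "?SS (\<lambda>\<alpha> \<beta>. half_term \<beta> \<alpha>) = ?SS half_term"
      by (rule X.finsum_finsum_swap) auto
    finally show ?thesis by (simp add: pair_sum_eq)
  qed
  have P: "(1/16) \<odot>\<^bsub>X\<^esub> ?SS (\<lambda>\<alpha> \<beta>. tens D (Ws (?p \<alpha> \<beta>)) \<one>\<^bsub>Wl\<^esub>) = tens D (Ws (Omega_W' D)) \<one>\<^bsub>Wl\<^esub>"
  proof -
    have "Ws (\<Oplus>\<^bsub>C\<^esub>\<alpha>\<in>\<Phi>pos. \<Oplus>\<^bsub>C\<^esub>\<beta>\<in>\<Phi>pos. ?p \<alpha> \<beta>) = (\<Oplus>\<^bsub>H\<^esub>\<alpha>\<in>\<Phi>pos. \<Oplus>\<^bsub>H\<^esub>\<beta>\<in>\<Phi>pos. Ws (?p \<alpha> \<beta>))"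
      by (subst Ws.hom_finsum; (rule H.finsum_eqI)?) (auto simp: Ws.hom_finsum)
    then have "tens D (Ws (\<Oplus>\<^bsub>C\<^esub>\<alpha>\<in>\<Phi>pos. \<Oplus>\<^bsub>C\<^esub>\<beta>\<in>\<Phi>pos. ?p \<alpha> \<beta>)) \<one>\<^bsub>Wl\<^esub> = ?SS (\<lambda>\<alpha> \<beta>. tens D (Ws (?p \<alpha> \<beta>)) \<one>\<^bsub>Wl\<^esub>)"
      by (simp, subst tens_finsum_l; (intro X.finsum_eqI)?) (auto simp: tens_finsum_l)
    moreover have "(\<Oplus>\<^bsub>C\<^esub>\<alpha>\<in>\<Phi>pos. \<Oplus>\<^bsub>C\<^esub>\<beta>\<in>\<Phi>pos. ?p \<alpha> \<beta>) \<in> carrier C" by auto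
    ultimately show ?thesis
      unfolding Omega_W'_def by (simp only: Ws.hom_smult Ws.hom_closed tens_smult_l Wl.one_closed)
  qed
  have Q: "(1/16) \<odot>\<^bsub>X\<^esub> ?SS (\<lambda>\<alpha> \<beta>. tens D \<one>\<^bsub>H\<^esub> (?q \<alpha> \<beta>)) = tens D \<one>\<^bsub>H\<^esub> (nu'_Omega_W' D I v vs)"
  proof -
    have "tens D \<one>\<^bsub>H\<^esub> (\<Oplus>\<^bsub>Wl\<^esub>\<alpha>\<in>\<Phi>pos. \<Oplus>\<^bsub>Wl\<^esub>\<beta>\<in>\<Phi>pos. ?q \<alpha> \<beta>) = ?SS (\<lambda>\<alpha> \<beta>. tens D \<one>\<^bsub>H\<^esub> (?q \<alpha> \<beta>))"
      by (subst tens_finsum_r; (intro X.finsum_eqI)?) (auto simp: tens_finsum_r)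
    moreover have "(\<Oplus>\<^bsub>Wl\<^esub>\<alpha>\<in>\<Phi>pos. \<Oplus>\<^bsub>Wl\<^esub>\<beta>\<in>\<Phi>pos. ?q \<alpha> \<beta>) \<in> carrier Wl" by auto
    ultimately show ?thesis
      unfolding nu'_Omega_W'_def by (simp only: tens_smult_r H.one_closed)
  qed
  have "Delta_Omega_W' D I v vs = (1/16) \<odot>\<^bsub>X\<^esub> ?SS (\<lambda>\<alpha> \<beta>. tens D (Ws (?p \<alpha> \<beta>)) \<one>\<^bsub>Wl\<^esub>
      \<oplus>\<^bsub>X\<^esub> (pair_term \<alpha> \<beta> \<oplus>\<^bsub>X\<^esub> pair_term \<alpha> \<beta>) \<oplus>\<^bsub>X\<^esub> tens D \<one>\<^bsub>H\<^esub> (?q \<alpha> \<beta>))"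
    unfolding Delta_Omega_W'_def
    by (intro arg_cong[of _ _ "smult X (1/16)"] X.finsum_eqI) (auto simp: Delta_comm_square pt)
  also have "?SS (\<lambda>\<alpha> \<beta>. tens D (Ws (?p \<alpha> \<beta>)) \<one>\<^bsub>Wl\<^esub>
      \<oplus>\<^bsub>X\<^esub> (pair_term \<alpha> \<beta> \<oplus>\<^bsub>X\<^esub> pair_term \<alpha> \<beta>) \<oplus>\<^bsub>X\<^esub> tens D \<one>\<^bsub>H\<^esub> (?q \<alpha> \<beta>))
      = ?SS (\<lambda>\<alpha> \<beta>. tens D (Ws (?p \<alpha> \<beta>)) \<one>\<^bsub>Wl\<^esub>) \<oplus>\<^bsub>X\<^esub> (?SS pair_term \<oplus>\<^bsub>X\<^esub> ?SS pair_term)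
        \<oplus>\<^bsub>X\<^esub> ?SS (\<lambda>\<alpha> \<beta>. tens D \<one>\<^bsub>H\<^esub> (?q \<alpha> \<beta>))"
  proof -
    have "?SS (\<lambda>\<alpha> \<beta>. tens D (Ws (?p \<alpha> \<beta>)) \<one>\<^bsub>Wl\<^esub> \<oplus>\<^bsub>X\<^esub> (pair_term \<alpha> \<beta> \<oplus>\<^bsub>X\<^esub> pair_term \<alpha> \<beta>))
        = ?SS (\<lambda>\<alpha> \<beta>. tens D (Ws (?p \<alpha> \<beta>)) \<one>\<^bsub>Wl\<^esub>) \<oplus>\<^bsub>X\<^esub> ?SS (\<lambda>\<alpha> \<beta>. pair_term \<alpha> \<beta> \<oplus>\<^bsub>X\<^esub> pair_term \<alpha> \<beta>)"
      by (rule SS_add) (auto simp: pt)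
    also have "?SS (\<lambda>\<alpha> \<beta>. pair_term \<alpha> \<beta> \<oplus>\<^bsub>X\<^esub> pair_term \<alpha> \<beta>) = ?SS pair_term \<oplus>\<^bsub>X\<^esub> ?SS pair_term"
      by (rule SS_add) (auto simp: pt)
    finally have "?SS (\<lambda>\<alpha> \<beta>. tens D (Ws (?p \<alpha> \<beta>)) \<one>\<^bsub>Wl\<^esub> \<oplus>\<^bsub>X\<^esub> (pair_term \<alpha> \<beta> \<oplus>\<^bsub>X\<^esub> pair_term \<alpha> \<beta>))
        = ?SS (\<lambda>\<alpha> \<beta>. tens D (Ws (?p \<alpha> \<beta>)) \<one>\<^bsub>Wl\<^esub>) \<oplus>\<^bsub>X\<^esub> (?SS pair_term \<oplus>\<^bsub>X\<^esub> ?SS pair_term)" .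
    moreover have "?SS (\<lambda>\<alpha> \<beta>. tens D (Ws (?p \<alpha> \<beta>)) \<one>\<^bsub>Wl\<^esub> \<oplus>\<^bsub>X\<^esub> (pair_term \<alpha> \<beta> \<oplus>\<^bsub>X\<^esub> pair_term \<alpha> \<beta>)
          \<oplus>\<^bsub>X\<^esub> tens D \<one>\<^bsub>H\<^esub> (?q \<alpha> \<beta>))
        = ?SS (\<lambda>\<alpha> \<beta>. tens D (Ws (?p \<alpha> \<beta>)) \<one>\<^bsub>Wl\<^esub> \<oplus>\<^bsub>X\<^esub> (pair_term \<alpha> \<beta> \<oplus>\<^bsub>X\<^esub> pair_term \<alpha> \<beta>))
          \<oplus>\<^bsub>X\<^esub> ?SS (\<lambda>\<alpha> \<beta>. tens D \<one>\<^bsub>H\<^esub> (?q \<alpha> \<beta>))"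
      by (rule SS_add) (auto simp: pt)
    ultimately show ?thesis by (simp only:)
  qed
  also have "(1/16) \<odot>\<^bsub>X\<^esub> \<dots> = (1/16) \<odot>\<^bsub>X\<^esub> ?SS (\<lambda>\<alpha> \<beta>. tens D (Ws (?p \<alpha> \<beta>)) \<one>\<^bsub>Wl\<^esub>)
      \<oplus>\<^bsub>X\<^esub> (1/16) \<odot>\<^bsub>X\<^esub> (?SS pair_term \<oplus>\<^bsub>X\<^esub> ?SS pair_term)
      \<oplus>\<^bsub>X\<^esub> (1/16) \<odot>\<^bsub>X\<^esub> ?SS (\<lambda>\<alpha> \<beta>. tens D \<one>\<^bsub>H\<^esub> (?q \<alpha> \<beta>))"
    by (subst X.smult_r_distr, force simp: pt, force, subst X.smult_r_distr, force, force simp: pt, rule refl)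
  also have "(1/16) \<odot>\<^bsub>X\<^esub> (?SS pair_term \<oplus>\<^bsub>X\<^esub> ?SS pair_term) = (1/4) \<odot>\<^bsub>X\<^esub> pair_sum"
  proof -
    \<comment> \<open>Four copies of 1/16: two from the mixed term of the square, and two because
      ordered pairs count each unordered pair twice.\<close>
    have "(1/4) \<odot>\<^bsub>X\<^esub> pair_sum = (1/16 + 1/16 + (1/16 + 1/16)) \<odot>\<^bsub>X\<^esub> pair_sum" by simp
    also have "\<dots> = (1/16) \<odot>\<^bsub>X\<^esub> (pair_sum \<oplus>\<^bsub>X\<^esub> pair_sum \<oplus>\<^bsub>X\<^esub> (pair_sum \<oplus>\<^bsub>X\<^esub> pair_sum))"
      by (simp only: X.smult_l_distr X.smult_r_distr pair_sum_closed X.a_closed)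
    finally show ?thesis by (simp add: SS_pt)
  qed
  finally show ?thesis unfolding P Q .
qed

lemma nu'_Omega_W'_closed [simp]: "nu'_Omega_W' D I v vs \<in> carrier Wl"
  unfolding nu'_Omega_W'_def by auto

text \<open>\<open>Delta_Omega_W'_eq\<close> is solved for the sum over pairs and inserted into the
  first formula; the square terms of both tensor factors reappear with the opposite sign.\<close>

lemma commutator_D_plus_D_minus':
  "commutator X (D_plus D I v vu) (D_minus D I v vs) =
    tens D (\<ominus>\<^bsub>H\<^esub> \<Omega>H \<oplus>\<^bsub>H\<^esub> Ws (Omega_W D) \<oplus>\<^bsub>H\<^esub> Ws (Omega_W' D)) \<one>\<^bsub>Wl\<^esub>
    \<ominus>\<^bsub>X\<^esub> Delta_Omega_W' D I v vs \<oplus>\<^bsub>X\<^esub> tens D \<one>\<^bsub>H\<^esub> (nu'_Omega_W' D I v vs)"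
proof -
  have alg: "\<ominus>\<^bsub>X\<^esub> a \<oplus>\<^bsub>X\<^esub> b \<ominus>\<^bsub>X\<^esub> p = \<ominus>\<^bsub>X\<^esub> a \<oplus>\<^bsub>X\<^esub> b \<oplus>\<^bsub>X\<^esub> c \<ominus>\<^bsub>X\<^esub> (c \<oplus>\<^bsub>X\<^esub> p \<oplus>\<^bsub>X\<^esub> q) \<oplus>\<^bsub>X\<^esub> q"
    if "a \<in> carrier X" "b \<in> carrier X" "c \<in> carrier X" "p \<in> carrier X" "q \<in> carrier X" for a b c p q
    using that by algebra
  show ?thesis
    unfolding commutator_D_plus_D_minus Delta_Omega_W'_eq
    by (simp add: tens_add_l tens_minus_l) (rule alg; simp)
qed

end

theorem theorem4p5:
  fixes D :: "'v::real_vector hecke_datum"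
    and I :: "'i set"
    and v vu :: "'i \<Rightarrow> 'v cx"
    and vs :: "'i \<Rightarrow> 'v cx \<Rightarrow> complex"
  assumes "real_root_system D"
    and "simple_system D"
    and "invariant_form D"
    and "invariant_param D"
    and "basis_with_duals D I v vu vs"
  shows "Omega_H D I v vu \<in> alg_center (hecke_algebra D)
    \<and> Omega_W D \<in> CW_inv D
    \<and> Omega_W' D \<in> CW_inv D
    \<and> commutator (HW D) (D_plus D I v vu) (D_minus D I v vs) =
        \<ominus>\<^bsub>HW D\<^esub> tens D (Omega_H D I v vu) \<one>\<^bsub>weyl_algebra\<^esub>
        \<oplus>\<^bsub>HW D\<^esub> tens D (W_to_H D (Omega_W D)) \<one>\<^bsub>weyl_algebra\<^esub>
        \<ominus>\<^bsub>HW D\<^esub> (1/4) \<odot>\<^bsub>HW D\<^esub> (\<Oplus>\<^bsub>HW D\<^esub>p\<in>pos_root_pairs D. on_pair (\<lambda>\<alpha> \<beta>.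
            pair_coeff D \<alpha> \<beta> \<odot>\<^bsub>HW D\<^esub>
              tens D (W_to_H D (commutator (CW D) (sW D \<alpha>) (sW D \<beta>))) (nu'_comm D I v vs \<alpha> \<beta>)) p)
    \<and> commutator (HW D) (D_plus D I v vu) (D_minus D I v vs) =
        tens D (\<ominus>\<^bsub>hecke_algebra D\<^esub> Omega_H D I v vu
                \<oplus>\<^bsub>hecke_algebra D\<^esub> W_to_H D (Omega_W D)
                \<oplus>\<^bsub>hecke_algebra D\<^esub> W_to_H D (Omega_W' D)) \<one>\<^bsub>weyl_algebra\<^esub>
        \<ominus>\<^bsub>HW D\<^esub> Delta_Omega_W' D I v vs
        \<oplus>\<^bsub>HW D\<^esub> tens D \<one>\<^bsub>hecke_algebra D\<^esub> (nu'_Omega_W' D I v vs)"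
proof -
  interpret root_datum_basis D I v vu vs
    using assms by unfold_locales
  show ?thesis
    using Omega_H_central Omega_W_inv Omega_W'_inv commutator_D_plus_D_minus
      commutator_D_plus_D_minus'
    by (simp only: pair_term_def[abs_def] simp_thms)
qed

end
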